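(* Let $p$ be a prime with $p\neq 5$ and $p\neq 7$, and let $a\in\mathbb{Z}$. Then there is a squarefree, $p$-smooth, positive integer $n$ such that $n\equiv a\pmod{p}$.
   Context: An integer $n$ is called $y$-smooth if every prime divisor of $n$ is at most $y$. *)

theory Defs
  imports
    "HOL-Number_Theory.Cong"
    "HOL-Computational_Algebra.Squarefree"
    Complex_Main
begin

definition smooth :: "real \<Rightarrow> int \<Rightarrow> bool" where
  "smooth y n \<longleftrightarrow> (\<forall>q::int. prime q \<longrightarrow> q dvd n \<longrightarrow> of_int q \<le> y)"

end

theory Submission
  imports Defs "HOL-Number_Theory.Residue_Primitive_Roots" "HOL-Algebra.Generated_Groups"
begin

text \<open>If \<open>p\<close> divides \<open>a\<close>, take \<open>n = p\<close>. Otherwise it suffices that the products of distinct primes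
  below \<open>p\<close> cover the group \<open>G\<close> of units modulo \<open>p\<close>.

  For \<open>p > 3000\<close>, measure the effect of multiplying a set \<open>X\<close> by \<open>g\<close> by the number of elements of
  \<open>g X - X\<close>. This number is subadditive in \<open>g\<close> and large on average, so some element \<open>b\<close> of any set \<open>C\<close>
  generating a subgroup \<open>H\<close> adds a number of elements proportional to \<open>|C|\<close> to \<open>X\<close>, as long as \<open>X\<close> fills at
  most half of \<open>H\<close>. Hence few primes have subset products filling more than half of \<open>H\<close>, and two disjoint
  such families fill \<open>H\<close>, provided that removing a few primes from \<open>H\<close> leaves a generating set; if this
  fails for \<open>H\<close>, pass to a proper subgroup that still contains most primes. The resulting subgroup \<open>H\<close>
  has small index, and the remaining primes cover \<open>G / H\<close> by the argument behind Kneser's theorem if every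
  proper subgroup \<open>K\<close> of index \<open>k\<close> above \<open>H\<close> misses at least \<open>k - 1\<close> primes. Otherwise all integers below
  \<open>p\<close> free of at most \<open>k - 2\<close> given primes lie in \<open>K\<close>, and a sieve shows that there are more than
  \<open>(p - 1) / k\<close> of them.

  For smaller \<open>p\<close>, exhibit a primitive root and primes whose discrete logarithms have subset sums
  covering all exponents.\<close>

section \<open>Growth of product sets in finite abelian groups\<close>

text \<open>The primes 5 and 7 are genuine exceptions: subset products of 2, 3 modulo 5 and of 2, 3,
  5 modulo 7 never equal 4. For large \<open>p\<close> the obstacle is that nothing is assumed about
  how the primes below \<open>p\<close> spread over residue classes; most of them might lie in a
  proper subgroup. Passing to a proper subgroup at least halves the order but loses a bounded number
  of primes, so it can happen only logarithmically often. Two facts about primes enter: a lower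
  bound for their number, of order \<open>n / log n\<close> from the least common multiple of 1,
  ..., \<open>n\<close>, and the factorisation of each integer below \<open>p\<close> into primes
  below \<open>p\<close>. The latter turns "few primes outside \<open>K\<close>" into "many integers
  inside \<open>K\<close>". Just above 3000 the first bound is too weak for the numerical
  conditions, and the exact count of primes replaces it.\<close>

context comm_group
begin

section \<open>Translates and the excess of a set\<close>

abbreviation shift :: "'a \<Rightarrow> 'a set \<Rightarrow> 'a set"
  where "shift g X \<equiv> (\<lambda>x. g \<otimes> x) ` X"

definition excess :: "'a set \<Rightarrow> 'a \<Rightarrow> nat"
  where "excess X g = card (shift g X - X)"

lemma shift_mult:
  assumes "X \<subseteq> carrier G" "g \<in> carrier G" "h \<in> carrier G"
  shows "shift (g \<otimes> h) X = shift g (shift h X)"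
  using assms by (force simp: image_image m_assoc intro!: image_cong)

lemma shift_one:
  assumes "X \<subseteq> carrier G"
  shows "shift \<one> X = X"
  using assms by (force simp: image_iff)

lemma card_shift:
  assumes "X \<subseteq> carrier G" "g \<in> carrier G"
  shows "card (shift g X) = card X"
  by (rule card_image, rule inj_onI) (use assms in \<open>auto simp: subset_iff\<close>)

lemma excess_one: "X \<subseteq> carrier G \<Longrightarrow> excess X \<one> = 0"
  by (simp add: excess_def shift_one)

lemma excess_plus_card_Int:
  assumes "finite X" "X \<subseteq> carrier G" "g \<in> carrier G"
  shows "excess X g + card (shift g X \<inter> X) = card X"
  using card_shift[OF assms(2,3)] assms(1)
  by (metis excess_def card_Diff_subset_Int finite_imageI finite_Int le_add_diff_inverse2 card_mono Int_lower1)

lemma excess_inv: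
  assumes "finite X" "X \<subseteq> carrier G" "g \<in> carrier G"
  shows "excess X (inv g) = excess X g"
proof -
  \<comment> \<open>Multiplication by \<open>g\<close> carries the intersection for
    \<open>inv g\<close> bijectively onto the one for \<open>g\<close>; the excess is
    \<open>card X\<close> minus the size of the intersection.\<close>
  have "shift g (shift (inv g) X \<inter> X) = shift g X \<inter> X"
  proof -
    have "shift g (shift (inv g) X \<inter> X) = shift g (shift (inv g) X) \<inter> shift g X"
      by (rule inj_on_image_Int[where C = "carrier G"]) (use assms in \<open>auto intro!: inj_onI\<close>)
    also have "shift g (shift (inv g) X) = X"
      using shift_mult[of X g "inv g"] assms by (simp add: shift_one)
    finally show ?thesis by auto
  qed
  then have "card (shift (inv g) X \<inter> X) = card (shift g X \<inter> X)"
    using card_shift[of "shift (inv g) X \<inter> X" g] assms by (simp add: le_infI2)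
  then show ?thesis
    using excess_plus_card_Int[of X g] excess_plus_card_Int[of X "inv g"] assms by simp
qed

text \<open>An element \<open>g h x\<close> outside \<open>X\<close> comes from \<open>h x\<close>
  outside \<open>X\<close>, and is then a translate by \<open>g\<close> of a point of
  \<open>shift h X - X\<close>, or from \<open>h x\<close> in \<open>X\<close>, and then lies in
  \<open>shift g X - X\<close>.\<close>

lemma excess_mult:
  assumes "finite X" "X \<subseteq> carrier G" "g \<in> carrier G" "h \<in> carrier G"
  shows "excess X (g \<otimes> h) \<le> excess X g + excess X h"
proof -
  have "shift (g \<otimes> h) X - X \<subseteq> shift g (shift h X - X) \<union> (shift g X - X)"
    using assms by (auto simp: shift_mult)
  then have "excess X (g \<otimes> h) \<le> card (shift g (shift h X - X) \<union> (shift g X - X))"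
    unfolding excess_def using assms(1) by (intro card_mono) auto
  also have "\<dots> \<le> card (shift g (shift h X - X)) + card (shift g X - X)"
    by (rule card_Un_le)
  also have "card (shift g (shift h X - X)) = excess X h"
    unfolding excess_def using assms by (intro card_shift) auto
  finally show ?thesis by (simp add: excess_def)
qed

text \<open>A pair \<open>(x, y)\<close> in \<open>X\<close> is counted only by \<open>g = y / x\<close>.\<close>

lemma sum_excess_ge:
  assumes "finite X" "X \<subseteq> carrier G" "finite M" "M \<subseteq> carrier G"
  shows "card M * card X \<le> (\<Sum>g\<in>M. excess X g) + card X * card X"
proof -
  have "(\<Sum>g\<in>M. card (shift g X \<inter> X)) = card (SIGMA g:M. shift g X \<inter> X)"
    using assms by simp
  also have "\<dots> \<le> card (X \<times> X)"
  proof (rule card_inj_on_le)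
    show "inj_on (\<lambda>(g, y). (inv g \<otimes> y, y)) (SIGMA g:M. shift g X \<inter> X)"
    proof (rule inj_onI, clarify)
      fix g x x' g' y y'
      assume *: "g \<in> M" "g' \<in> M" "x \<in> X" "x' \<in> X" "inv g \<otimes> (g \<otimes> x) = inv g' \<otimes> (g' \<otimes> x')"
        "g \<otimes> x = g' \<otimes> x'" "g' \<otimes> x' \<in> X"
      have c: "g \<in> carrier G" "g' \<in> carrier G" "x \<in> carrier G" "x' \<in> carrier G"
        using * assms by auto
      then have "x = x'"
        using *(5) by (simp add: m_assoc[symmetric])
      then show "g = g'"
        using c *(6) by simp
    qed
    show "(\<lambda>(g, y). (inv g \<otimes> y, y)) ` (SIGMA g:M. shift g X \<inter> X) \<subseteq> X \<times> X"
      using assms by (auto simp: m_assoc[symmetric] subset_iff)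
  qed (use assms in auto)
  finally have "(\<Sum>g\<in>M. card (shift g X \<inter> X)) \<le> card X * card X"
    by (simp add: card_cartesian_product)
  moreover have "(\<Sum>g\<in>M. excess X g) + (\<Sum>g\<in>M. card (shift g X \<inter> X)) = card M * card X"
    unfolding sum.distrib[symmetric]
    using excess_plus_card_Int assms by (simp add: subset_iff)
  ultimately show ?thesis by linarith
qed

section \<open>Balls in the Cayley graph and averages over them\<close>

fun ball :: "'a set \<Rightarrow> nat \<Rightarrow> 'a set" where
  "ball W 0 = {\<one>}"
| "ball W (Suc n) = (\<Union>u\<in>W. shift u (ball W n))"

lemma ball_subset:
  assumes "subgroup H G" "W \<subseteq> H"
  shows "ball W n \<subseteq> H"
  using assms by (induction n) (auto simp: subgroup.one_closed intro!: subgroup.m_closed[of H])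

lemma ball_Suc_mono:
  assumes "W \<subseteq> carrier G" "\<one> \<in> W"
  shows "ball W n \<subseteq> ball W (Suc n)"
proof -
  have "shift \<one> (ball W n) = ball W n"
    using ball_subset[OF subgroup_self assms(1)] by (rule shift_one)
  with assms(2) show ?thesis by auto
qed

lemma ball_mono:
  assumes "W \<subseteq> carrier G" "\<one> \<in> W" "m \<le> n"
  shows "ball W m \<subseteq> ball W n"
  using ball_Suc_mono[OF assms(1,2)] assms(3) by (rule lift_Suc_mono_le)

lemma excess_ball:
  assumes "finite X" "X \<subseteq> carrier G" "W \<subseteq> carrier G" "\<And>u. u \<in> W \<Longrightarrow> excess X u \<le> l"
    and "g \<in> ball W n"
  shows "excess X g \<le> n * l"
  using assms(5)
proof (induction n arbitrary: g)
  case 0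
  then show ?case using assms by (simp add: excess_one)
next
  case (Suc n)
  then obtain u v where uv: "u \<in> W" "v \<in> ball W n" "g = u \<otimes> v" by auto
  moreover have "v \<in> carrier G"
    using uv ball_subset[OF subgroup_self assms(3)] by auto
  ultimately have "excess X g \<le> excess X u + excess X v"
    using assms by (auto intro!: excess_mult)
  with Suc.IH[OF uv(2)] assms(4)[OF uv(1)] show ?case by simp
qed

definition sym_closure :: "'a set \<Rightarrow> 'a set"
  where "sym_closure C = insert \<one> (C \<union> (\<lambda>x. inv x) ` C)"

text \<open>Once a further step gains nothing, the ball is closed under multiplication by the
  generators and their inverses, hence by all of \<open>generate G C\<close>; as it contains the
  unit, it is that subgroup.\<close>

lemma ball_stable:
  assumes C: "C \<subseteq> carrier G" and eq: "ball (sym_closure C) (Suc n) \<subseteq> ball (sym_closure C) n"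
  shows "ball (sym_closure C) n = generate G C"
proof
  have W: "sym_closure C \<subseteq> generate G C"
    by (auto simp: sym_closure_def intro: generate.intros)
  show "ball (sym_closure C) n \<subseteq> generate G C"
    by (rule ball_subset[OF generate_is_subgroup[OF C] W])
  let ?S = "ball (sym_closure C) n"
  have W': "sym_closure C \<subseteq> carrier G" "\<one> \<in> sym_closure C"
    using C by (auto simp: sym_closure_def)
  have Sc: "?S \<subseteq> carrier G" by (rule ball_subset[OF subgroup_self W'(1)])
  have step: "u \<otimes> s \<in> ?S" if "u \<in> sym_closure C" "s \<in> ?S" for u s
    using eq that by auto
  have "\<forall>s\<in>?S. g \<otimes> s \<in> ?S" if "g \<in> generate G C" for g
    using that
  proof (induction rule: generate.induct)
    case (eng h1 h2)
    then have "h1 \<in> carrier G" "h2 \<in> carrier G"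
      using generate_in_carrier[OF C] by auto
    with eng Sc show ?case by (auto simp: m_assoc subset_iff)
  qed (use step Sc in \<open>auto simp: sym_closure_def\<close>)
  moreover have "\<one> \<in> ?S"
    using ball_mono[OF W', of 0 n] by auto
  ultimately show "generate G C \<subseteq> ?S"
    using generate_in_carrier[OF C] by (metis r_one subsetI)
qed

text \<open>\<open>M\<close> is a union of disjoint translates of \<open>W\<close> by elements at distance 0, 3, 6, \<open>\<dots>\<close> from \<open>\<one>\<close>.\<close>

lemma ball_chain:
  fixes C X :: "'a set" and l :: nat
  defines "W \<equiv> sym_closure C"
  assumes X: "finite X" "X \<subseteq> carrier G" and C: "finite C" "C \<subseteq> carrier G"
    and l: "\<And>u. u \<in> W \<Longrightarrow> excess X u \<le> l"
    and ne: "\<And>i. 1 \<le> i \<Longrightarrow> i < j \<Longrightarrow> ball W (3 * i - 1) \<noteq> generate G C"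
    and j: "1 \<le> j"
  shows "\<exists>M. finite M \<and> M \<subseteq> ball W (3 * j - 2) \<and> card M = j * card W \<and>
    2 * (\<Sum>g\<in>M. excess X g) \<le> l * card W * j * (3 * j - 1)"
  using j ne
proof (induction j rule: nat_induct_at_least)
  case base
  have W: "W \<subseteq> carrier G" "finite W"
    using C by (auto simp: W_def sym_closure_def)
  have "W \<subseteq> ball W 1"
    using W by (auto simp: image_iff subset_iff)
  moreover have "(\<Sum>g\<in>W. excess X g) \<le> card W * l"
    using sum_bounded_above[of W "excess X" l] l by simp
  ultimately show ?case
    using W by (intro exI[of _ W]) (auto simp: mult_ac)
next
  case (Suc j)
  have W: "W \<subseteq> carrier G" "finite W" "\<one> \<in> W"
    using C by (auto simp: W_def sym_closure_def)
  obtain M where M: "finite M" "M \<subseteq> ball W (3 * j - 2)" "card M = j * card W"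
      "2 * (\<Sum>g\<in>M. excess X g) \<le> l * card W * j * (3 * j - 1)"
    using Suc.IH Suc.prems by force
  \<comment> \<open>Growth from radius \<open>3 j - 1\<close> to \<open>3 j\<close> supplies a
    centre \<open>g\<close> at word distance exactly \<open>3 j\<close>.\<close>
  have "ball W (3 * j - 1) \<noteq> generate G C"
    using Suc by auto
  then have "\<not> ball W (Suc (3 * j - 1)) \<subseteq> ball W (3 * j - 1)"
    using ball_stable[OF C(2), of "3 * j - 1"] unfolding W_def by blast
  moreover have "Suc (3 * j - 1) = 3 * j" using Suc.hyps by simp
  ultimately obtain g where g: "g \<in> ball W (3 * j)" "g \<notin> ball W (3 * j - 1)"
    by auto
  have gc: "g \<in> carrier G"
    using g(1) ball_subset[OF subgroup_self W(1)] by auto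
  \<comment> \<open>A common point would put \<open>g\<close> within distance
    \<open>3 j - 1\<close>, because \<open>M\<close> lies within distance
    \<open>3 j - 2\<close>.\<close>
  have disj: "M \<inter> shift g W = {}"
  proof (rule ccontr)
    assume "M \<inter> shift g W \<noteq> {}"
    then obtain u where u: "u \<in> W" "g \<otimes> u \<in> ball W (3 * j - 2)"
      using M(2) by auto
    have "inv u \<in> W"
      using u(1) C by (auto simp: W_def sym_closure_def)
    moreover have "g = inv u \<otimes> (g \<otimes> u)"
      using u(1) W gc by (metis inv_solve_left m_comm m_closed subsetD)
    ultimately have "g \<in> ball W (Suc (3 * j - 2))"
      using u(2) by auto
    moreover have "Suc (3 * j - 2) = 3 * j - 1" using Suc.hyps by simp
    ultimately show False using g(2) by simp
  qed
  have sub: "shift g W \<subseteq> ball W (3 * j + 1)"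
  proof
    fix y assume "y \<in> shift g W"
    then obtain u where "u \<in> W" "y = g \<otimes> u" by auto
    then have "y = u \<otimes> g" using W gc m_comm by auto
    with \<open>u \<in> W\<close> g(1) show "y \<in> ball W (3 * j + 1)" by auto
  qed
  have sumle: "(\<Sum>h\<in>shift g W. excess X h) \<le> card W * ((3 * j + 1) * l)"
  proof -
    have "(\<Sum>h\<in>shift g W. excess X h) \<le> of_nat (card (shift g W)) * ((3 * j + 1) * l)"
      by (rule sum_bounded_above) (use sub excess_ball[OF X W(1) l] in blast)
    then show ?thesis using card_shift[OF W(1) gc] by simp
  qed
  show ?case
  proof (intro exI[of _ "M \<union> shift g W"] conjI)
    show "finite (M \<union> shift g W)" using M W by auto
    have "ball W (3 * j - 2) \<subseteq> ball W (3 * j + 1)"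
      by (rule ball_mono[OF W(1,3)]) simp
    moreover have "3 * Suc j - 2 = 3 * j + 1" by simp
    ultimately show "M \<union> shift g W \<subseteq> ball W (3 * Suc j - 2)"
      using M(2) sub by (metis Un_least subset_trans)
    show "card (M \<union> shift g W) = Suc j * card W"
      using M W disj card_shift[OF W(1) gc] by (simp add: card_Un_disjoint)
    \<comment> \<open>The successive translates lie within distance 1, 4, 7, ..., so the bound is
      \<open>l * card W\<close> times the pentagonal number \<open>j (3 j - 1) / 2\<close>, doubled
      to avoid the division.\<close>
    have "2 * (\<Sum>h\<in>M \<union> shift g W. excess X h)
        = 2 * (\<Sum>h\<in>M. excess X h) + 2 * (\<Sum>h\<in>shift g W. excess X h)"
      using M W disj by (subst sum.union_disjoint) auto
    also have "\<dots> \<le> l * card W * j * (3 * j - 1) + 2 * (card W * ((3 * j + 1) * l))"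
      using M(4) sumle by linarith
    also have "\<dots> = l * card W * Suc j * (3 * Suc j - 1)"
      using Suc.hyps by (cases j) (auto simp: algebra_simps)
    finally show "2 * (\<Sum>h\<in>M \<union> shift g W. excess X h) \<le> l * card W * Suc j * (3 * Suc j - 1)" .
  qed
qed


text \<open>If every generator had excess at most \<open>l < w / 6\<close>, subadditivity would
  bound the excess at word distance \<open>d\<close> by \<open>d * l\<close>. Averaging over a set
  \<open>M\<close> forces a mean of at least \<open>x - x^2 / card M\<close>. The two conflict when
  \<open>M\<close> has about \<open>2 x\<close> elements spread over small distances, and if the
  Cayley graph is too small to hold such an \<open>M\<close>, the average over all of
  \<open>H\<close> gives the conflict.\<close>

lemma exists_excess_ge_sixth:
  fixes C X :: "'a set"
  defines "W \<equiv> sym_closure C" and "H \<equiv> generate G C"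
  assumes fin: "finite (carrier G)" and C: "C \<subseteq> carrier G" and X: "X \<subseteq> H"
    and half: "2 * card X \<le> card H" and large: "card W \<le> 4 * card X"
  shows "\<exists>b\<in>C. card W \<le> 6 * excess X b"
proof (rule ccontr)
  assume "\<not> ?thesis"
  then have small: "6 * excess X b < card W" if "b \<in> C" for b
    using that by force
  define w where "w = card W"
  define l where "l = (w - 1) div 6"
  define x where "x = card X"
  txt \<open>\<open>j\<close> is the integer nearest to \<open>2 x / w\<close>: the estimate for \<open>j\<close> translates of \<open>W\<close> is best then.\<close>
  define j where "j = (4 * x + w) div (2 * w)"
  have H: "subgroup H G" "H \<subseteq> carrier G" "finite H"
    using generate_is_subgroup[OF C] fin unfolding H_def
    by (simp_all add: subgroup.subset) (meson finite_subset subgroup.subset)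
  have Xc: "X \<subseteq> carrier G" "finite X"
    using X H finite_subset by auto
  have Cf: "finite C" using C fin finite_subset by auto
  have W: "finite W" "\<one> \<in> W" "W \<subseteq> carrier G"
    using C Cf by (auto simp: W_def sym_closure_def)
  then have w: "w > 0" by (auto simp: w_def card_gt_0_iff)
  have excC: "excess X b \<le> l" if "b \<in> C" for b
    using small[OF that] by (simp add: l_def w_def)
  have exc: "excess X u \<le> l" if "u \<in> W" for u
    using that excC Xc C unfolding W_def sym_closure_def
    by (auto simp: excess_one excess_inv subset_iff)
  have l: "6 * real l < real w" using w unfolding l_def by linarith
  have "j * (2 * w) \<le> 4 * x + w"
    unfolding j_def by (rule div_times_less_eq_dividend)
  then have "real (j * (2 * w)) \<le> real (4 * x + w)" by (simp only: of_nat_le_iff)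
  moreover have "4 * x + w < 2 * w + j * (2 * w)"
    unfolding j_def using w by (intro dividend_less_div_times) simp
  then have "real (4 * x + w) < real (2 * w + j * (2 * w))" by (simp only: of_nat_less_iff)
  ultimately have jx: "2 * real j * w \<le> 4 * real x + w" "4 * real x < 2 * real j * w + w"
    by (simp_all add: algebra_simps)
  \<comment> \<open>Here \<open>w \<le> 4 x\<close> is needed: it makes \<open>2 x / w\<close> round
    to at least 1.\<close>
  have j1: "1 \<le> j"
    using large w unfolding j_def x_def w_def by (simp add: div_greater_zero_iff Suc_le_eq)
  show False
  \<comment> \<open>Either there is room for \<open>j\<close> disjoint translates of
    \<open>W\<close>, or a ball of smaller radius is already all of \<open>H\<close>.\<close>
  proof (cases "\<forall>i. 1 \<le> i \<longrightarrow> i < j \<longrightarrow> ball W (3 * i - 1) \<noteq> H")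
    case True
    obtain M where M: "finite M" "M \<subseteq> ball W (3 * j - 2)" "card M = j * w"
        "2 * (\<Sum>g\<in>M. excess X g) \<le> l * w * j * (3 * j - 1)"
      using ball_chain[OF Xc(2,1) Cf C, of l j] exc True j1
      unfolding w_def W_def H_def by blast
    have "j * w * x \<le> (\<Sum>g\<in>M. excess X g) + x * x"
      using sum_excess_ge[OF Xc(2,1), of M] M ball_subset[OF subgroup_self W(3)]
      by (auto simp: x_def)
    then have "2 * (j * w * x) \<le> l * w * j * (3 * j - 1) + 2 * (x * x)"
      using M(4) by linarith
    then have "real (2 * (j * w * x)) \<le> real (l * w * j * (3 * j - 1) + 2 * (x * x))"
      by (simp only: of_nat_le_iff)
    then have "2 * (real j * w * x) \<le> real l * (w * j * (3 * j - 1)) + 2 * (real x * x)"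
      using j1 by (simp add: mult.assoc)
    moreover have "6 * real l * (w * j * (3 * j - 1)) < real w * (w * j * (3 * j - 1))"
      using l w j1 by (intro mult_strict_right_mono) auto
    \<comment> \<open>Eliminating \<open>l\<close> leaves
      \<open>j * w^2 < 3 * (2 * x - j * w)^2\<close>, whereas rounding to the nearest integer makes
      \<open>2 * x - j * w\<close> at most \<open>w / 2\<close> in absolute value.\<close>
    moreover have "(4 * real x - 2 * j * w)\<^sup>2 \<le> (real w)\<^sup>2"
      using jx by (intro abs_le_square_iff[THEN iffD1]) auto
    moreover have "(real w)\<^sup>2 * 1 \<le> (real w)\<^sup>2 * j"
      using j1 by (intro mult_left_mono) auto
    moreover have "0 \<le> (real w)\<^sup>2" by simp
    ultimately show False
      using j1 unfolding power2_eq_square by (simp add: algebra_simps of_nat_diff)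
  next
    case False
    \<comment> \<open>By minimality there are still \<open>i\<close> disjoint translates, and every
      other element of \<open>H\<close> is within distance \<open>3 i - 1\<close>.\<close>
    define i where "i = (LEAST i. 1 \<le> i \<and> i < j \<and> ball W (3 * i - 1) = H)"
    from False have i: "1 \<le> i" "i < j" "ball W (3 * i - 1) = H"
      using LeastI_ex[of "\<lambda>i. 1 \<le> i \<and> i < j \<and> ball W (3 * i - 1) = H"] unfolding i_def by auto
    have ne: "ball W (3 * i' - 1) \<noteq> H" if "1 \<le> i'" "i' < i" for i'
      using not_less_Least[of i' "\<lambda>i. 1 \<le> i \<and> i < j \<and> ball W (3 * i - 1) = H"] that i
      unfolding i_def by auto
    obtain M where M: "finite M" "M \<subseteq> ball W (3 * i - 2)" "card M = i * w"
        "2 * (\<Sum>g\<in>M. excess X g) \<le> l * w * i * (3 * i - 1)"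
      using ball_chain[OF Xc(2,1) Cf C, of l i] exc ne i(1)
      unfolding w_def W_def H_def by blast
    have MH: "M \<subseteq> H"
    proof -
      have "ball W (3 * i - 2) \<subseteq> ball W (3 * i - 1)"
        by (rule ball_mono[OF W(3,2)]) linarith
      with M(2) i(3) show ?thesis by simp
    qed
    define h where "h = card H"
    have hM: "i * w \<le> h"
      using card_mono[OF H(3) MH] M by (simp add: h_def)
    have "(\<Sum>g\<in>H - M. excess X g) \<le> (h - i * w) * ((3 * i - 1) * l)"
    proof -
      have "(\<Sum>g\<in>H - M. excess X g) \<le> of_nat (card (H - M)) * ((3 * i - 1) * l)"
        by (rule sum_bounded_above) (use i(3) excess_ball[OF Xc(2,1) W(3) exc] in blast)
      also have "card (H - M) = h - i * w"
        using M MH by (simp add: card_Diff_subset h_def)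
      finally show ?thesis by simp
    qed
    moreover have "(\<Sum>g\<in>H. excess X g) = (\<Sum>g\<in>M. excess X g) + (\<Sum>g\<in>H - M. excess X g)"
      using MH H(3) by (metis add.commute sum.subset_diff)
    moreover have "h * x \<le> (\<Sum>g\<in>H. excess X g) + x * x"
      using sum_excess_ge[OF Xc(2,1) H(3,2)] by (simp add: h_def x_def)
    ultimately have "2 * (h * x) \<le> l * w * i * (3 * i - 1) + 2 * ((h - i * w) * ((3 * i - 1) * l))
        + 2 * (x * x)"
      using M(4) by linarith
    then have ineq: "2 * (real h * x) \<le> real l * w * i * (3 * real i - 1)
        + 2 * ((real h - real i * w) * ((3 * real i - 1) * l)) + 2 * (real x * x)"
    proof -
      have a: "real (3 * i - 1) = 3 * real i - 1" using i(1) by simp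
      have b: "real (h - i * w) = real h - real i * w" using hM by (simp add: of_nat_diff)
      show ?thesis
        using \<open>2 * (h * x) \<le> _\<close>[unfolded of_nat_le_iff[symmetric, where 'a = real]]
        by (simp only: of_nat_mult of_nat_add of_nat_numeral a b)
    qed
    have hx: "2 * real x \<le> real h"
      using half unfolding h_def x_def by linarith
    define t where "t = 3 * real i - 1"
    have t: "t \<ge> 2" using i(1) by (simp add: t_def)
    have ix: "(2 * real i + 1) * w \<le> 4 * real x"
    proof -
      have "(2 * real i + 1) * w \<le> (2 * real j - 1) * w"
        using i(2) by (intro mult_right_mono) auto
      then show ?thesis using jx(1) by (simp add: algebra_simps)
    qed
    have "real l * t * (2 * real h - real i * w) \<ge> 2 * (real x * (real h - real x))"
      using ineq by (simp add: t_def algebra_simps)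
    moreover have pos: "2 * real h - real i * w > 0"
    proof -
      have "0 < i * w" using i(1) w by simp
      with hM have "0 < real h" "real i * w \<le> real h"
        by (linarith, metis of_nat_le_iff of_nat_mult)
      then show ?thesis by linarith
    qed
    then have "6 * real l * (t * (2 * real h - real i * w)) < w * (t * (2 * real h - real i * w))"
      using l t by (intro mult_strict_right_mono) auto
    ultimately have "12 * (real x * (real h - real x)) < w * (t * (2 * real h - real i * w))"
      by (simp add: algebra_simps)
    moreover have "w * (t * (2 * real h - real i * w)) \<le> 12 * (real x * (real h - real x))"
    proof -
      \<comment> \<open>With \<open>h = 2 x + d\<close> the claim splits into the case
        \<open>h = 2 x\<close>, settled by a square, and a term linear in \<open>d \<ge> 0\<close>,
        settled by \<open>ix\<close>.\<close>
      define d where "d = real h - 2 * x"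
      have d: "d \<ge> 0" using hx by (simp add: d_def)
      have h: "real h = 2 * x + d" by (simp add: d_def)
      have "2 * w * t \<le> 12 * real x"
        using ix w by (simp add: t_def algebra_simps)
      then have "d * (2 * w * t) \<le> d * (12 * real x)"
        using d by (rule mult_left_mono)
      moreover have "w * (t * (4 * x - real i * w)) \<le> 12 * (real x * x)"
      proof -
        have "0 \<le> (6 * real x - w * t)\<^sup>2" by simp
        then have "12 * (real x * w * t) \<le> 36 * (real x * x) + w * t * (w * t)"
          by (simp add: power2_eq_square algebra_simps)
        moreover have "w * t * (w * t) \<le> w * t * (w * (3 * real i))"
        proof (rule mult_left_mono)
          show "w * t \<le> w * (3 * real i)"
            by (rule mult_left_mono) (simp_all add: t_def)
        qed (use t in simp)
        ultimately show ?thesis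
          by (simp add: algebra_simps)
      qed
      ultimately show ?thesis unfolding h by (simp add: algebra_simps)
    qed
    ultimately show False by simp
  qed
qed

text \<open>Averaging over \<open>W\<close> alone suffices: the mean excess is at least
  \<open>x - x^2 / w\<close>, more than \<open>3 x / 4\<close> when \<open>4 x < w\<close>. This is
  the origin of the growth factor \<open>7 / 4\<close>.\<close>

lemma exists_excess_ge_three_quarters:
  fixes C X :: "'a set"
  defines "W \<equiv> sym_closure C"
  assumes C: "finite C" "C \<subseteq> carrier G" and X: "finite X" "X \<subseteq> carrier G" "X \<noteq> {}"
    and small: "4 * card X < card W"
  shows "\<exists>b\<in>C. 3 * card X \<le> 4 * excess X b"
proof (rule ccontr)
  assume "\<not> ?thesis"
  then have *: "4 * excess X b < 3 * card X" if "b \<in> C" for b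
    using that by force
  have W: "finite W" "\<one> \<in> W" "W \<subseteq> carrier G"
    using C by (auto simp: W_def sym_closure_def)
  have x: "card X > 0" using X by (simp add: card_gt_0_iff)
  have exc: "4 * excess X u < 3 * card X" if "u \<in> W" for u
    using that * X C x unfolding W_def sym_closure_def
    by (auto simp: excess_one excess_inv subset_iff)
  have "(\<Sum>u\<in>W. 4 * excess X u) < (\<Sum>u\<in>W. 3 * card X)"
    using W exc by (intro sum_strict_mono) auto
  then have "4 * (\<Sum>u\<in>W. excess X u) < 3 * card X * card W"
    by (simp add: sum_distrib_left mult.commute)
  moreover have "4 * (card W * card X) \<le> 4 * (\<Sum>u\<in>W. excess X u) + 4 * (card X * card X)"
    using sum_excess_ge[OF X(1,2) W(1,3)] by linarith
  moreover have "4 * (card X * card X) < card W * card X"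
    using small x by simp
  ultimately show False by (simp add: algebra_simps)
qed


section \<open>Subset products and their growth inside a subgroup\<close>

definition subprods :: "'a set \<Rightarrow> 'a set"
  where "subprods U = (\<lambda>S. finprod G (\<lambda>x. x) S) ` Pow U"

lemma subprods_empty: "subprods {} = {\<one>}"
  by (simp add: subprods_def)

lemma subprods_insert:
  assumes "finite U" "insert r U \<subseteq> carrier G" "r \<notin> U"
  shows "subprods (insert r U) = subprods U \<union> shift r (subprods U)"
proof -
  have "finprod G (\<lambda>x. x) (insert r S) = r \<otimes> finprod G (\<lambda>x. x) S" if "S \<in> Pow U" for S
    using assms that by (intro finprod_insert) (auto intro: finite_subset)
  then show ?thesis
    by (simp add: subprods_def Pow_insert image_Un image_image)
qed

lemma subprods_closed:
  assumes "subgroup H G" "finite U" "U \<subseteq> H"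
  shows "subprods U \<subseteq> H"
  using assms(2,3)
proof (induction U)
  case empty
  then show ?case using assms(1) by (simp add: subprods_empty subgroup.one_closed)
next
  case (insert r U)
  then show ?case
    using assms(1) subgroup.subset[OF assms(1)]
    by (subst subprods_insert) (auto intro!: subgroup.m_closed[OF assms(1)])
qed

lemma one_in_subprods: "\<one> \<in> subprods U"
  unfolding subprods_def by (rule image_eqI[of _ _ "{}"]) auto

lemma finite_subprods: "finite U \<Longrightarrow> finite (subprods U)"
  by (simp add: subprods_def)

lemma subprods_mono: "U \<subseteq> V \<Longrightarrow> subprods U \<subseteq> subprods V"
  by (auto simp: subprods_def)

lemma subprods_mult:
  assumes "finite U" "finite V" "U \<subseteq> carrier G" "V \<subseteq> carrier G" "U \<inter> V = {}"
    and "x \<in> subprods U" "y \<in> subprods V"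
  shows "x \<otimes> y \<in> subprods (U \<union> V)"
proof -
  obtain S T where ST: "S \<subseteq> U" "T \<subseteq> V" "x = finprod G (\<lambda>x. x) S" "y = finprod G (\<lambda>x. x) T"
    using assms(6,7) by (auto simp: subprods_def)
  then have "x \<otimes> y = finprod G (\<lambda>x. x) (S \<union> T)"
    using assms by (subst finprod_Un_disjoint) (auto intro: finite_subset)
  with ST show ?thesis by (auto simp: subprods_def)
qed

lemma card_subprods_insert:
  assumes "finite U" "insert r U \<subseteq> carrier G" "r \<notin> U"
  shows "card (subprods (insert r U)) = card (subprods U) + excess (subprods U) r"
proof -
  have "subprods (insert r U) = subprods U \<union> (shift r (subprods U) - subprods U)"
    using subprods_insert[OF assms] by auto
  moreover have "finite (shift r (subprods U) - subprods U)"
    using finite_subprods[OF assms(1)] by simp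
  ultimately show ?thesis
    using finite_subprods[OF assms(1)] unfolding excess_def
    by (metis Diff_disjoint card_Un_disjoint)
qed

lemma card_sym_closure_ge:
  assumes "finite C"
  shows "card C \<le> card (sym_closure C)"
  using assms by (intro card_mono) (auto simp: sym_closure_def)

text \<open>The threshold uses a lower bound \<open>w\<close> of \<open>card C\<close> in place of
  the size of the symmetric closure, so that it stays fixed while generators are used up.\<close>

lemma excess_step:
  assumes fin: "finite (carrier G)" and C: "C \<subseteq> carrier G"
    and X: "X \<subseteq> generate G C" "X \<noteq> {}" "2 * card X \<le> card (generate G C)"
    and w: "w \<le> card C"
  shows "\<exists>b\<in>C. if 4 * card X < w then 3 * card X \<le> 4 * excess X b else w \<le> 6 * excess X b"
proof -
  have Cf: "finite C" using C fin finite_subset by auto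
  have Xc: "X \<subseteq> carrier G" "finite X"
    using X generate_incl[OF C] fin by (meson finite_subset order_trans)+
  have w': "w \<le> card (sym_closure C)" using w card_sym_closure_ge[OF Cf] by simp
  show ?thesis
  proof (cases "4 * card X < card (sym_closure C)")
    case True
    \<comment> \<open>If already \<open>w \<le> 4 * card X\<close>, this gives an excess of at least
      \<open>3 w / 16\<close>, more than the required \<open>w / 6\<close>.\<close>
    obtain b where "b \<in> C" "3 * card X \<le> 4 * excess X b"
      using exists_excess_ge_three_quarters[OF Cf C Xc(2,1) X(2) True] by auto
    then show ?thesis by (intro bexI[of _ b]) auto
  next
    case False
    obtain b where "b \<in> C" "card (sym_closure C) \<le> 6 * excess X b"
      using exists_excess_ge_sixth[OF fin C X(1,3)] False by auto
    with w' False show ?thesis by (intro bexI[of _ b]) auto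
  qed
qed

lemma half_cover:
  assumes fin: "finite (carrier G)" and H: "subgroup H G" and C: "C \<subseteq> H"
    and gen: "\<And>R. R \<subseteq> C \<Longrightarrow> card R \<le> a + b \<Longrightarrow> generate G (C - R) = H"
    and w: "w + (a + b) \<le> card C" "w * 4 ^ a \<le> 4 * 7 ^ a" "6 * card H < (3 + 2 * b) * w"
  shows "\<exists>U\<subseteq>C. card U \<le> a + b \<and> card H < 2 * card (subprods U)"
proof -
  have Hc: "H \<subseteq> carrier G" by (rule subgroup.subset[OF H])
  have Cf: "finite C" using C Hc fin finite_subset by (meson order_trans)
  have step: "\<exists>r\<in>C - U. if 4 * card (subprods U) < w
      then 3 * card (subprods U) \<le> 4 * excess (subprods U) r
      else w \<le> 6 * excess (subprods U) r"
    if U: "U \<subseteq> C" "card U \<le> a + b" "2 * card (subprods U) \<le> card H" for U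
  proof (rule excess_step[OF fin])
    have Uf: "finite U" using U Cf finite_subset by auto
    show "C - U \<subseteq> carrier G" using C Hc by auto
    show "subprods U \<subseteq> generate G (C - U)" "2 * card (subprods U) \<le> card (generate G (C - U))"
      using gen[OF U(1,2)] subprods_closed[OF H Uf] U C by auto
    show "w \<le> card (C - U)"
      using w(1) U(2) card_Diff_subset[OF Uf U(1)] by simp
    show "subprods U \<noteq> {}" using one_in_subprods by blast
  qed
  have card_ins: "card (subprods (insert r U)) = card (subprods U) + excess (subprods U) r"
    "card (insert r U) = Suc (card U)" if "U \<subseteq> C" "r \<in> C - U" for r U
    using that Cf C Hc finite_subset[of U C] by (auto intro!: card_subprods_insert)
  have A: "\<exists>U\<subseteq>C. card U \<le> t \<and> (card H < 2 * card (subprods U) \<or> w \<le> 4 * card (subprods U)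
      \<or> 7 ^ t \<le> 4 ^ t * card (subprods U))" if "t \<le> a" for t
    using that
  proof (induction t)
    case 0
    then show ?case by (intro exI[of _ "{}"]) (auto simp: subprods_empty)
  next
    case (Suc t)
    then obtain U where U: "U \<subseteq> C" "card U \<le> t" and alt: "card H < 2 * card (subprods U)
        \<or> w \<le> 4 * card (subprods U) \<or> 7 ^ t \<le> 4 ^ t * card (subprods U)" by auto
    show ?case
    proof (cases "card H < 2 * card (subprods U) \<or> w \<le> 4 * card (subprods U)")
      case True
      with U show ?thesis by (intro exI[of _ U]) auto
    next
      case False
      then obtain r where r: "r \<in> C - U" "3 * card (subprods U) \<le> 4 * excess (subprods U) r"
        using step[OF U(1)] U(2) Suc.prems by force
      have "7 ^ Suc t \<le> 4 ^ t * (7 * card (subprods U))"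
        using alt False by simp
      also have "\<dots> \<le> 4 ^ t * (4 * card (subprods (insert r U)))"
        using r card_ins(1)[OF U(1) r(1)] by (intro mult_left_mono) auto
      finally show ?thesis
        using U r card_ins(2)[OF U(1) r(1)] by (intro exI[of _ "insert r U"]) (auto simp: mult_ac)
    qed
  qed
  have B: "\<exists>U\<subseteq>C. card U \<le> a + t \<and> (card H < 2 * card (subprods U)
      \<or> (3 + 2 * t) * w \<le> 12 * card (subprods U))" if "t \<le> b" for t
    using that
  proof (induction t)
    case 0
    obtain U where U: "U \<subseteq> C" "card U \<le> a" and alt: "card H < 2 * card (subprods U)
        \<or> w \<le> 4 * card (subprods U) \<or> 7 ^ a \<le> 4 ^ a * card (subprods U)" using A[of a] by auto
    have "w \<le> 4 * card (subprods U)" if "7 ^ a \<le> 4 ^ a * card (subprods U)"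
    proof -
      have "w * 4 ^ a \<le> 4 * card (subprods U) * 4 ^ a"
        using order_trans[OF w(2) mult_le_mono2[OF that, of 4]] by (simp only: mult_ac)
      then show ?thesis by simp
    qed
    with U alt show ?case by (intro exI[of _ U]) auto
  next
    case (Suc t)
    then obtain U where U: "U \<subseteq> C" "card U \<le> a + t" and alt: "card H < 2 * card (subprods U)
        \<or> (3 + 2 * t) * w \<le> 12 * card (subprods U)" by auto
    show ?case
    proof (cases "card H < 2 * card (subprods U)")
      case True
      with U show ?thesis by (intro exI[of _ U]) auto
    next
      case False
      have "3 * w \<le> (3 + 2 * t) * w" by simp
      then have "3 * w \<le> 12 * card (subprods U)" using alt False by linarith
      then obtain r where r: "r \<in> C - U" "w \<le> 6 * excess (subprods U) r"
        using step[OF U(1)] U(2) Suc.prems False by force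
      have "(3 + 2 * Suc t) * w = (3 + 2 * t) * w + 2 * w" by (simp add: algebra_simps)
      then have "(3 + 2 * Suc t) * w \<le> 12 * card (subprods (insert r U))"
        using alt False r card_ins(1)[OF U(1) r(1)] by linarith
      then show ?thesis
        using U r card_ins(2)[OF U(1) r(1)] by (intro exI[of _ "insert r U"]) auto
    qed
  qed
  obtain U where "U \<subseteq> C" "card U \<le> a + b" "card H < 2 * card (subprods U)
      \<or> (3 + 2 * b) * w \<le> 12 * card (subprods U)" using B[of b] by auto
  with w(3) show ?thesis by (intro exI[of _ U]) auto
qed

text \<open>Pigeonhole: \<open>X\<close> and the set of quotients of \<open>h\<close> by elements of
  \<open>Y\<close> lie in \<open>H\<close> and have together more elements than \<open>H\<close>, so
  they meet.\<close>

lemma mult_cover: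
  assumes fin: "finite (carrier G)" and H: "subgroup H G" and XY: "X \<subseteq> H" "Y \<subseteq> H"
    and card: "card H < card X + card Y" and h: "h \<in> H"
  shows "\<exists>x\<in>X. \<exists>y\<in>Y. h = x \<otimes> y"
proof -
  have Hc: "H \<subseteq> carrier G" "finite H"
    using subgroup.subset[OF H] fin finite_subset by auto
  have XYc: "X \<subseteq> carrier G" "Y \<subseteq> carrier G" using XY Hc by auto
  have "inj_on (\<lambda>y. h \<otimes> inv y) Y"
    using XYc h Hc by (intro inj_onI) (metis inv_closed inv_inv Units_eq Units_l_cancel subsetD)
  then have "card ((\<lambda>y. h \<otimes> inv y) ` Y) = card Y" by (rule card_image)
  moreover have sub: "(\<lambda>y. h \<otimes> inv y) ` Y \<subseteq> H"
    using XY h H by (auto intro!: subgroup.m_closed[OF H] subgroup.m_inv_closed[OF H])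
  ultimately have "X \<inter> (\<lambda>y. h \<otimes> inv y) ` Y \<noteq> {}"
    using card XY Hc(2) card_Un_disjoint[of X "(\<lambda>y. h \<otimes> inv y) ` Y"]
      card_mono[OF Hc(2), of "X \<union> (\<lambda>y. h \<otimes> inv y) ` Y"] by (auto intro: finite_subset)
  then obtain y where y: "y \<in> Y" "h \<otimes> inv y \<in> X" by auto
  have "h = h \<otimes> inv y \<otimes> y"
    using y XYc h Hc by (metis inv_closed inv_solve_right m_closed subsetD)
  with y show ?thesis by blast
qed

text \<open>The second family must avoid the first, which is why generation has to survive the
  removal of \<open>2 (a + b)\<close> elements rather than \<open>a + b\<close>.\<close>

lemma full_cover:
  assumes fin: "finite (carrier G)" and H: "subgroup H G" and C: "C \<subseteq> H"
    and gen: "\<And>R. R \<subseteq> C \<Longrightarrow> card R \<le> 2 * (a + b) \<Longrightarrow> generate G (C - R) = H"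
    and w: "w + 2 * (a + b) \<le> card C" "w * 4 ^ a \<le> 4 * 7 ^ a" "6 * card H < (3 + 2 * b) * w"
  shows "\<exists>U\<subseteq>C. subprods U = H"
proof -
  have Hc: "H \<subseteq> carrier G" by (rule subgroup.subset[OF H])
  have Cf: "finite C" using C Hc fin finite_subset by (meson order_trans)
  obtain U where U: "U \<subseteq> C" "card U \<le> a + b" "card H < 2 * card (subprods U)"
    using half_cover[OF fin H C gen _ w(2,3)] w(1) by force
  have Uf: "finite U" using U Cf finite_subset by auto
  have "\<exists>V\<subseteq>C - U. card V \<le> a + b \<and> card H < 2 * card (subprods V)"
  proof (rule half_cover[OF fin H _ _ _ w(2,3)])
    fix R assume R: "R \<subseteq> C - U" "card R \<le> a + b"
    then have "card (U \<union> R) \<le> 2 * (a + b)"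
      using U(2) card_Un_le[of U R] by simp
    then have "generate G (C - (U \<union> R)) = H" using R U by (intro gen) auto
    moreover have "C - (U \<union> R) = C - U - R" by auto
    ultimately show "generate G (C - U - R) = H" by simp
  next
    show "w + (a + b) \<le> card (C - U)"
      using card_Diff_subset[OF Uf U(1)] U(2) w(1) by simp
  qed (use C w(1) card_Diff_subset[OF Uf U(1)] U(2) in auto)
  then obtain V where V: "V \<subseteq> C - U" "card V \<le> a + b" "card H < 2 * card (subprods V)" by auto
  have Vf: "finite V" using V Cf finite_subset by (meson finite_Diff)
  have "H \<subseteq> subprods (U \<union> V)"
  proof
    fix h assume "h \<in> H"
    then obtain x y where "x \<in> subprods U" "y \<in> subprods V" "h = x \<otimes> y"
      using mult_cover[OF fin H subprods_closed[OF H Uf] subprods_closed[OF H Vf]] U V C by force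
    then show "h \<in> subprods (U \<union> V)"
      using U V C Hc Uf Vf by (auto intro!: subprods_mult)
  qed
  moreover have "subprods (U \<union> V) \<subseteq> H"
    using U V C Uf Vf by (intro subprods_closed[OF H]) auto
  ultimately show ?thesis using U V by (intro exI[of _ "U \<union> V"]) auto
qed

end


text \<open>Here \<open>c\<close> bounds the number of available generators from below and \<open>h\<close> the order of the subgroup
  from above. A pair \<open>(a, b)\<close> stands for \<open>a\<close> generators that enlarge the set of subset products by a
  factor \<open>7 / 4\<close> each and \<open>b\<close> generators that add one sixth of the number of generators left; two such
  families are used up. The next pair is for a proper subgroup.\<close>

fun descends :: "(nat \<times> nat) list \<Rightarrow> nat \<Rightarrow> nat \<Rightarrow> nat \<Rightarrow> bool" where
  "descends [] c h m \<longleftrightarrow> h < c \<and> m \<le> c"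
| "descends ((a, b) # ts) c h m \<longleftrightarrow> 2 * (a + b) \<le> c \<and>
     (c - 2 * (a + b)) * 4 ^ a \<le> 4 * 7 ^ a \<and> 6 * h < (3 + 2 * b) * (c - 2 * (a + b)) \<and>
     descends ts (c - 2 * (a + b)) (h div 2) m"

lemma descends_le: "descends ts c h m \<Longrightarrow> m \<le> c"
  by (induction ts c h m rule: descends.induct) auto

section \<open>Descent through subgroups and cover of the quotient\<close>

context comm_group
begin

lemma card_proper_subgroup:
  assumes "finite (carrier G)" "subgroup H G" "subgroup K G" "K \<subset> H"
  shows "2 * card K \<le> card H"
proof -
  have "subgroup K (G\<lparr>carrier := H\<rparr>)"
    using assms by (intro subgroup_incl) auto
  moreover have "finite H" using subgroup.subset[OF assms(2)] assms(1) finite_subset by auto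
  ultimately have "card (rcosets\<^bsub>G\<lparr>carrier := H\<rparr>\<^esub> K) * card K = card H"
    using group.lagrange_finite[OF subgroup.subgroup_is_group[OF assms(2) is_group]]
    by (simp add: order_def)
  then have "card K dvd card H" by (metis dvd_triv_right)
  then obtain q where q: "card H = card K * q" by auto
  have "card K < card H"
    using assms finite_subset[OF subgroup.subset[OF assms(2)] assms(1)] by (intro psubset_card_mono) auto
  with q have "q \<noteq> 0" "q \<noteq> 1" by auto
  then have "2 \<le> q" by simp
  with q show ?thesis by simp
qed

text \<open>If removing some \<open>R\<close> destroys generation, the remaining elements generate a
  proper subgroup that contains all available elements except possibly those of \<open>R\<close> and
  has at most half the order. The state \<open>(c, h)\<close> becomes
  \<open>(c - 2 (a + b), h div 2)\<close>.\<close>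

lemma subgroup_cover:
  assumes fin: "finite (carrier G)" and A: "finite A" and ts: "descends ts c h m"
    and H: "subgroup H G" "card H \<le> h" "c \<le> card (A \<inter> H)"
  shows "\<exists>K U. subgroup K G \<and> U \<subseteq> A \<inter> K \<and> subprods U = K \<and> m \<le> card K"
  using ts H
proof (induction ts arbitrary: c h H)
  \<comment> \<open>The descent cannot get here: a subgroup of order at most \<open>h\<close> cannot
    contain \<open>c > h\<close> elements.\<close>
  case Nil
  have "finite H" using subgroup.subset[OF Nil(2)] fin finite_subset by auto
  then have "card (A \<inter> H) \<le> card H" by (intro card_mono) auto
  with Nil show ?case by auto
next
  case (Cons ab ts)
  obtain a b where ab: "ab = (a, b)" by (cases ab)
  define w where "w = c - 2 * (a + b)"
  have w: "2 * (a + b) \<le> c" "w * 4 ^ a \<le> 4 * 7 ^ a" "6 * h < (3 + 2 * b) * w"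
      "descends ts w (h div 2) m"
    using Cons.prems(1) by (simp_all add: ab w_def)
  have Hf: "finite H" using subgroup.subset[OF Cons.prems(2)] fin finite_subset by auto
  show ?case
  proof (cases "\<forall>R\<subseteq>A \<inter> H. card R \<le> 2 * (a + b) \<longrightarrow> generate G (A \<inter> H - R) = H")
    case True
    have "6 * card H < (3 + 2 * b) * w" using w(3) Cons.prems(3) by simp
    moreover have "w + 2 * (a + b) \<le> card (A \<inter> H)"
      using w(1) Cons.prems(4) by (simp add: w_def)
    moreover have "\<And>R. R \<subseteq> A \<inter> H \<Longrightarrow> card R \<le> 2 * (a + b) \<Longrightarrow> generate G (A \<inter> H - R) = H"
      using True by blast
    ultimately have "\<exists>U\<subseteq>A \<inter> H. subprods U = H"
      using w(2) by (intro full_cover[OF fin Cons.prems(2) Int_lower2, of A a b w])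
    then obtain U where U: "U \<subseteq> A \<inter> H" "subprods U = H" by blast
    have "card (A \<inter> H) \<le> card H" using Hf by (intro card_mono) auto
    then have "m \<le> card H"
      using descends_le[OF Cons.prems(1)] Cons.prems(4) by simp
    with U Cons.prems(2) show ?thesis by blast
  next
    case False
    then obtain R where R: "R \<subseteq> A \<inter> H" "card R \<le> 2 * (a + b)" "generate G (A \<inter> H - R) \<noteq> H"
      by auto
    define K where "K = generate G (A \<inter> H - R)"
    have sub: "A \<inter> H - R \<subseteq> carrier G" using subgroup.subset[OF Cons.prems(2)] by auto
    have K: "subgroup K G" unfolding K_def by (rule generate_is_subgroup[OF sub])
    have KH: "K \<subset> H"
      using R(3) generate_subgroup_incl[OF _ Cons.prems(2), of "A \<inter> H - R"] unfolding K_def by auto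
    have "2 * card K \<le> card H" by (rule card_proper_subgroup[OF fin Cons.prems(2) K KH])
    then have k: "card K \<le> h div 2" using Cons.prems(3) by linarith
    have Kf: "finite K" using KH Hf finite_subset by auto
    have "A \<inter> H - R \<subseteq> A \<inter> K"
      unfolding K_def by (auto intro: generate.incl)
    then have "card (A \<inter> H - R) \<le> card (A \<inter> K)"
      using Kf by (intro card_mono) auto
    moreover have "card (A \<inter> H - R) = card (A \<inter> H) - card R"
      using R(1) Hf by (intro card_Diff_subset) (auto intro: finite_subset)
    ultimately have "w \<le> card (A \<inter> K)"
      using Cons.prems(4) R(2) unfolding w_def by linarith
    from Cons.IH[OF w(4) K k this] show ?thesis .
  qed
qed

text \<open>A product set that no further element of \<open>F\<close> enlarges is stabilised by
  all unused elements, hence is a union of cosets of a subgroup missing only used elements.\<close>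

lemma quotient_cover:
  assumes fin: "finite (carrier G)" and H: "subgroup H G" and F: "F \<subseteq> carrier G"
    and many: "\<And>K. subgroup K G \<Longrightarrow> H \<subseteq> K \<Longrightarrow> K \<noteq> carrier G \<Longrightarrow>
      order G \<le> card K * (card (F - K) + 1)"
  shows "\<forall>g\<in>carrier G. \<exists>h\<in>H. \<exists>s\<in>subprods F. g = h \<otimes> s"
  using H many
proof (induction "order G - card H" arbitrary: H rule: less_induct)
  case less
  note H = \<open>subgroup H G\<close>
  have Ff: "finite F" using F fin finite_subset by auto
  have Hc: "H \<subseteq> carrier G" "finite H" using subgroup.subset[OF H] fin finite_subset by auto
  define Z where "Z S = (\<Union>s\<in>subprods S. shift s H)" for S
  have sc: "subprods S \<subseteq> carrier G" if "S \<subseteq> F" for S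
    using subprods_closed[OF subgroup_self] that F Ff finite_subset by (meson order_trans)
  have Zc: "Z S \<subseteq> carrier G" if "S \<subseteq> F" for S
    using sc[OF that] Hc by (auto simp: Z_def)
  have Zf: "finite (Z S)" if "S \<subseteq> F" for S
    using Zc[OF that] fin finite_subset by auto
  \<comment> \<open>Good means that \<open>Z S\<close>, a union of cosets of \<open>H\<close>, has
    at least one coset for each element of \<open>S\<close> besides \<open>H\<close> itself. For a
    good \<open>S\<close> of maximal size no further element can contribute a coset.\<close>
  define good where "good S \<longleftrightarrow> S \<subseteq> F \<and> card H * (card S + 1) \<le> card (Z S)" for S
  have "good {}"
    using shift_one[OF Hc(1)] by (simp add: good_def Z_def subprods_empty)
  moreover have "\<forall>S. good S \<longrightarrow> card S < Suc (card F)"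
    using Ff by (auto simp: good_def less_Suc_eq_le intro: card_mono)
  ultimately obtain S where S: "good S" and max: "\<And>S'. good S' \<Longrightarrow> card S' \<le> card S"
    using ex_has_greatest_nat[of good "{}" card "Suc (card F)"] by blast
  have SF: "S \<subseteq> F" "finite S" using S Ff finite_subset by (auto simp: good_def)
  have per: "z \<otimes> h \<in> Z S" if "z \<in> Z S" "h \<in> H" for z h
  proof -
    obtain s k where sk: "s \<in> subprods S" "k \<in> H" "z = s \<otimes> k"
      using \<open>z \<in> Z S\<close> by (auto simp: Z_def)
    then have "z \<otimes> h = s \<otimes> (k \<otimes> h)"
      using sc[OF SF(1)] Hc that by (intro trans[OF _ m_assoc]) auto
    moreover have "k \<otimes> h \<in> H" using sk that subgroup.m_closed[OF H] by auto
    ultimately show ?thesis using sk by (auto simp: Z_def)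
  qed
  have sub: "subprods S \<subseteq> Z S"
  proof
    fix s assume s: "s \<in> subprods S"
    then have "s = s \<otimes> \<one>" using sc[OF SF(1)] by auto
    with s subgroup.one_closed[OF H] show "s \<in> Z S" unfolding Z_def by blast
  qed
  have one: "\<one> \<in> Z S" using sub one_in_subprods by auto
  have eqI: "shift g (Z S) = Z S" if "g \<in> carrier G" "shift g (Z S) \<subseteq> Z S" for g
    using card_subset_eq[OF Zf[OF SF(1)] that(2)] card_shift[OF Zc[OF SF(1)] that(1)] by simp
  have stuck: "shift f (Z S) = Z S" if f: "f \<in> F" "f \<notin> S" for f
  proof (rule ccontr)
    assume "shift f (Z S) \<noteq> Z S"
    moreover have fc: "f \<in> carrier G" using f F by auto
    ultimately obtain z where z: "z \<in> Z S" "f \<otimes> z \<notin> Z S" using eqI by blast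
    have zc: "f \<otimes> z \<in> carrier G" using z fc Zc[OF SF(1)] by auto
    have ins: "insert f S \<subseteq> F" using f SF by auto
    have "subprods (insert f S) = subprods S \<union> shift f (subprods S)"
      using subprods_insert[OF SF(2)] ins F f by auto
    moreover have "f \<otimes> (s \<otimes> h) = f \<otimes> s \<otimes> h" if "s \<in> subprods S" "h \<in> H" for s h
      using that sc[OF SF(1)] fc Hc by (intro m_assoc[symmetric]) auto
    ultimately have "Z S \<union> shift f (Z S) \<subseteq> Z (insert f S)"
      unfolding Z_def by auto
    moreover have "f \<otimes> z \<otimes> h = f \<otimes> (z \<otimes> h)" if "h \<in> H" for h
      using that z(1) Zc[OF SF(1)] fc Hc by (intro m_assoc) auto
    then have "shift (f \<otimes> z) H \<subseteq> shift f (Z S)"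
      using per[OF z(1)] by auto
    ultimately have "card (Z S \<union> shift (f \<otimes> z) H) \<le> card (Z (insert f S))"
      using Zf[OF ins] by (intro card_mono) auto
    moreover have "Z S \<inter> shift (f \<otimes> z) H = {}"
    proof (rule ccontr)
      assume "Z S \<inter> shift (f \<otimes> z) H \<noteq> {}"
      then obtain h where h: "h \<in> H" "f \<otimes> z \<otimes> h \<in> Z S" by auto
      have "f \<otimes> z \<otimes> h \<otimes> inv h \<in> Z S"
        using per[OF h(2)] subgroup.m_inv_closed[OF H h(1)] by simp
      moreover have "f \<otimes> z \<otimes> h \<otimes> inv h = f \<otimes> z"
        using h(1) Hc zc by (simp add: m_assoc subset_iff)
      ultimately show False using z(2) by simp
    qed
    then have "card (Z S \<union> shift (f \<otimes> z) H) = card (Z S) + card H"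
      using Zf[OF SF(1)] Hc card_shift[OF Hc(1) zc] by (simp add: card_Un_disjoint)
    ultimately have "good (insert f S)"
      using S f(2) SF ins by (simp add: good_def algebra_simps)
    from max[OF this] show False using f(2) SF by simp
  qed
  define K where "K = {g \<in> carrier G. shift g (Z S) = Z S}"
  have K_iff: "g \<in> K \<longleftrightarrow> g \<in> carrier G \<and> shift g (Z S) = Z S" for g
    by (simp add: K_def)
  have Kc: "K \<subseteq> carrier G" using K_iff by blast
  have K: "subgroup K G"
  proof (rule subgroupI)
    show "K \<noteq> {}" using shift_one[OF Zc[OF SF(1)]] K_iff by blast
    fix a assume a: "a \<in> K"
    show "inv a \<in> K"
      using a shift_mult[OF Zc[OF SF(1)], of "inv a" a] shift_one[OF Zc[OF SF(1)]]
      K_iff by simp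
    fix b assume "b \<in> K"
    with a show "a \<otimes> b \<in> K"
      using shift_mult[OF Zc[OF SF(1)], of a b] K_iff by simp
  qed (rule Kc)
  have HK: "H \<subseteq> K"
  proof
    fix h assume h: "h \<in> H"
    have "h \<otimes> z \<in> Z S" if "z \<in> Z S" for z
    proof -
      have "h \<otimes> z = z \<otimes> h"
        by (rule m_comm) (use that h Hc(1) Zc[OF SF(1)] in blast)+
      then show ?thesis using per[OF that h] by (rule ssubst)
    qed
    then have "shift h (Z S) \<subseteq> Z S" by blast
    moreover have "h \<in> carrier G" using h Hc(1) by (rule subsetD[rotated])
    ultimately show "h \<in> K" using eqI[of h] K_iff[of h] by simp
  qed
  have FK: "F - S \<subseteq> K"
  proof
    fix f assume f: "f \<in> F - S"
    then have "f \<in> carrier G" using F by blast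
    with f stuck[of f] K_iff[of f] show "f \<in> K" by simp
  qed
  have Kf: "finite K" using Kc fin finite_subset by blast
  have "Z S = carrier G"
  proof (cases "K = carrier G")
    case True
    have "g \<in> Z S" if "g \<in> carrier G" for g
    proof -
      have "g \<otimes> \<one> \<in> shift g (Z S)" using one by blast
      moreover have "shift g (Z S) = Z S" using K_iff[of g] that True by simp
      ultimately show ?thesis using that by simp
    qed
    with Zc[OF SF(1)] show ?thesis by auto
  next
    case ne: False
    show ?thesis
    proof (cases "K = H")
      case True
      \<comment> \<open>Here the hypothesis for \<open>H\<close> itself bounds the index by
        \<open>card S + 1\<close>, and that many cosets are already filled.\<close>
      have "card (F - K) \<le> card S"
        using FK SF by (intro card_mono) auto
      then have "card K * (card (F - K) + 1) \<le> card H * (card S + 1)"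
        using True by simp
      then have "order G \<le> card (Z S)"
        using less.prems(2)[OF K HK ne] S by (simp add: good_def)
      then show ?thesis
        using card_seteq[OF fin Zc[OF SF(1)]] by (simp add: order_def)
    next
      case False
      \<comment> \<open>The stabiliser being strictly larger, the induction covers the quotient by
        \<open>K\<close>. In a representing product the factors outside \<open>S\<close> lie in
        \<open>K\<close>, which preserves \<open>Z S\<close>, and the factors in \<open>S\<close>
        give an element of \<open>Z S\<close>.\<close>
      have lt: "card H < card K" using False HK Kf by (intro psubset_card_mono) auto
      have "card K \<le> order G"
        unfolding order_def using fin Kc by (rule card_mono)
      then have "order G - card K < order G - card H" using lt by linarith
      then have *: "\<forall>g\<in>carrier G. \<exists>h\<in>K. \<exists>s\<in>subprods F. g = h \<otimes> s"
        using less.hyps[OF _ K] less.prems(2) HK by (meson order_trans)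
      have "g \<in> Z S" if "g \<in> carrier G" for g
      proof -
        obtain k T where kT: "k \<in> K" "T \<subseteq> F" "g = k \<otimes> finprod G (\<lambda>x. x) T"
          using * \<open>g \<in> carrier G\<close> unfolding subprods_def by blast
        have Tf: "finite T" using kT Ff finite_subset by auto
        have "T = (T - S) \<union> (T \<inter> S)" by auto
        moreover have "finprod G (\<lambda>x. x) ((T - S) \<union> (T \<inter> S))
            = finprod G (\<lambda>x. x) (T - S) \<otimes> finprod G (\<lambda>x. x) (T \<inter> S)"
          using Tf kT F by (intro finprod_Un_disjoint) auto
        moreover have k': "finprod G (\<lambda>x. x) (T - S) \<in> K"
          using subprods_closed[OF K, of "T - S"] Tf FK kT by (auto simp: subprods_def)
        moreover have s: "finprod G (\<lambda>x. x) (T \<inter> S) \<in> Z S"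
          using sub by (auto simp: subprods_def)
        ultimately have "g = k \<otimes> (finprod G (\<lambda>x. x) (T - S) \<otimes> finprod G (\<lambda>x. x) (T \<inter> S))"
          using kT(3) by simp
        also have "\<dots> = k \<otimes> finprod G (\<lambda>x. x) (T - S) \<otimes> finprod G (\<lambda>x. x) (T \<inter> S)"
          using kT(1) k' s Zc[OF SF(1)] subgroup.subset[OF K] by (intro m_assoc[symmetric]) auto
        finally have g_eq: "g = k \<otimes> finprod G (\<lambda>x. x) (T - S) \<otimes> finprod G (\<lambda>x. x) (T \<inter> S)" .
        moreover have "k \<otimes> finprod G (\<lambda>x. x) (T - S) \<in> K"
          using kT(1) k' by (rule subgroup.m_closed[OF K])
        ultimately have "shift (k \<otimes> finprod G (\<lambda>x. x) (T - S)) (Z S) = Z S"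
          using K_iff by simp
        with s show ?thesis unfolding g_eq by blast
      qed
      with Zc[OF SF(1)] show ?thesis by auto
    qed
  qed
  then show ?case
  proof (intro ballI)
    fix g assume "g \<in> carrier G"
    with \<open>Z S = carrier G\<close> obtain s h where sh: "s \<in> subprods S" "h \<in> H" "g = s \<otimes> h"
      unfolding Z_def by blast
    then have "g = h \<otimes> s" using sc[OF SF(1)] Hc by (metis m_comm subsetD)
    with sh subprods_mono[OF SF(1)] show "\<exists>h\<in>H. \<exists>s\<in>subprods F. g = h \<otimes> s" by blast
  qed
qed

text \<open>The elements spent on \<open>H\<close> lie in \<open>H\<close>, hence in every
  \<open>K\<close> above it, so discarding them leaves the count of elements outside
  \<open>K\<close> unchanged and the rest of \<open>A\<close> can still cover the quotient.\<close>

theorem subprods_eq_carrier: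
  assumes fin: "finite (carrier G)" and A: "A \<subseteq> carrier G"
    and ts: "descends ts c h m" "c \<le> card A" "order G \<le> h"
    and many: "\<And>K. subgroup K G \<Longrightarrow> K \<noteq> carrier G \<Longrightarrow> m \<le> card K \<Longrightarrow>
      order G \<le> card K * (card (A - K) + 1)"
  shows "subprods A = carrier G"
proof
  have Af: "finite A" using A fin finite_subset by auto
  show "subprods A \<subseteq> carrier G" by (rule subprods_closed[OF subgroup_self Af A])
  have "A \<inter> carrier G = A" using A by auto
  then obtain H U where H: "subgroup H G" "U \<subseteq> A \<inter> H" "subprods U = H" "m \<le> card H"
    using subgroup_cover[OF fin Af ts(1) subgroup_self] ts(2,3) by (auto simp: order_def)
  have Uf: "finite U" using H Af finite_subset by auto
  have "order G \<le> card K * (card ((A - U) - K) + 1)"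
    if K: "subgroup K G" "H \<subseteq> K" "K \<noteq> carrier G" for K
  proof -
    have "A - U - K = A - K" using H K by auto
    moreover have "card H \<le> card K"
      using K(2) subgroup.subset[OF K(1)] fin finite_subset by (intro card_mono) auto
    ultimately show ?thesis using many[OF K(1,3)] H(4) by simp
  qed
  then have cover: "\<forall>g\<in>carrier G. \<exists>h\<in>H. \<exists>s\<in>subprods (A - U). g = h \<otimes> s"
    using A by (intro quotient_cover[OF fin H(1)]) auto
  show "carrier G \<subseteq> subprods A"
  proof
    fix g assume "g \<in> carrier G"
    then obtain h s where hs: "h \<in> subprods U" "s \<in> subprods (A - U)" "g = h \<otimes> s"
      using cover H(3) by blast
    have "U \<subseteq> A" using H(2) by blast
    then have "U \<union> (A - U) = A" "U \<subseteq> carrier G" "A - U \<subseteq> carrier G" using A by blast+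
    then show "g \<in> subprods A"
      using subprods_mult[OF Uf _ _ _ _ hs(1,2)] Af hs(3) by simp
  qed
qed

end

section \<open>Chebyshev-type lower bound for the number of primes\<close>

definition primes_upto :: "nat \<Rightarrow> nat set"
  where "primes_upto n = {q. prime q \<and> q \<le> n}"

lemma finite_primes_upto [simp]: "finite (primes_upto n)"
  by (rule finite_subset[of _ "{..n}"]) (auto simp: primes_upto_def)

text \<open>The recurrence of Leibniz's harmonic triangle:
  \<open>1 / ((m + 1) * C(n, m + 1)) = 1 / (m * C(n - 1, m)) - 1 / (m * C(n, m))\<close>.\<close>

lemma mult_binomial_dvd:
  assumes dvd: "\<And>j. 1 \<le> j \<Longrightarrow> j \<le> n \<Longrightarrow> j dvd L" and m: "1 \<le> m" "m \<le> n"
  shows "m * (n choose m) dvd L"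
proof -
  have *: "of_nat L / (of_nat m * of_nat (i choose m) :: rat) \<in> \<int>" if "m \<le> i" "i \<le> n" for i
    using m(1) that
  proof (induction m arbitrary: i rule: nat_induct_at_least)
    case base
    then have "i dvd L" using dvd[of i] by auto
    then obtain k where "L = i * k" by auto
    then show ?case using base by auto
  next
    case (Suc m)
    then obtain i' where i: "i = Suc i'" "m \<le> i'" by (cases i) auto
    have 1: "of_nat L / (of_nat m * of_nat (i' choose m) :: rat) \<in> \<int>"
      "of_nat L / (of_nat m * of_nat (i choose m) :: rat) \<in> \<int>"
      by (rule Suc.IH; use i Suc.prems in linarith)+
    define c where "c = (of_nat (i choose m) :: rat)"
    have c: "c \<noteq> 0" using i(2) Suc.prems(1) by (simp add: c_def)
    have a: "of_nat (Suc m) * of_nat (i choose Suc m) = (of_nat (i - m) * c :: rat)"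
      using binomial_absorption[of m "i"] binomial_absorb_comp[of i m] unfolding c_def
      by (metis of_nat_mult)
    have b: "of_nat i * of_nat (i' choose m) = (of_nat (i - m) * c :: rat)"
      unfolding c_def using binomial_absorb_comp[of i m] i by (metis diff_Suc_1 of_nat_mult)
    have im: "of_nat (i - m) = (of_nat i - of_nat m :: rat)" "of_nat i - of_nat m \<noteq> (0 :: rat)"
      using i by (auto simp: of_nat_diff)
    have b': "of_nat (i' choose m) = (of_nat i - of_nat m) * c / (of_nat i :: rat)"
      using b im i by (simp add: field_simps)
    have "of_nat L / (of_nat (Suc m) * of_nat (i choose Suc m) :: rat)
        = of_nat L / (of_nat m * of_nat (i' choose m)) - of_nat L / (of_nat m * c)"
    proof -
      define d where "d = (of_nat i - of_nat m :: rat)"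
      have d: "of_nat i = d + of_nat m" "d \<noteq> 0" "d + of_nat m \<noteq> 0"
        using im(2) i by (auto simp: d_def)
      have m0: "of_nat m \<noteq> (0 :: rat)" using Suc.hyps by simp
      show ?thesis
        unfolding a b' im(1) unfolding d(1) using d(2,3) m0 c
        by (simp add: divide_simps) (simp add: algebra_simps)
    qed
    also have "\<dots> \<in> \<int>" using 1 unfolding c_def by (rule Ints_diff)
    finally show ?case .
  qed
  from *[OF m(2)] obtain k where k: "of_nat L = (of_int k * (of_nat m * of_nat (n choose m)) :: rat)"
    using m by (auto elim!: Ints_cases simp: field_simps)
  have "of_int (int L) = (of_int (k * int (m * (n choose m))) :: rat)"
    using k by simp
  then have "int L = k * int (m * (n choose m))" by (simp only: of_int_eq_iff)
  then show ?thesis by (metis dvd_triv_right int_dvd_int_iff)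
qed

text \<open>The \<open>n\<close> numbers \<open>m * (n choose m)\<close> have the sum
  \<open>n * 2 ^ (n - 1)\<close>, so one of them reaches the mean.\<close>

lemma exists_mult_binomial_ge:
  assumes "n > 0"
  shows "\<exists>m. 1 \<le> m \<and> m \<le> n \<and> 2 ^ (n - 1) \<le> m * (n choose m)"
proof (rule ccontr)
  assume "\<not> ?thesis"
  then have *: "m * (n choose m) < 2 ^ (n - 1)" if "m \<in> {1..n}" for m
    using that by force
  have "(\<Sum>m\<le>n. m * (n choose m)) = (\<Sum>m\<in>{1..n}. m * (n choose m))"
    by (rule sum.mono_neutral_right) auto
  also have "\<dots> < (\<Sum>m\<in>{1..n}. 2 ^ (n - 1))"
    using assms * by (intro sum_strict_mono) auto
  finally show False using choose_linear_sum[of n] by simp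
qed

text \<open>Both sides are compared with the least common multiple \<open>L\<close> of 1, ...,
  \<open>n\<close>: some \<open>m * (n choose m) \<ge> 2 ^ (n - 1)\<close> divides it, and every
  prime up to \<open>n\<close> contributes a power of at most \<open>n\<close>.\<close>

lemma two_power_le_power_card_primes:
  assumes "n > 0"
  shows "2 ^ (n - 1) \<le> n ^ card (primes_upto n)"
proof -
  define e where "e q = (GREATEST k. q ^ k \<le> n)" for q :: nat
  have e: "q ^ e q \<le> n" "\<And>k. q ^ k \<le> n \<Longrightarrow> k \<le> e q" if "q \<in> primes_upto n" for q
  proof -
    have q2: "q \<ge> 2" using that prime_ge_2_nat by (auto simp: primes_upto_def)
    have b: "k \<le> n" if "q ^ k \<le> n" for k
    proof -
      have "k < 2 ^ k" by (rule less_exp)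
      also have "2 ^ k \<le> q ^ k" using q2 by (intro power_mono) auto
      finally show ?thesis using that by simp
    qed
    have "q ^ 0 \<le> n" using assms by simp
    then show "q ^ e q \<le> n" unfolding e_def by (rule GreatestI_nat[where b = n]) (rule b)
    show "k \<le> e q" if "q ^ k \<le> n" for k
      unfolding e_def by (rule Greatest_le_nat[where b = n]) (use that b in auto)
  qed
  define L where "L = (\<Prod>q\<in>primes_upto n. q ^ e q)"
  have Lpos: "L > 0"
    unfolding L_def by (intro prod_pos) (auto simp: primes_upto_def prime_gt_0_nat)
  have "j dvd L" if j: "1 \<le> j" "j \<le> n" for j
  proof -
    have "j = (\<Prod>q\<in>prime_factors j. q ^ multiplicity q j)"
      using j by (simp add: prime_factorization_nat)
    also have "\<dots> dvd L"
      unfolding L_def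
    proof (rule prod_dvd_prod_subset2)
      show sub: "prime_factors j \<subseteq> primes_upto n"
        using j by (auto simp: primes_upto_def prime_factors_dvd dest!: dvd_imp_le)
      fix q assume q: "q \<in> prime_factors j"
      have "q ^ multiplicity q j \<le> j"
        using j by (intro dvd_imp_le multiplicity_dvd) auto
      then have "multiplicity q j \<le> e q" using e(2)[of q] q sub j by auto
      then show "q ^ multiplicity q j dvd q ^ e q" by (rule le_imp_power_dvd)
    qed auto
    finally show ?thesis .
  qed
  moreover obtain m where m: "1 \<le> m" "m \<le> n" "2 ^ (n - 1) \<le> m * (n choose m)"
    using exists_mult_binomial_ge[OF assms] by auto
  ultimately have "m * (n choose m) dvd L" by (intro mult_binomial_dvd)
  then have "2 ^ (n - 1) \<le> L" using m(3) Lpos dvd_imp_le by (meson order_trans)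
  also have "L \<le> (\<Prod>q\<in>primes_upto n. n)"
    unfolding L_def using e(1) by (intro prod_mono) auto
  finally show ?thesis by simp
qed

text \<open>The fraction \<open>v / u\<close> is a rational upper bound for the binary logarithm of
  \<open>n\<close>.\<close>

lemma card_primes_upto_ge:
  assumes "n > 0" "n ^ u \<le> 2 ^ v" "u > 0"
  shows "u * (n - 1) \<le> v * card (primes_upto n)"
proof -
  have "(2::nat) ^ (u * (n - 1)) = (2 ^ (n - 1)) ^ u" by (simp only: power_mult mult.commute[of u])
  also have "\<dots> \<le> (n ^ card (primes_upto n)) ^ u"
    using two_power_le_power_card_primes[OF assms(1)] by (rule power_mono) simp
  also have "\<dots> = (n ^ u) ^ card (primes_upto n)" by (simp flip: power_mult add: mult.commute)
  also have "\<dots> \<le> (2 ^ v) ^ card (primes_upto n)" using assms(2) by (rule power_mono) simp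
  also have "\<dots> = 2 ^ (v * card (primes_upto n))" by (simp add: power_mult)
  finally show ?thesis by simp
qed

section \<open>Integers free of a few prime factors\<close>

text \<open>The bound \<open>t\<close> is real so that it can be divided by primes without
  rounding.\<close>

definition coprime_below :: "real \<Rightarrow> nat set \<Rightarrow> nat set"
  where "coprime_below t E = {n. 0 < n \<and> real n \<le> t \<and> (\<forall>q\<in>E. \<not> q dvd n)}"

lemma finite_coprime_below [simp]: "finite (coprime_below t E)"
proof (rule finite_subset)
  show "coprime_below t E \<subseteq> {..nat \<lfloor>t\<rfloor>}"
    by (auto simp: coprime_below_def le_nat_floor)
qed simp

lemma card_coprime_below_multiples:
  assumes "prime q" "\<forall>r\<in>E. prime r" "q \<notin> E"
  shows "card {n \<in> coprime_below t E. q dvd n} = card (coprime_below (t / q) E)"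
proof -
  have q: "q > 0" using assms(1) by (rule prime_gt_0_nat)
  have dvd: "r dvd q * m \<longleftrightarrow> r dvd m" if "r \<in> E" for r m
    using that assms by (metis dvd_mult prime_dvd_mult_iff primes_dvd_imp_eq)
  have "bij_betw (\<lambda>m. q * m) (coprime_below (t / q) E) {n \<in> coprime_below t E. q dvd n}"
  proof (rule bij_betwI')
    fix n assume n: "n \<in> {n \<in> coprime_below t E. q dvd n}"
    then obtain m where m: "n = q * m" by auto
    with n q dvd have "m \<in> coprime_below (t / q) E"
      by (auto simp: coprime_below_def field_simps)
    with m show "\<exists>m\<in>coprime_below (t / q) E. n = q * m" by auto
  qed (use q dvd in \<open>auto simp: coprime_below_def field_simps\<close>)
  then show ?thesis by (metis bij_betw_same_card)
qed

lemma card_coprime_below_insert: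
  assumes "prime q" "\<forall>r\<in>E. prime r" "q \<notin> E"
  shows "real (card (coprime_below t (insert q E)))
    = real (card (coprime_below t E)) - real (card (coprime_below (t / q) E))"
proof -
  have "coprime_below t (insert q E) = coprime_below t E - {n \<in> coprime_below t E. q dvd n}"
    by (auto simp: coprime_below_def)
  moreover have "card {n \<in> coprime_below t E. q dvd n} \<le> card (coprime_below t E)"
    by (intro card_mono) auto
  ultimately show ?thesis
    using card_coprime_below_multiples[OF assms, of t] by (simp add: card_Diff_subset of_nat_diff)
qed

text \<open>Each further prime \<open>q\<close> subtracts the same kind of count at
  \<open>t / q\<close>, so the error bound, 1 for the floor function at the start, doubles.\<close>

lemma legendre_sieve:
  assumes "finite E" "\<forall>r\<in>E. prime r" "t \<ge> 0"
  shows "\<bar>real (card (coprime_below t E)) - t * (\<Prod>q\<in>E. 1 - 1 / real q)\<bar> \<le> 2 ^ card E"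
  using assms
proof (induction E arbitrary: t rule: finite_induct)
  case empty
  have "coprime_below t {} = {1..nat \<lfloor>t\<rfloor>}"
    using empty by (auto simp: coprime_below_def le_nat_floor Suc_le_eq le_nat_iff le_floor_iff)
  then have "card (coprime_below t {}) = nat \<lfloor>t\<rfloor>" by simp
  moreover have "\<bar>real (nat \<lfloor>t\<rfloor>) - t\<bar> \<le> 1" using empty by linarith
  ultimately show ?case by simp
next
  case (insert q E)
  have q: "prime q" "q > 0" using insert.prems prime_gt_0_nat by auto
  have "\<bar>real (card (coprime_below t E)) - t * (\<Prod>q\<in>E. 1 - 1 / real q)\<bar> \<le> 2 ^ card E"
    "\<bar>real (card (coprime_below (t / q) E)) - t / q * (\<Prod>q\<in>E. 1 - 1 / real q)\<bar> \<le> 2 ^ card E"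
    using insert.IH[of t] insert.IH[of "t / q"] insert.prems by auto
  moreover have "t * (\<Prod>q\<in>insert q E. 1 - 1 / real q)
      = t * (\<Prod>q\<in>E. 1 - 1 / real q) - t / q * (\<Prod>q\<in>E. 1 - 1 / real q)"
    using insert.hyps by (simp add: algebra_simps)
  moreover have "real (card (coprime_below t (insert q E)))
      = real (card (coprime_below t E)) - real (card (coprime_below (t / q) E))"
    using insert by (intro card_coprime_below_insert) auto
  moreover have "2 ^ card (insert q E) = 2 ^ card E + (2::real) ^ card E"
    using insert.hyps by simp
  moreover have "\<bar>x - y - (u - v)\<bar> \<le> c + c" if "\<bar>x - u\<bar> \<le> c" "\<bar>y - v\<bar> \<le> c" for x y u v c :: real
    using that by linarith
  ultimately show ?case by presburger
qed

text \<open>A union bound: an integer lost to \<open>F\<close> is a multiple of some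
  \<open>q\<close> in \<open>F\<close> with a cofactor still free of \<open>E\<close>. Compared with
  the exact sieve it avoids doubling the error, at the price of a weaker main term.\<close>

lemma card_coprime_below_Un:
  assumes "finite F" "\<forall>r\<in>E \<union> F. prime r" "E \<inter> F = {}"
  shows "real (card (coprime_below t E))
    \<le> real (card (coprime_below t (E \<union> F))) + (\<Sum>q\<in>F. real (card (coprime_below (t / q) E)))"
  using assms
proof (induction F rule: finite_induct)
  case (insert q F)
  have "coprime_below (t / q) (E \<union> F) \<subseteq> coprime_below (t / q) E"
    by (auto simp: coprime_below_def)
  then have "card (coprime_below (t / q) (E \<union> F)) \<le> card (coprime_below (t / q) E)"
    by (intro card_mono) auto
  moreover have "real (card (coprime_below t (insert q (E \<union> F))))
    = real (card (coprime_below t (E \<union> F))) - real (card (coprime_below (t / q) (E \<union> F)))"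
    using insert by (intro card_coprime_below_insert) auto
  ultimately show ?case using insert by simp
qed simp

text \<open>The sequence 2, 3, 5, 7, 9, ... bounds the \<open>i\<close>-th smallest element, counted
  from 0, of any set of primes, because all primes but 2 are odd.\<close>

definition odd_bound :: "nat \<Rightarrow> real"
  where "odd_bound i = (if i = 0 then 2 else 2 * real i + 1)"

lemma nth_prime_ge:
  assumes "sorted_wrt (<) ps" "\<forall>q\<in>set ps. prime (q :: nat)" "i < length ps"
  shows "odd_bound i \<le> real (ps ! i)"
  using assms(3)
proof (induction i)
  case 0
  then show ?case using assms(2) nth_mem prime_ge_2_nat[of "ps ! 0"] by (simp add: odd_bound_def)
next
  case (Suc i)
  have less: "ps ! i < ps ! Suc i"
    using assms(1) Suc.prems by (simp add: sorted_wrt_iff_nth_less)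
  have pr: "prime (ps ! Suc i)" "prime (ps ! i)" using assms(2) Suc.prems by auto
  then have ge: "2 \<le> ps ! i" by (simp add: prime_ge_2_nat)
  then have "odd (ps ! Suc i)" using pr less by (intro prime_odd_nat) auto
  show ?case
  proof (cases "i = 0")
    case True
    then show ?thesis using less ge by (simp add: odd_bound_def)
  next
    case False
    have IH: "2 * i + 1 \<le> ps ! i" using Suc False by (simp add: odd_bound_def)
    have "odd (ps ! i)" using pr IH False by (intro prime_odd_nat) auto
    with \<open>odd (ps ! Suc i)\<close> less have "ps ! i + 2 \<le> ps ! Suc i" by presburger
    with IH show ?thesis by (simp add: odd_bound_def)
  qed
qed

text \<open>The \<open>h\<close> smallest primes are sieved exactly and the \<open>l\<close> others
  by the union bound, so the error is \<open>(1 + l) * 2 ^ h\<close> instead of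
  \<open>2 ^ (h + l)\<close>. With \<open>odd_bound\<close> in place of the primes the main term
  depends on \<open>h\<close> and \<open>l\<close> alone.\<close>

lemma card_coprime_below_ge:
  assumes "finite E" "\<forall>q\<in>E. prime q" "card E = h + l" "t \<ge> 0"
    and "(\<Sum>i\<in>{h..<h + l}. 1 / odd_bound i) \<le> 1"
  shows "t * ((\<Prod>i<h. 1 - 1 / odd_bound i) * (1 - (\<Sum>i\<in>{h..<h + l}. 1 / odd_bound i)))
    - (1 + real l) * 2 ^ h \<le> real (card (coprime_below t E))"
proof -
  define ps where "ps = sorted_list_of_set E"
  have ps: "sorted_wrt (<) ps" "set ps = E" "distinct ps" "length ps = h + l"
    using assms(1,3) by (simp_all add: ps_def)
  have nth: "odd_bound i \<le> real (ps ! i)" if "i < h + l" for i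
    using nth_prime_ge[OF ps(1)] assms(2) ps that by auto
  have odd2: "2 \<le> odd_bound i" for i by (simp add: odd_bound_def)
  define E1 where "E1 = set (take h ps)"
  define E2 where "E2 = set (drop h ps)"
  have E: "E = E1 \<union> E2" "E1 \<inter> E2 = {}" "finite E1" "finite E2"
    using ps by (auto simp: E1_def E2_def set_take_disj_set_drop_if_distinct
        simp flip: set_append)
  have card1: "card E1 = h" using ps by (simp add: E1_def distinct_card)
  have card2: "card E2 = l" using ps by (simp add: E2_def distinct_card)
  have pr: "\<forall>q\<in>E1. prime q" "\<forall>q\<in>E2. prime q" using assms(2) E by auto
  define P where "P = (\<Prod>q\<in>E1. 1 - 1 / real q)"
  define S where "S = (\<Sum>q\<in>E2. 1 / real q)"
  have "take h ps = map ((!) ps) [0..<h]"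
    using ps by (intro nth_equalityI) auto
  then have "P = (\<Prod>q\<in>(!) ps ` {..<h}. 1 - 1 / real q)"
    unfolding P_def E1_def by (simp add: lessThan_atLeast0)
  also have "\<dots> = (\<Prod>i<h. 1 - 1 / real (ps ! i))"
    using ps by (subst prod.reindex) (auto intro: inj_on_nth)
  also have "\<dots> \<ge> (\<Prod>i<h. 1 - 1 / odd_bound i)"
  proof (intro prod_mono conjI)
    fix i assume "i \<in> {..<h}"
    then have "odd_bound i \<le> real (ps ! i)" using nth by auto
    then show "1 - 1 / odd_bound i \<le> 1 - 1 / real (ps ! i)"
      using odd2[of i] by (simp add: frac_le)
    show "0 \<le> 1 - 1 / odd_bound i" using odd2[of i] by (simp add: field_simps)
  qed
  finally have P: "(\<Prod>i<h. 1 - 1 / odd_bound i) \<le> P" .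
  have P0: "0 \<le> (\<Prod>i<h. 1 - 1 / odd_bound i)"
  proof (rule prod_nonneg)
    fix i
    show "0 \<le> 1 - 1 / odd_bound i" using odd2[of i] by (simp add: field_simps)
  qed
  have "drop h ps = map ((!) ps) [h..<h + l]"
    using ps by (intro nth_equalityI) auto
  then have "S = (\<Sum>q\<in>(!) ps ` {h..<h + l}. 1 / real q)"
    unfolding S_def E2_def by simp
  also have "\<dots> = (\<Sum>i\<in>{h..<h + l}. 1 / real (ps ! i))"
    using ps by (subst sum.reindex) (auto intro: inj_on_nth)
  also have "\<dots> \<le> (\<Sum>i\<in>{h..<h + l}. 1 / odd_bound i)"
    by (intro sum_mono frac_le) (use nth odd2 in \<open>auto intro: less_le_trans[OF _ odd2]\<close>)
  finally have S: "S \<le> (\<Sum>i\<in>{h..<h + l}. 1 / odd_bound i)" .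
  have bound: "real (card (coprime_below (t / q) E1)) \<le> t * P * (1 / real q) + 2 ^ h" for q :: nat
    using legendre_sieve[OF E(3) pr(1), of "t / q"] assms(4) card1 by (simp add: P_def abs_le_iff)
  have "t * P - 2 ^ h \<le> real (card (coprime_below t E1))"
    using legendre_sieve[OF E(3) pr(1) assms(4)] card1 by (simp add: P_def abs_le_iff)
  also have "\<dots> \<le> real (card (coprime_below t E)) + (\<Sum>q\<in>E2. real (card (coprime_below (t / q) E1)))"
    unfolding E(1) using E pr by (intro card_coprime_below_Un) auto
  also have "(\<Sum>q\<in>E2. real (card (coprime_below (t / q) E1))) \<le> (\<Sum>q\<in>E2. t * P * (1 / real q) + 2 ^ h)"
    by (rule sum_mono) (rule bound)
  also have "\<dots> = t * P * S + real l * 2 ^ h"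
    unfolding S_def sum.distrib by (simp add: sum_distrib_left card2)
  finally have "t * (P * (1 - S)) - (1 + real l) * 2 ^ h \<le> real (card (coprime_below t E))"
    by (simp add: algebra_simps)
  moreover have "t * ((\<Prod>i<h. 1 - 1 / odd_bound i) * (1 - (\<Sum>i\<in>{h..<h + l}. 1 / odd_bound i)))
      \<le> t * (P * (1 - S))"
    using P S P0 assms(4,5) by (intro mult_left_mono mult_mono) auto
  ultimately show ?thesis by linarith
qed


section \<open>Explicit choices of the sieve parameters\<close>

definition sieve_ok :: "nat \<Rightarrow> nat \<Rightarrow> real \<Rightarrow> bool" where
  "sieve_ok h l b \<longleftrightarrow> (\<Sum>i\<in>{h..<h + l}. 1 / odd_bound i) \<le> 1 \<and>
    (1 + real l) * 2 ^ h < b * ((\<Prod>i<h. 1 - 1 / odd_bound i)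
      * (1 - (\<Sum>i\<in>{h..<h + l}. 1 / odd_bound i)) - 1 / (real (h + l) + 2))"

text \<open>The error does not depend on \<open>t\<close>, and the surplus of the main term over
  \<open>t / (card E + 2)\<close> is \<open>t\<close> times a positive constant, so the inequality
  at \<open>b\<close> persists beyond \<open>b\<close>.\<close>

lemma sieve_ok_card:
  assumes "sieve_ok h l b" "0 < b" "b \<le> t"
    and "finite E" "\<forall>q\<in>E. prime q" "card E = h + l"
  shows "t / (real (card E) + 2) < real (card (coprime_below t E))"
proof -
  define d where "d = (\<Prod>i<h. 1 - 1 / odd_bound i) * (1 - (\<Sum>i\<in>{h..<h + l}. 1 / odd_bound i))"
  have less: "(1 + real l) * 2 ^ h < b * (d - 1 / (real (h + l) + 2))"
    using assms(1) by (simp add: sieve_ok_def d_def)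
  have "0 < (1 + real l) * 2 ^ h" by simp
  with less have "0 < b * (d - 1 / (real (h + l) + 2))" by linarith
  then have "0 \<le> d - 1 / (real (h + l) + 2)"
    using assms(2) by (simp add: zero_less_mult_iff)
  then have "b * (d - 1 / (real (h + l) + 2)) \<le> t * (d - 1 / (real (h + l) + 2))"
    using assms(3) by (rule mult_right_mono[rotated])
  with less have "(1 + real l) * 2 ^ h < t * d - t / (real (h + l) + 2)"
    by (simp add: algebra_simps)
  moreover have "t * d - (1 + real l) * 2 ^ h \<le> real (card (coprime_below t E))"
    using card_coprime_below_ge[OF assms(4-6), of t] assms by (simp add: sieve_ok_def d_def)
  ultimately show ?thesis using assms(6) by simp
qed

text \<open>3000 is where the large primes begin, and \<open>2 ^ e\<close> is a lower bound
  available to the caller. For 11 and 12 primes neither suffices with \<open>h = 4\<close>; 4522 is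
  the least integer that works for 12.\<close>

lemma sieve_ok_small:
  fixes e :: nat
  shows "e \<le> 2 \<Longrightarrow> sieve_ok e 0 3000"
    and "e \<in> {3..<11} \<Longrightarrow> sieve_ok 3 (e - 3) 3000"
    and "e \<in> {11..<13} \<Longrightarrow> sieve_ok 4 (e - 4) 4522"
    and "e \<in> {13..<16} \<Longrightarrow> sieve_ok 4 (e - 4) (2 ^ e)"
    and "e \<in> {16..<24} \<Longrightarrow> sieve_ok 5 (e - 5) (2 ^ e)"
proof -
  show "e \<le> 2 \<Longrightarrow> sieve_ok e 0 3000"
    by (auto simp: le_Suc_eq numeral_2_eq_2 sieve_ok_def odd_bound_def)
qed (auto simp: atLeastLessThan_nat_numeral lessThan_nat_numeral
    sieve_ok_def odd_bound_def)

text \<open>A product of Wallis type: since \<open>x * (x + 2) \<le> (x + 1)^2\<close>, the factor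
  \<open>(x + 1) / (x + 2)\<close> is at least \<open>sqrt x / sqrt (x + 2)\<close>, and the
  quotients telescope.\<close>

lemma prod_odd_bound_ge:
  "1 / (2 * sqrt (2 * real h + 1)) \<le> (\<Prod>i<Suc h. 1 - 1 / odd_bound i)"
proof (induction h)
  case 0
  then show ?case by (simp add: odd_bound_def)
next
  case (Suc h)
  define x where "x = 2 * real h + 1"
  have x: "x \<ge> 1" by (simp add: x_def)
  have "(x + 2) * x \<le> (x + 1)\<^sup>2" by (simp add: power2_eq_square algebra_simps)
  then have "sqrt (x + 2) * sqrt x \<le> x + 1"
    using x by (metis abs_of_nonneg add_nonneg_nonneg le_numeral_extra(1) order_trans real_sqrt_abs real_sqrt_le_mono real_sqrt_mult)
  then have "1 \<le> (x + 1) / (sqrt (x + 2) * sqrt x)"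
    using x by (subst le_divide_eq_1_pos) auto
  then have "1 / (2 * sqrt (x + 2)) * 1 \<le> 1 / (2 * sqrt (x + 2)) * ((x + 1) / (sqrt (x + 2) * sqrt x))"
    using x by (intro mult_left_mono) auto
  then have "1 / (2 * sqrt (x + 2)) \<le> 1 / (2 * sqrt (x + 2)) * ((x + 1) / (sqrt (x + 2) * sqrt x))"
    by simp
  also have "\<dots> = 1 / (2 * sqrt x) * ((x + 1) / (x + 2))"
    using x by (simp add: divide_simps)
  also have "(x + 1) / (x + 2) = 1 - 1 / (x + 2)"
    using x by (simp add: field_simps)
  finally have "1 / (2 * sqrt (x + 2)) \<le> 1 / (2 * sqrt x) * (1 - 1 / (x + 2))" .
  also have "\<dots> \<le> (\<Prod>i<Suc h. 1 - 1 / odd_bound i) * (1 - 1 / (x + 2))"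
    using Suc.IH x by (intro mult_right_mono) (auto simp: x_def)
  also have "1 - 1 / (x + 2) = 1 - 1 / odd_bound (Suc h)"
    by (simp add: odd_bound_def x_def)
  finally show ?case by (simp add: x_def add.commute)
qed

text \<open>With half of the primes in each part the product is at least
  \<open>1 / (2 * sqrt e)\<close> and the sum at most \<open>1 / 2\<close>. The main coefficient, at
  least \<open>1 / (4 * sqrt e)\<close>, beats \<open>1 / (e + 2)\<close>, while the error is only
  \<open>2 ^ (e / 2)\<close> up to a linear factor.\<close>

lemma sieve_ok_large:
  assumes e: "24 \<le> e"
  shows "sieve_ok ((e + 1) div 2) (e div 2) (2 ^ e)"
proof -
  define h l where "h = (e + 1) div 2" and "l = e div 2"
  have hl: "h + l = e" "l \<le> h" "h \<le> l + 1" "12 \<le> l"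
    using e by (auto simp: h_def l_def)
  have "(\<Sum>i\<in>{h..<h + l}. 1 / odd_bound i) \<le> (\<Sum>i\<in>{h..<h + l}. 1 / (2 * real h))"
    using hl by (intro sum_mono frac_le) (auto simp: odd_bound_def)
  also have "\<dots> = real l / (2 * real h)" by simp
  also have "\<dots> \<le> 1 / 2" using hl by (simp add: field_simps)
  finally have S: "(\<Sum>i\<in>{h..<h + l}. 1 / odd_bound i) \<le> 1 / 2" .
  have "1 / (2 * sqrt (real e)) \<le> 1 / (2 * sqrt (2 * real (h - 1) + 1))"
    using hl by (intro frac_le) (auto simp: of_nat_diff)
  also have "\<dots> \<le> (\<Prod>i<h. 1 - 1 / odd_bound i)"
    using prod_odd_bound_ge[of "h - 1"] hl by simp
  finally have P: "1 / (2 * sqrt (real e)) \<le> (\<Prod>i<h. 1 - 1 / odd_bound i)" .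
  \<comment> \<open>In the form \<open>5 * sqrt e \<le> e + 2\<close> this leaves a quarter of
    \<open>1 / (e + 2)\<close> to absorb the error.\<close>
  have "25 * real e \<le> (real e + 2)\<^sup>2"
  proof -
    have "24 * real e \<le> real e * real e" using e by (intro mult_right_mono) auto
    moreover have "(real e + 2)\<^sup>2 = real e * real e + 4 * real e + 4"
      by (simp add: power2_eq_square algebra_simps)
    ultimately show ?thesis using e by linarith
  qed
  then have "sqrt (25 * real e) \<le> real e + 2"
    by (intro real_le_lsqrt) simp_all
  moreover have "sqrt 25 = (5::real)" by (rule real_sqrt_unique) simp_all
  ultimately have "5 * sqrt (real e) \<le> real e + 2"
    by (simp add: real_sqrt_mult)
  then have "5 / (4 * (real e + 2)) \<le> 1 / (2 * sqrt (real e)) * (1 / 2)"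
    using e by (simp add: field_simps)
  also have "\<dots> \<le> (\<Prod>i<h. 1 - 1 / odd_bound i) * (1 - (\<Sum>i\<in>{h..<h + l}. 1 / odd_bound i))"
  proof (rule mult_mono[OF P])
    show "0 \<le> (\<Prod>i<h. 1 - 1 / odd_bound i)"
      by (rule order_trans[OF _ P]) simp
  qed (use S in simp_all)
  finally have "5 / (4 * (real e + 2)) \<le> (\<Prod>i<h. 1 - 1 / odd_bound i)
      * (1 - (\<Sum>i\<in>{h..<h + l}. 1 / odd_bound i))" .
  moreover have "5 / (4 * (real e + 2)) - 1 / (real e + 2) = 1 / (4 * (real e + 2))"
    by (simp add: divide_simps)
  ultimately have gain: "1 / (4 * (real e + 2)) \<le> (\<Prod>i<h. 1 - 1 / odd_bound i)
      * (1 - (\<Sum>i\<in>{h..<h + l}. 1 / odd_bound i)) - 1 / (real (h + l) + 2)"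
    unfolding hl(1) by (metis diff_right_mono)
  have "2 * (2 * l + 3)\<^sup>2 < (2::nat) ^ l"
    using hl(4)
  proof (induction l rule: nat_induct_at_least)
    case (Suc l)
    have "2 * (2 * Suc l + 3)\<^sup>2 \<le> 2 * (2 * (2 * l + 3)\<^sup>2)"
      using Suc.hyps by (simp add: power2_eq_square algebra_simps)
    with Suc.IH show ?case by simp
  qed simp
  then have "real (2 * (2 * l + 3)\<^sup>2) < real (2 ^ l)" by (simp only: of_nat_less_iff)
  then have pow: "2 * (2 * real l + 3)\<^sup>2 < 2 ^ l" by simp
  have "4 * (real e + 2) * (1 + real l) \<le> 2 * (2 * real l + 3)\<^sup>2"
  proof -
    have "real e + 2 \<le> 2 * real l + 3" using hl by simp
    then have "(real e + 2) * (2 * (1 + real l)) \<le> (2 * real l + 3) * (2 * real l + 3)"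
      by (intro mult_mono) auto
    then show ?thesis by (simp add: power2_eq_square algebra_simps)
  qed
  with pow have "(1 + real l) * 2 ^ h * (4 * (real e + 2)) < 2 ^ l * 2 ^ h"
    by (simp add: mult_ac)
  also have "2 ^ l * 2 ^ h = (2::real) ^ e" using hl by (simp flip: power_add add: add.commute)
  finally have "(1 + real l) * 2 ^ h < 2 ^ e * (1 / (4 * (real e + 2)))"
    by (simp add: field_simps)
  also have "\<dots> \<le> 2 ^ e * ((\<Prod>i<h. 1 - 1 / odd_bound i)
      * (1 - (\<Sum>i\<in>{h..<h + l}. 1 / odd_bound i)) - 1 / (real (h + l) + 2))"
    using gain by (rule mult_left_mono) simp
  finally show ?thesis
    using S unfolding sieve_ok_def h_def[symmetric] l_def[symmetric] by linarith
qed

lemma card_coprime_below_gt: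
  assumes E: "finite E" "\<forall>q\<in>E. prime q"
    and N: "3000 \<le> N" "2 ^ card E \<le> N" "10 < card E \<Longrightarrow> 4522 \<le> N"
  shows "real N / (real (card E) + 2) < real (card (coprime_below (real N) E))"
proof -
  have N': "(2::real) ^ card E \<le> real N" "10 < card E \<Longrightarrow> 4522 \<le> real N" "3000 \<le> real N"
    using N by (metis of_nat_le_iff of_nat_numeral of_nat_power) (use N in auto)
  consider "card E \<ge> 24" | "card E < 24" by linarith
  then show ?thesis
  proof cases
    case 1
    then show ?thesis
      using sieve_ok_card[OF sieve_ok_large[OF 1] _ N'(1) E] by simp
  next
    case 2
    then consider "card E \<le> 2" | "card E \<in> {3..<11}" | "card E \<in> {11..<13}"
      | "card E \<in> {13..<16}" | "card E \<in> {16..<24}"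
      by force
    then have "\<exists>h l b. sieve_ok h l b \<and> 0 < b \<and> b \<le> real N \<and> card E = h + l"
    proof cases
      case 1
      show ?thesis
        by (rule exI[of _ "card E"], rule exI[of _ "0"], rule exI[of _ "3000"])
          (use sieve_ok_small(1)[OF 1] 1 N' in simp)
    next
      case 2
      show ?thesis
        by (rule exI[of _ "3"], rule exI[of _ "card E - 3"], rule exI[of _ "3000"])
          (use sieve_ok_small(2)[OF 2] 2 N' in simp)
    next
      case 3
      show ?thesis
        by (rule exI[of _ "4"], rule exI[of _ "card E - 4"], rule exI[of _ "4522"])
          (use sieve_ok_small(3)[OF 3] 3 N' in simp)
    next
      case 4
      show ?thesis
        by (rule exI[of _ "4"], rule exI[of _ "card E - 4"], rule exI[of _ "2 ^ card E"])
          (use sieve_ok_small(4)[OF 4] 4 N' in simp)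
    next
      case 5
      show ?thesis
        by (rule exI[of _ "5"], rule exI[of _ "card E - 5"], rule exI[of _ "2 ^ card E"])
          (use sieve_ok_small(5)[OF 5] 5 N' in simp)
    qed
    then show ?thesis using sieve_ok_card E by blast
  qed
qed

section \<open>Products of primes modulo a large prime\<close>

lemma card_primes_upto_mono: "m \<le> n \<Longrightarrow> card (primes_upto m) \<le> card (primes_upto n)"
  by (rule card_mono) (auto simp: primes_upto_def)

locale prime_units =
  fixes p :: nat and G :: "int monoid"
  assumes prime: "prime p"
  defines "G \<equiv> units_of (residue_ring (int p))"
begin

lemma group_facts:
  shows "comm_group G" and "carrier G = {1..int p - 1}" and "finite (carrier G)"
    and "order G = p - 1" and "x \<otimes>\<^bsub>G\<^esub> y = x * y mod int p" and "\<one>\<^bsub>G\<^esub> = 1"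
proof -
  interpret R: residues_prime p "residue_ring (int p)"
    by unfold_locales (auto intro: prime)
  show "comm_group G"
    unfolding G_def by (rule R.units_comm_group)
  show c: "carrier G = {1..int p - 1}"
    unfolding G_def units_of_carrier R.res_prime_units_eq
    using prime_gt_1_nat[OF prime] by (auto simp: of_nat_diff)
  then show "finite (carrier G)" "order G = p - 1"
    using prime_gt_1_nat[OF prime] by (auto simp: order_def)
  show "x \<otimes>\<^bsub>G\<^esub> y = x * y mod int p" "\<one>\<^bsub>G\<^esub> = 1"
    unfolding G_def units_of_mult units_of_one by (simp_all add: residue_ring_def)
qed

sublocale comm_group G by (rule group_facts)

lemma finprod_eq:
  assumes "finite S" "S \<subseteq> carrier G"
  shows "finprod G (\<lambda>x. x) S = \<Prod>S mod int p"
  using assms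
proof (induction S)
  case empty
  then show ?case using prime_gt_1_nat[OF prime] by (simp add: group_facts(6))
next
  case (insert x S)
  then have "finprod G (\<lambda>x. x) (insert x S) = x \<otimes>\<^bsub>G\<^esub> finprod G (\<lambda>x. x) S"
    by (intro finprod_insert) auto
  with insert show ?case by (simp add: group_facts(5) mod_mult_right_eq)
qed

lemma in_subgroup_if_prime_factors:
  assumes K: "subgroup K G" and n: "0 < n" "n < p" and q: "\<And>q. prime q \<Longrightarrow> q dvd n \<Longrightarrow> int q \<in> K"
  shows "int n \<in> K"
  using n q
proof (induction n rule: less_induct)
  case (less n)
  show ?case
  proof (cases "n = 1")
    case True
    then show ?thesis using subgroup.one_closed[OF K] by (simp add: group_facts(6))
  next
    case False
    then obtain q where q: "prime q" "q dvd n" using prime_factor_nat by blast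
    then obtain m where m: "n = q * m" by auto
    have "m > 0" using m less.prems(1) by auto
    have "q > 1" using q prime_gt_1_nat by auto
    then have "m < n" using m \<open>m > 0\<close> by simp
    then have "int m \<in> K"
      using less.IH[OF \<open>m < n\<close> \<open>m > 0\<close>] less.prems(2,3) \<open>m < n\<close> m by (simp add: dvd_mult)
    moreover have "int q \<in> K" using less.prems(3) q by simp
    ultimately have "int q \<otimes>\<^bsub>G\<^esub> int m \<in> K" by (intro subgroup.m_closed[OF K])
    \<comment> \<open>The product \<open>q * m = n\<close> is below \<open>p\<close>, so
      multiplication in the group involves no reduction.\<close>
    then show ?thesis
      using less.prems(2) m by (simp add: group_facts(5) flip: of_nat_mult)
  qed
qed

text \<open>If \<open>K\<close> has index \<open>k\<close> and contains all but at most \<open>k - 2\<close> primes below \<open>p\<close>, then too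
  many integers below \<open>p\<close> have all their prime factors in \<open>K\<close>.\<close>

lemma many_primes_outside_subgroup:
  assumes N: "N = p - 1" "3000 \<le> N" and h: "N \<le> h" "h < 2 ^ B"
    and c: "c \<le> card (primes_upto N)" "B * B + B \<le> 2 * c" "4522 \<le> N \<or> N < 13 * (c - 10)"
    and m: "2 * h \<le> m * (c + 3)"
    and K: "subgroup K G" "K \<noteq> carrier G" "m \<le> card K"
  shows "order G \<le> card K * (card (int ` primes_upto N - K) + 1)"
proof (rule ccontr)
  assume *: "\<not> ?thesis"
  define E where "E = {q \<in> primes_upto N. int q \<notin> K}"
  define e where "e = card E"
  define u where "u = card (primes_upto N)"
  have Kf: "finite K" using subgroup.subset[OF K(1)] group_facts(3) finite_subset by auto
  have E: "finite E" "\<forall>q\<in>E. prime q" by (auto simp: E_def primes_upto_def)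
  have "int ` primes_upto N - K = int ` E" by (auto simp: E_def)
  then have "card (int ` primes_upto N - K) = e" by (simp add: e_def card_image)
  with * have less: "card K * (e + 1) < N"
    using group_facts(4) N(1) by simp
  obtain k where k: "N = card K * k"
    using lagrange_finite[OF group_facts(3) K(1)] group_facts(4) N(1) by (metis mult.commute)
  \<comment> \<open>As \<open>k\<close> is the index of \<open>K\<close>, the negated claim says
    \<open>k \<ge> e + 2\<close>.\<close>
  have "card K * (e + 1) < card K * k" using less by (rule ord_less_eq_trans) (rule k)
  then have "e + 1 < k" by (simp only: mult_less_cancel1)
  then have index: "card K * (e + 2) \<le> N"
    by (subst k) (intro mult_le_mono2, simp)
  have sub: "int ` coprime_below (real N) E \<subseteq> K"
  proof
    fix x assume "x \<in> int ` coprime_below (real N) E"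
    then obtain n where n: "x = int n" "0 < n" "n \<le> N" "\<forall>q\<in>E. \<not> q dvd n"
      by (auto simp: coprime_below_def)
    have "int n \<in> K"
    proof (rule in_subgroup_if_prime_factors[OF K(1) n(2)])
      show "n < p" using n N by simp
      fix q assume "prime q" "q dvd n"
      then have "q \<in> primes_upto N"
        using n dvd_imp_le[of q n] by (auto simp: primes_upto_def)
      with \<open>q dvd n\<close> n(4) show "int q \<in> K" by (auto simp: E_def)
    qed
    then show "x \<in> K" using n by simp
  qed
  then have le: "card (coprime_below (real N) E) \<le> card K"
    using card_mono[OF Kf sub] by (simp add: card_image)
  have "int ` insert 1 (primes_upto N - E) \<subseteq> K"
    using subgroup.one_closed[OF K(1)] by (auto simp: E_def group_facts(6))
  then have "card (insert 1 (primes_upto N - E)) \<le> card K"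
    using card_mono[OF Kf, of "int ` insert 1 (primes_upto N - E)"]
    by (simp only: card_image inj_on_of_nat)
  moreover have "card (insert 1 (primes_upto N - E)) = Suc (u - e)"
    unfolding u_def e_def using E(1)
  proof (subst card_insert_disjoint)
    show "Suc (card (primes_upto N - E)) = Suc (card (primes_upto N) - card E)"
      using E(1) by (subst card_Diff_subset) (auto simp: E_def)
  qed (auto simp: primes_upto_def)
  moreover have "e \<le> u" unfolding u_def e_def by (intro card_mono) (auto simp: E_def)
  ultimately have K_ge: "u + 1 - e \<le> card K" by simp
  \<comment> \<open>\<open>K\<close> contains 1 and the \<open>u - e\<close> primes that are not in
    \<open>E\<close>.\<close>
  have prod: "(u + 1 - e) * (e + 2) \<le> N"
    using mult_le_mono1[OF K_ge, of "e + 2"] index by linarith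
  \<comment> \<open>The lower bound \<open>m\<close> for \<open>card K\<close> limits
    \<open>e + 2\<close> to \<open>(c + 3) / 2\<close>, which keeps \<open>e\<close> on the
    increasing branch of the product considered next.\<close>
  have e_le: "2 * (e + 2) \<le> u + 3"
  proof -
    have "m * (2 * (e + 2)) \<le> 2 * (card K * (e + 2))"
      using K(3) mult_le_mono1 by (metis mult.left_commute mult_le_mono2)
    also have "\<dots> \<le> 2 * h" using index h(1) by simp
    also have "\<dots> \<le> m * (c + 3)" by (rule m)
    also have "\<dots> \<le> m * (u + 3)" using c(1) by (simp add: u_def)
    finally have "m * (2 * (e + 2)) \<le> m * (u + 3)" .
    moreover have "m > 0" using m h N by (intro gr0I) auto
    ultimately show ?thesis by (simp only: mult_le_cancel1)
  qed
  text \<open>The product \<open>(x + 2) * (u + 1 - x)\<close> increases up to \<open>x = (u - 1) / 2\<close>.\<close>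
  have mono: "(d + 2) * (u + 1 - d) \<le> (u + 1 - e) * (e + 2)" if "d \<le> e" for d
  proof -
    obtain r where r: "e = d + r" using \<open>d \<le> e\<close> le_Suc_ex by blast
    obtain s where s: "u + 3 = 2 * (e + 2) + s" using e_le le_Suc_ex by blast
    then have a: "u + 1 - d = d + 2 * r + s + 2" "u + 1 - e = d + r + s + 2" "e + 2 = d + r + 2"
      using r by simp_all
    show ?thesis unfolding a by (simp add: algebra_simps)
  qed
  \<comment> \<open>\<open>b\<close> is the binary length of \<open>N\<close>; the aim is
    \<open>e < b\<close>, which yields the \<open>2 ^ e \<le> N\<close> that the sieve asks
    for.\<close>
  define b where "b = (LEAST b. N < 2 ^ b)"
  have b: "N < 2 ^ b" "b \<le> B"
    unfolding b_def using h by (auto intro: LeastI[of _ B] Least_le order.strict_trans1)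
  have b0: "b > 0" using b(1) N(2) by (intro gr0I) auto
  then have b': "2 ^ (b - 1) \<le> N"
    using not_less_Least[of "b - 1" "\<lambda>b. N < 2 ^ b"] unfolding b_def[symmetric] by simp
  have lcm: "N - 1 \<le> b * u"
    using card_primes_upto_ge[of N 1 b] b N by (simp add: u_def)
  have "e < b"
  proof (rule ccontr)
    \<comment> \<open>At \<open>b\<close> the product equals
      \<open>b * u + 2 + (2 * u - b - b^2)\<close>, hence is at least \<open>b * u + 2\<close>,
      against \<open>N \<le> b * u + 1\<close>.\<close>
    assume "\<not> e < b"
    then have *: "(b + 2) * (u + 1 - b) \<le> N" using mono[of b] prod by simp
    have "b * b + b \<le> B * B + B" using b(2) by (intro add_mono mult_le_mono)
    then have bu: "b * b + b \<le> 2 * u" using c by (simp add: u_def)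
    have "b \<le> u"
      using e_le \<open>\<not> e < b\<close> by simp
    then obtain s where "u = b + s" using le_Suc_ex by blast
    then show False using * lcm bu N(2) by (simp add: algebra_simps)
  qed
  then have "(2::nat) ^ e \<le> 2 ^ (b - 1)" by (intro power_increasing) auto
  from this b' have "2 ^ e \<le> N" by (rule order_trans)
  \<comment> \<open>More than ten primes outside \<open>K\<close> force
    \<open>13 * (u - 10) \<le> N\<close>, which the hypothesis on \<open>c\<close> allows only from
    4522 on.\<close>
  moreover have "4522 \<le> N" if "10 < e"
  proof -
    have "13 * (u + 1 - 11) \<le> N" using mono[of 11] prod that by simp
    moreover have "c - 10 \<le> u + 1 - 11" using c(1) by (simp add: u_def)
    ultimately have "\<not> N < 13 * (c - 10)" by linarith
    with c(3) show ?thesis by simp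
  qed
  ultimately have "real N / (real e + 2) < real (card (coprime_below (real N) E))"
    using card_coprime_below_gt[OF E N(2)] by (simp add: e_def)
  also have "\<dots> \<le> real (card K)" using le by simp
  finally have "real N < real (card K) * (real e + 2)" by (simp add: field_simps)
  then have "real N < real (card K * (e + 2))" by (simp add: algebra_simps)
  then show False using index by (simp only: of_nat_less_iff)
qed

text \<open>Only numerical conditions remain: \<open>h\<close> and \<open>B\<close> bound the order
  and its binary length, \<open>c\<close> is a lower bound for the number of primes, and
  \<open>m\<close> for the order of the subgroup in which the descent ends.\<close>

theorem prime_products_cover:
  assumes "3000 \<le> p - 1" "p - 1 \<le> h" "h < 2 ^ B"
    and "c \<le> card (primes_upto (p - 1))" "B * B + B \<le> 2 * c" "4522 \<le> p - 1 \<or> p - 1 < 13 * (c - 10)"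
    and "2 * h \<le> m * (c + 3)" and ts: "descends ts c h m"
    and a: "0 < a" "a < int p"
  shows "\<exists>S. finite S \<and> (\<forall>q\<in>S. prime q \<and> q < int p) \<and> [\<Prod>S = a] (mod int p)"
proof -
  let ?A = "int ` primes_upto (p - 1)"
  have A: "?A \<subseteq> carrier G"
  proof
    fix x assume "x \<in> ?A"
    then obtain q where "x = int q" "prime q" "q \<le> p - 1" by (auto simp: primes_upto_def)
    then show "x \<in> carrier G"
      using prime_gt_0_nat[of q] prime_gt_0_nat[OF prime] by (simp add: group_facts(2) of_nat_diff)
  qed
  have "subprods ?A = carrier G"
  proof (rule subprods_eq_carrier[OF group_facts(3) A ts])
    show "c \<le> card ?A" using assms(4) by (simp only: card_image inj_on_of_nat)
    show "order G \<le> h" using assms(2) group_facts(4) by simp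
    show "order G \<le> card K * (card (?A - K) + 1)"
      if "subgroup K G" "K \<noteq> carrier G" "m \<le> card K" for K
      by (rule many_primes_outside_subgroup[OF refl assms(1-7) that])
  qed
  then have "a \<in> subprods ?A" using a by (simp add: group_facts(2))
  then obtain S where S: "S \<subseteq> ?A" "a = finprod G (\<lambda>x. x) S" by (auto simp: subprods_def)
  have "finite S" using S(1) by (rule finite_subset) simp
  have "[\<Prod>S = a] (mod int p)"
    using S finprod_eq[OF \<open>finite S\<close>] A by (auto simp: cong_def)
  moreover have "prime q \<and> q < int p" if "q \<in> S" for q
    using that S(1) prime_gt_0_nat[OF prime] by (auto simp: primes_upto_def)
  ultimately show ?thesis using \<open>finite S\<close> by blast
qed

end


text \<open>Growth to a quarter is required for the largest number of generators and the final
  growth for the smallest number and the largest order, so each inequality serves all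
  \<open>k\<close> rounds. After \<open>k\<close> halvings the order is below the number of
  generators left.\<close>

lemma descends_replicate:
  assumes "2 * (a + b) * k \<le> c" "c * 4 ^ a \<le> 4 * 7 ^ a"
    and "6 * h < (3 + 2 * b) * (c - 2 * (a + b) * k)" "h < 2 ^ k * (c - 2 * (a + b) * k)"
    and "m \<le> c - 2 * (a + b) * k"
  shows "descends (replicate k (a, b)) c h m"
  using assms
proof (induction k arbitrary: c h)
  case (Suc k)
  define d where "d = 2 * (a + b)"
  have d: "d \<le> c" "c - d - d * k = c - d * Suc k" "d * k \<le> c - d"
    using Suc.prems(1) by (simp_all add: d_def algebra_simps)
  have w: "6 * (h div 2) < (3 + 2 * b) * (c - d * Suc k)" "6 * h < (3 + 2 * b) * (c - d)"
  proof -
    show "6 * (h div 2) < (3 + 2 * b) * (c - d * Suc k)"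
      using Suc.prems(3) unfolding d_def by linarith
    have "(3 + 2 * b) * (c - d * Suc k) \<le> (3 + 2 * b) * (c - d)"
      by (intro mult_le_mono2) simp
    then show "6 * h < (3 + 2 * b) * (c - d)"
      using Suc.prems(3) unfolding d_def by linarith
  qed
  moreover have pow: "(c - d) * 4 ^ a \<le> 4 * 7 ^ a"
    using Suc.prems(2) by (rule order_trans[rotated]) simp
  moreover have "h div 2 < 2 ^ k * (c - d * Suc k)"
    using Suc.prems(4) unfolding d_def by simp
  ultimately have "descends (replicate k (a, b)) (c - d) (h div 2) m"
    using d Suc.prems(5) unfolding d_def by (intro Suc.IH) simp_all
  then show ?case
    using w(2) pow d(1) by (simp add: d_def)
qed simp

text \<open>This is \<open>7 l + 126 l^2 k \<le> 2 ^ l\<close> for \<open>4 k \<le> l + 8\<close>,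
  multiplied by 4. It fails at 18, where 1061928 stands against 1048576; hence the start of the
  uniform argument at \<open>2 ^ 19\<close>.\<close>

lemma power_growth: "19 \<le> a \<Longrightarrow> 28 * a + 126 * a\<^sup>2 * (a + 8) \<le> 4 * 2 ^ a" for a :: nat
proof (induction a rule: nat_induct_at_least)
  case (Suc a)
  have "28 * Suc a + 126 * (Suc a)\<^sup>2 * (Suc a + 8) \<le> 2 * (28 * a + 126 * a\<^sup>2 * (a + 8))"
  proof -
    obtain r where "a = 19 + r" using Suc.hyps le_Suc_ex by blast
    then show ?thesis by (simp add: power2_eq_square algebra_simps)
  qed
  with Suc.IH show ?case by simp
qed simp

text \<open>It certifies that \<open>k = a div 4 + 2\<close> rounds are enough: \<open>2 ^ k\<close>
  has to reach \<open>7 a / 3\<close>.\<close>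

lemma linear_le_power: "19 \<le> a \<Longrightarrow> 7 * a \<le> 3 * 2 ^ (a div 4 + 2)" for a :: nat
proof -
  assume "19 \<le> a"
  have "28 * j + 21 \<le> 12 * 2 ^ j" if "4 \<le> j" for j :: nat
    using that by (induction j rule: nat_induct_at_least) auto
  moreover have "4 \<le> a div 4" using \<open>19 \<le> a\<close> by linarith
  moreover have "7 * a \<le> 28 * (a div 4) + 21" by linarith
  ultimately show ?thesis by (force simp: power_add)
qed

section \<open>Parameters for all primes above 3000\<close>

context prime_units
begin

text \<open>Primes are counted at the lower end \<open>n\<close> of a range and the order is bounded
  by its upper end \<open>h\<close>. The strict inequality admits \<open>u * (n - 1) / v\<close>
  rounded up as \<open>c\<close>.\<close>

lemma range_cover:
  assumes "n \<le> p - 1" "p - 1 \<le> h" "h < 2 ^ B" "4522 \<le> n" "0 < u" "n ^ u \<le> 2 ^ v" "v * c < u * (n - 1) + v"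
    and "B * B + B \<le> 2 * c" "2 * h \<le> m * (c + 3)" "descends ts c h m" and a: "0 < a" "a < int p"
  shows "\<exists>S. finite S \<and> (\<forall>q\<in>S. prime q \<and> q < int p) \<and> [\<Prod>S = a] (mod int p)"
proof -
  have "u * (n - 1) \<le> v * card (primes_upto n)"
    using assms by (intro card_primes_upto_ge) auto
  then have "v * c < v * (card (primes_upto n) + 1)" using assms(7) by simp
  then have "c \<le> card (primes_upto n)" by (simp only: mult_less_cancel1) simp
  also have "\<dots> \<le> card (primes_upto (p - 1))" using assms(1) by (rule card_primes_upto_mono)
  finally show ?thesis
    using assms by (intro prime_products_cover[of h B c m ts]) auto
qed

text \<open>With \<open>n = 2 ^ l \<le> p - 1 < 2 n\<close> there are about \<open>n / l\<close>
  primes. The choice \<open>a = 2 l\<close> works because \<open>(49 / 16) ^ l \<ge> 2 ^ l\<close>,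
  and \<open>b = 7 l\<close> because \<open>14 * l * x \<ge> 12 * n\<close>. The \<open>k\<close>
  rounds use up \<open>18 l k\<close> primes, leaving \<open>x\<close>.\<close>

lemma large_cover:
  assumes "2 ^ 19 \<le> p - 1" and a: "0 < a" "a < int p"
  shows "\<exists>S. finite S \<and> (\<forall>q\<in>S. prime q \<and> q < int p) \<and> [\<Prod>S = a] (mod int p)"
proof -
  obtain l where l: "2 ^ l \<le> p - 1" "p - 1 < 2 ^ (l + 1)"
    using ex_power_ivl1[of 2 "p - 1"] assms(1) by auto
  have l19: "19 \<le> l"
  proof (rule ccontr)
    assume "\<not> 19 \<le> l"
    then have "2 ^ (l + 1) \<le> (2::nat) ^ 19" by (intro power_increasing) auto
    with l assms(1) show False by linarith
  qed
  define n where "n = (2::nat) ^ l"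
  define k where "k = l div 4 + 2"
  define c where "c = (n - 1) div l"
  define x where "x = c - 2 * (2 * l + 7 * l) * k"
  have nl: "7 * l + 126 * (l * l * k) \<le> n"
  proof -
    have "4 * k \<le> l + 8" by (simp add: k_def)
    then have "126 * (l * l) * (4 * k) \<le> 126 * (l * l) * (l + 8)" by (rule mult_le_mono2)
    then show ?thesis
      using power_growth[OF l19] by (simp add: n_def power2_eq_square algebra_simps)
  qed
  have k6: "6 \<le> k" using l19 by (simp add: k_def)
  have ll: "19 * l \<le> l * l" using l19 by simp
  then have "6 * (l * l) \<le> l * l * k" using k6 by simp
  then have n2: "756 * (l * l) \<le> n" using nl by linarith
  have n1: "1 < n" using n2 ll l19 by linarith
  have lc: "n \<le> l * c + l" "l * c \<le> n"
  proof -
    have "n - 1 = l * c + (n - 1) mod l" by (simp add: c_def)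
    moreover have "(n - 1) mod l < l" using l19 by simp
    ultimately show "n \<le> l * c + l" "l * c \<le> n" using n1 by linarith+
  qed
  have "l * (18 * (l * k)) = 18 * (l * l * k)" by simp
  also have "\<dots> \<le> l * c" using nl lc by linarith
  finally have "l * (18 * (l * k)) \<le> l * c" .
  then have dk: "2 * (2 * l + 7 * l) * k \<le> c" using l19 by (simp add: mult_ac)
  have "l * c = l * x + l * (2 * (2 * l + 7 * l) * k)"
    unfolding x_def using dk by (simp flip: add_mult_distrib2)
  \<comment> \<open>As \<open>126 = 7 * 18\<close>, the inequality \<open>nl\<close> says that
    rounding and the elements used up cost at most a seventh of \<open>n\<close>.\<close>
  then have lx: "6 * n \<le> 7 * (l * x)"
    using nl lc by (simp add: algebra_simps)
  have h: "2 * n - 1 < 2 ^ k * x"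
  proof -
    have "7 * l * (2 * n) \<le> 3 * 2 ^ k * (2 * n)"
      using linear_le_power[OF l19] by (intro mult_le_mono1) (simp add: k_def)
    also have "\<dots> = 2 ^ k * (6 * n)" by simp
    also have "\<dots> \<le> 2 ^ k * (7 * (l * x))" using lx by (rule mult_le_mono2)
    finally have "7 * l * (2 * n) \<le> 7 * l * (2 ^ k * x)" by (simp add: mult_ac)
    then have "2 * n \<le> 2 ^ k * x" using l19 by (simp only: mult_le_cancel1)
    then show ?thesis using n1 by linarith
  qed
  have w: "6 * (2 * n - 1) < (3 + 2 * (7 * l)) * x"
  proof -
    have "(3 + 2 * (7 * l)) * x = 3 * x + 14 * (l * x)" by (simp add: algebra_simps)
    then show ?thesis using lx n1 by linarith
  qed
  have pow: "c * 4 ^ (2 * l) \<le> 4 * 7 ^ (2 * l)"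
  proof -
    have "c \<le> n" using lc l19 by (metis le_trans mult_le_mono1 nat_mult_1 one_le_numeral order_trans)
    then have "c * 4 ^ (2 * l) \<le> n * 4 ^ (2 * l)" by (rule mult_le_mono1)
    also have "\<dots> = 32 ^ l" by (simp add: n_def power_mult flip: power_mult_distrib)
    also have "\<dots> \<le> 49 ^ l" by (rule power_mono) simp_all
    also have "49 ^ l = (7::nat) ^ (2 * l)" by (simp add: power_mult)
    finally show ?thesis by simp
  qed
  have ts: "descends (replicate k (2 * l, 7 * l)) c (2 * n - 1) x"
    using dk pow w h unfolding x_def by (intro descends_replicate) auto
  have m: "2 * (2 * n - 1) \<le> x * (c + 3)"
  proof -
    have "n \<le> l * (c + 3)" using lc by (simp add: algebra_simps)
    then have "6 * n * n \<le> 7 * (l * x) * (l * (c + 3))" using mult_le_mono[OF lx] by blast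
    moreover have "7 * (l * l) * (4 * n) \<le> 6 * n * n"
      using n2 by simp
    ultimately have "7 * (l * l) * (4 * n) \<le> 7 * (l * x) * (l * (c + 3))"
      by (rule order_trans[rotated])
    then have "7 * (l * l) * (4 * n) \<le> 7 * (l * l) * (x * (c + 3))"
      by (simp only: mult_ac)
    moreover have "0 < 7 * (l * l)" using l19 by simp
    ultimately have "4 * n \<le> x * (c + 3)" by (simp only: mult_le_cancel1)
    then show ?thesis by simp
  qed
  have "l * ((l + 1) * (l + 1) + (l + 1)) \<le> l * (2 * c)"
  proof -
    have "l * (l * l) \<le> 4 * (l * l * k)"
    proof -
      have "l \<le> 4 * k" by (simp add: k_def)
      then have "l * l * l \<le> l * l * (4 * k)" by (rule mult_le_mono2)
      then show ?thesis by (simp add: mult_ac)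
    qed
    moreover have "l * ((l + 1) * (l + 1) + (l + 1)) = l * (l * l) + 3 * (l * l) + 2 * l"
      by (simp add: algebra_simps)
    moreover have "l * (2 * c) = 2 * (l * c)" by simp
    ultimately show ?thesis using nl lc \<open>6 * (l * l) \<le> l * l * k\<close> by linarith
  qed
  then have B: "(l + 1) * (l + 1) + (l + 1) \<le> 2 * c" using l19 by (simp only: mult_le_cancel1)
  have "1 * (n - 1) \<le> l * card (primes_upto n)"
    using n1 by (intro card_primes_upto_ge) (auto simp: n_def)
  then have "c \<le> card (primes_upto n)"
    unfolding c_def using l19 by (metis div_le_mono div_mult_self_is_m nat_mult_1 not_numeral_le_zero zero_less_iff_neq_zero mult.commute le_zero_eq)
  also have "\<dots> \<le> card (primes_upto (p - 1))"
    using l(1) by (intro card_primes_upto_mono) (simp add: n_def)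
  finally have c: "c \<le> card (primes_upto (p - 1))" .
  have "p - 1 \<le> 2 * n - 1" "2 * n - 1 < 2 ^ (l + 1)" using l(2) by (simp_all add: n_def)
  with c B m ts show ?thesis
    using assms by (intro prime_products_cover[of "2 * n - 1" "l + 1" c x]) auto
qed

text \<open>In each range \<open>v / u\<close> bounds the binary logarithm of the lower end,
  \<open>c\<close> is the resulting count rounded up, and \<open>m\<close> is what is left of
  \<open>c\<close> after all families in \<open>ts\<close>. The last explicit range ends at 600000,
  beyond \<open>2 ^ 19\<close>.\<close>

lemma cover_from_5400:
  assumes ge: "5400 \<le> p - 1" and a: "0 < a" "a < int p"
  shows "\<exists>S. finite S \<and> (\<forall>q\<in>S. prime q \<and> q < int p) \<and> [\<Prod>S = a] (mod int p)"
proof -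
  consider "p - 1 \<le> 5593" | "5593 \<le> p - 1" by linarith
  then show ?thesis
  proof cases
    case 1
    show ?thesis
      by (rule range_cover[OF ge 1, where u = 5 and v = 62 and B = 13 and c = 436 and m = 44 and
        ts = "[(8, 52), (8, 35), (7, 24), (7, 16), (6, 11), (5, 7), (5, 5)]"]) (use a in simp_all)
  next
    case 2
    note ge = this
  consider "p - 1 \<le> 5916" | "5916 \<le> p - 1" by linarith
  then show ?thesis
  proof cases
    case 1
    show ?thesis
      by (rule range_cover[OF ge 1, where u = 8 and v = 100 and B = 13 and c = 448 and m = 56 and
        ts = "[(8, 53), (8, 36), (7, 24), (7, 16), (6, 10), (6, 6), (5, 4)]"]) (use a in simp_all)
  next
    case 2
    note ge = this
  consider "p - 1 \<le> 6632" | "6632 \<le> p - 1" by linarith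
  then show ?thesis
  proof cases
    case 1
    show ?thesis
      by (rule range_cover[OF ge 1, where u = 7 and v = 88 and B = 13 and c = 471 and m = 29 and
        ts = "[(8, 57), (8, 39), (7, 26), (7, 18), (6, 12), (6, 8), (5, 6), (4, 4)]"]) (use a in simp_all)
  next
    case 2
    note ge = this
  consider "p - 1 \<le> 8204" | "8204 \<le> p - 1" by linarith
  then show ?thesis
  proof cases
    case 1
    show ?thesis
      by (rule range_cover[OF ge 1, where u = 7 and v = 89 and B = 14 and c = 522 and m = 36 and
        ts = "[(9, 64), (8, 44), (7, 30), (7, 20), (6, 13), (6, 9), (5, 6), (4, 5)]"]) (use a in simp_all)
  next
    case 2
    note ge = this
  consider "p - 1 \<le> 11932" | "11932 \<le> p - 1" by linarith
  then show ?thesis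
  proof cases
    case 1
    show ?thesis
      by (rule range_cover[OF ge 1, where u = 8 and v = 105 and B = 14 and c = 625 and m = 59 and
        ts = "[(9, 78), (8, 53), (8, 36), (7, 24), (7, 16), (6, 10), (6, 6), (5, 4)]"]) (use a in simp_all)
  next
    case 2
    note ge = this
  consider "p - 1 \<le> 18000" | "18000 \<le> p - 1" by linarith
  then show ?thesis
  proof cases
    case 1
    show ?thesis
      by (rule range_cover[OF ge 1, where u = 7 and v = 95 and B = 15 and c = 880 and m = 440 and
        ts = "[(10, 75), (9, 44), (9, 24), (9, 13), (9, 6), (9, 3)]"]) (use a in simp_all)
  next
    case 2
    note ge = this
  consider "p - 1 \<le> 36000" | "36000 \<le> p - 1" by linarith
  then show ?thesis
  proof cases
    case 1
    show ?thesis
      by (rule range_cover[OF ge 1, where u = 7 and v = 99 and B = 16 and c = 1273 and m = 715 and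
        ts = "[(10, 102), (10, 58), (10, 31), (10, 16), (10, 8), (10, 4)]"]) (use a in simp_all)
  next
    case 2
    note ge = this
  consider "p - 1 \<le> 120000" | "120000 \<le> p - 1" by linarith
  then show ?thesis
  proof cases
    case 1
    show ?thesis
      by (rule range_cover[OF ge 1, where u = 7 and v = 106 and B = 17 and c = 2378 and m = 1452 and
        ts = "[(12, 179), (11, 100), (11, 54), (11, 28), (11, 14), (11, 7), (11, 3)]"]) (use a in simp_all)
  next
    case 2
    note ge = this
  consider "p - 1 \<le> 600000" | "600000 \<le> p - 1" by linarith
  then show ?thesis
  proof cases
    case 1
    show ?thesis
      by (rule range_cover[OF ge 1, where u = 8 and v = 135 and B = 20 and c = 7112 and m = 5798 and
        ts = "[(14, 274), (14, 144), (14, 73), (14, 37), (14, 18), (14, 9), (14, 4)]"]) (use a in simp_all)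
  next
    case 2
    note ge = this
    show ?thesis using large_cover[OF _ a] ge by simp
  qed
  qed
  qed
  qed
  qed
  qed
  qed
  qed
  qed
qed

text \<open>At 3000 the general bound guarantees only about 260 primes, hence the exact count 430.
  The upper end 5400 stays below \<open>13 * (430 - 10) = 5460\<close>, which rules out more than
  ten primes outside \<open>K\<close>.\<close>

lemma cover_from_3000:
  assumes ge: "3000 \<le> p - 1" and a: "0 < a" "a < int p" and c: "430 \<le> card (primes_upto 3000)"
  shows "\<exists>S. finite S \<and> (\<forall>q\<in>S. prime q \<and> q < int p) \<and> [\<Prod>S = a] (mod int p)"
proof (cases "p - 1 \<le> 5400")
  case True
  have "430 \<le> card (primes_upto (p - 1))"
    using c card_primes_upto_mono[OF ge] by linarith
  then show ?thesis
    by (rule prime_products_cover[OF ge True, where B = 13 and m = 46 and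
      ts = "[(8, 51), (8, 35), (7, 23), (7, 16), (6, 10), (5, 7), (5, 4)]", rotated])
      (use True a in simp_all)
next
  case False
  then show ?thesis using cover_from_5400 a by simp
qed

end

section \<open>Certificates for small primes\<close>

text \<open>With \<open>reduce\<close> this is binary long division: \<open>doubles [] m n\<close>
  lists \<open>2 ^ (n - 1) * m\<close>, ..., \<open>2 * m\<close>, \<open>m\<close>, and
  \<open>reduce\<close> subtracts every entry that fits, using only comparisons and
  subtractions.\<close>

fun doubles :: "int list \<Rightarrow> int \<Rightarrow> nat \<Rightarrow> int list" where
  "doubles xs m 0 = xs"
| "doubles xs m (Suc n) = doubles (m # xs) (m + m) n"

fun reduce :: "int list \<Rightarrow> int \<Rightarrow> int" where
  "reduce [] x = x"
| "reduce (m # ms) x = reduce ms (if m \<le> x then x - m else x)"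

lemma doubles_dvd: "(\<forall>r\<in>set xs. d dvd r) \<Longrightarrow> d dvd m \<Longrightarrow> \<forall>r\<in>set (doubles xs m n). d dvd r"
  by (induction xs m n rule: doubles.induct) auto

lemma reduce_cong: "\<forall>r\<in>set R. m dvd r \<Longrightarrow> [reduce R x = x] (mod m)"
proof (induction R x rule: reduce.induct)
  case (2 r rs x)
  then have "[reduce rs (if r \<le> x then x - r else x) = (if r \<le> x then x - r else x)] (mod m)" by simp
  also have "[(if r \<le> x then x - r else x) = x] (mod m)"
    using 2 by (auto simp: cong_iff_dvd_diff)
  finally show ?case by simp
qed simp

text \<open>Twelve shifts fully reduce nonnegative numbers below \<open>4096 * m\<close>, in
  particular products of two residues modulo a prime below 3000. The congruence holds for any number
  of shifts; too few could only make a check fail.\<close>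

abbreviation shifts :: "int \<Rightarrow> int list"
  where "shifts m \<equiv> doubles [] m 12"

lemma reduce_shifts_cong: "[reduce (shifts m) x = x] (mod m)"
  by (rule reduce_cong) (rule doubles_dvd, auto)

text \<open>Nine shifts give the exact remainder for \<open>x < 512 * d\<close>; for
  \<open>d \<ge> 7\<close> this includes all \<open>x < 3481 = 59^2\<close>, the range decided by
  trial division up to 53.\<close>

fun has_divisor :: "int \<Rightarrow> int list \<Rightarrow> bool" where
  "has_divisor x [] \<longleftrightarrow> False"
| "has_divisor x (d # ds) \<longleftrightarrow> (if x < d * d then False
    else if reduce (doubles [] d 9) x = 0 then True else has_divisor x ds)"

definition trial_primes :: "int list"
  where "trial_primes = [7,11,13,17,19,23,29,31,37,41,43,47,53]"

fun sift :: "int list \<Rightarrow> int list" where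
  "sift [] = []"
| "sift (x # xs) = (if has_divisor x trial_primes then sift xs else x # sift xs)"

text \<open>A wheel modulo 30: a block tests the eight integers coprime to 30 among
  \<open>n + 7\<close>, ..., \<open>n + 36\<close>. Starting at 7 leaves out 1, and the last of the
  100 blocks ends with 3001.\<close>

fun prime_blocks :: "int \<Rightarrow> int list list \<Rightarrow> bool" where
  "prime_blocks n [] \<longleftrightarrow> n = 3000"
| "prime_blocks n (ps # pss) \<longleftrightarrow> sift [n + 7, n + 11, n + 13, n + 17, n + 19, n + 23, n + 29, n + 31] = ps
    \<and> prime_blocks (n + 30) pss"

lemma twelve: "doubles xs m 12 = doubles xs m (Suc (Suc (Suc (Suc (Suc (Suc (Suc (Suc (Suc (Suc (Suc (Suc 0))))))))))))"
  and nine: "doubles xs m 9 = doubles xs m (Suc (Suc (Suc (Suc (Suc (Suc (Suc (Suc (Suc 0)))))))))"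
  by (simp_all add: eval_nat_numeral)

text \<open>One pass certifies distinctness and length; with 2, 3 and 5 the count 428 makes 431
  primes up to 3001.\<close>

fun ascending :: "int \<Rightarrow> int \<Rightarrow> int list \<Rightarrow> bool" where
  "ascending c l [] \<longleftrightarrow> c = 428 \<and> l = 3001"
| "ascending c l (x # xs) \<longleftrightarrow> l < x \<and> ascending (c + 1) x xs"

lemmas arith_eval = arith_simps rel_simps arith_special simp_thms if_True if_False list.pred_inject
  doubles.simps reduce.simps twelve nine list.inject list.distinct

definition blocks_3000 :: "int list list" where
  "blocks_3000 =
    [[7,11,13,17,19,23,29,31], [37,41,43,47,53,59,61], [67,71,73,79,83,89], [97,101,103,107,109,113],
    [127,131,137,139,149,151], [157,163,167,173,179,181], [191,193,197,199,211], [223,227,229,233,239,241],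
    [251,257,263,269,271], [277,281,283,293], [307,311,313,317,331], [337,347,349,353,359],
    [367,373,379,383,389], [397,401,409,419,421], [431,433,439,443,449], [457,461,463,467,479],
    [487,491,499,503,509], [521,523,541], [547,557,563,569,571], [577,587,593,599,601], [607,613,617,619,631],
    [641,643,647,653,659,661], [673,677,683,691], [701,709,719], [727,733,739,743,751], [757,761,769,773],
    [787,797,809,811], [821,823,827,829,839], [853,857,859,863], [877,881,883,887], [907,911,919,929],
    [937,941,947,953], [967,971,977,983,991], [997,1009,1013,1019,1021], [1031,1033,1039,1049,1051],
    [1061,1063,1069], [1087,1091,1093,1097,1103,1109], [1117,1123,1129], [1151,1153,1163,1171],
    [1181,1187,1193,1201], [1213,1217,1223,1229,1231], [1237,1249,1259], [1277,1279,1283,1289,1291],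
    [1297,1301,1303,1307,1319,1321], [1327], [1361,1367,1373,1381], [1399,1409], [1423,1427,1429,1433,1439],
    [1447,1451,1453,1459,1471], [1481,1483,1487,1489,1493,1499], [1511,1523,1531], [1543,1549,1553,1559],
    [1567,1571,1579,1583], [1597,1601,1607,1609,1613,1619,1621], [1627,1637], [1657,1663,1667,1669],
    [1693,1697,1699,1709], [1721,1723,1733,1741], [1747,1753,1759], [1777,1783,1787,1789,1801],
    [1811,1823,1831], [1847,1861], [1867,1871,1873,1877,1879,1889], [1901,1907,1913], [1931,1933,1949,1951],
    [1973,1979], [1987,1993,1997,1999,2003,2011], [2017,2027,2029,2039], [2053,2063,2069],
    [2081,2083,2087,2089,2099], [2111,2113,2129,2131], [2137,2141,2143,2153,2161], [2179],
    [2203,2207,2213,2221], [2237,2239,2243,2251], [2267,2269,2273,2281], [2287,2293,2297,2309,2311],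
    [2333,2339,2341], [2347,2351,2357,2371], [2377,2381,2383,2389,2393,2399], [2411,2417,2423],
    [2437,2441,2447,2459], [2467,2473,2477], [2503,2521], [2531,2539,2543,2549,2551], [2557,2579],
    [2591,2593,2609], [2617,2621,2633], [2647,2657,2659,2663,2671], [2677,2683,2687,2689,2693,2699],
    [2707,2711,2713,2719,2729,2731], [2741,2749,2753], [2767,2777,2789,2791], [2797,2801,2803,2819],
    [2833,2837,2843,2851], [2857,2861,2879], [2887,2897,2903,2909], [2917,2927,2939],
    [2953,2957,2963,2969,2971], [2999,3001]]"

lemma prime_blocks_3000: "prime_blocks 0 blocks_3000"
  by (simp only: blocks_3000_def prime_blocks.simps sift.simps has_divisor.simps trial_primes_def arith_eval
      cong: if_weak_cong)

lemma ascending_3000: "ascending 0 5 (concat blocks_3000)"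
  by (simp only: blocks_3000_def concat.simps append.simps ascending.simps arith_eval)


section \<open>Correctness of the trial division\<close>

lemma reduce_doubles:
  assumes "0 \<le> x" "x < 2 ^ n * m"
  shows "\<exists>y. 0 \<le> y \<and> y < m \<and> reduce (doubles xs m n) x = reduce xs y"
  using assms
proof (induction n arbitrary: xs m)
  case (Suc n)
  obtain y where "0 \<le> y" "y < m + m" "reduce (doubles xs m (Suc n)) x = reduce (m # xs) y"
    using Suc.IH[of "m + m" "m # xs"] Suc.prems by auto
  then show ?case by (intro exI[of _ "if m \<le> y then y - m else y"]) auto
qed auto

lemma reduce_eq_0_iff:
  assumes "0 \<le> x" "x < 512 * d"
  shows "reduce (doubles [] d 9) x = 0 \<longleftrightarrow> d dvd x"
proof -
  obtain y where y: "0 \<le> y" "y < d" "reduce (doubles [] d 9) x = y"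
    using reduce_doubles[of x 9 d "[]"] assms by auto
  have "[reduce (doubles [] d 9) x = x] (mod d)"
    by (rule reduce_cong) (rule doubles_dvd, auto)
  then have "d dvd y \<longleftrightarrow> d dvd x" unfolding y(3) by (rule cong_dvd_iff)
  moreover have "d dvd y \<longleftrightarrow> y = 0"
    using y(1,2) zdvd_not_zless[of y d] by (cases "y = 0") auto
  ultimately show ?thesis using y by simp
qed

lemma not_has_divisor:
  assumes "\<not> has_divisor x ds" "sorted ds" "\<forall>d\<in>set ds. 7 \<le> d" "0 \<le> x" "x < 3481"
    and "d \<in> set ds" "d dvd x"
  shows "x < d * d"
  using assms
proof (induction x ds rule: has_divisor.induct)
  case (2 x e ds)
  have e: "7 \<le> e" using "2.prems"(3) by simp
  show ?case
  proof (cases "x < e * e")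
    case True
    have "e \<le> d" using "2.prems"(2,6) by auto
    then have "e * e \<le> d * d" using e by (intro mult_mono) auto
    with True show ?thesis by simp
  next
    case False
    have nz: "reduce (doubles [] e 9) x \<noteq> 0" "\<not> has_divisor x ds"
      using "2.prems"(1) False by (simp_all split: if_split_asm)
    then have "\<not> e dvd x"
      using e "2.prems"(4,5) by (subst reduce_eq_0_iff[symmetric]) simp_all
    then have "d \<in> set ds" using "2.prems"(6,7) by auto
    then show ?thesis
      using "2.IH"[OF False nz] "2.prems" by simp
  qed
qed simp

lemma has_divisorD:
  assumes "has_divisor x ds" "\<forall>d\<in>set ds. 7 \<le> d" "0 \<le> x" "x < 3481"
  shows "\<exists>d\<in>set ds. d dvd x \<and> d * d \<le> x"
  using assms
proof (induction x ds rule: has_divisor.induct)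
  case (2 x e ds)
  have e: "7 \<le> e" using "2.prems"(2) by simp
  have ne: "\<not> x < e * e" using "2.prems"(1) by (simp split: if_split_asm)
  show ?case
  proof (cases "reduce (doubles [] e 9) x = 0")
    case True
    then have "e dvd x"
      using e "2.prems"(3,4) by (subst reduce_eq_0_iff[symmetric]) simp_all
    with ne show ?thesis by auto
  next
    case False
    moreover have "has_divisor x ds" using "2.prems"(1) ne False by simp
    ultimately show ?thesis using "2.IH"[OF ne False] "2.prems" by auto
  qed
qed simp

lemma has_divisor_iff:
  assumes x: "1 < x" "x < 3481" "\<not> 2 dvd x" "\<not> 3 dvd x" "\<not> 5 dvd x"
  shows "has_divisor x trial_primes \<longleftrightarrow> \<not> prime x"
proof
  assume "has_divisor x trial_primes"
  then have "\<exists>d\<in>set trial_primes. d dvd x \<and> d * d \<le> x"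
    by (rule has_divisorD) (use x(1,2) in \<open>simp_all add: trial_primes_def\<close>)
  then obtain d where d: "d \<in> set trial_primes" "d dvd x" "d * d \<le> x"
    by blast
  have "1 < d" using d(1) by (auto simp: trial_primes_def)
  then have "d \<noteq> x" using d(3) x by (auto simp: mult_le_cancel_left1)
  with d(2) \<open>1 < d\<close> show "\<not> prime x"
    by (auto simp: prime_int_iff intro!: exI[of _ d])
next
  assume "\<not> prime x"
  show "has_divisor x trial_primes"
  proof (rule ccontr)
    assume nd: "\<not> has_divisor x trial_primes"
    obtain a b where ab: "x = a * b" "1 < a" "a \<le> b"
    proof -
      obtain a where a: "a dvd x" "0 \<le> a" "a \<noteq> 1" "a \<noteq> x"
        using \<open>\<not> prime x\<close> x(1) by (auto simp: prime_int_iff)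
      then obtain b where b: "x = a * b" by auto
      have "0 < a" using a(2) b x(1) by (cases "a = 0") auto
      moreover have "0 < b" using b x(1) \<open>0 < a\<close> by (metis zero_less_mult_pos less_trans zero_less_one)
      moreover have "b \<noteq> 1" using a(4) b by auto
      ultimately show ?thesis
        using that[of a b] that[of b a] a(3) b by (cases "a \<le> b") (auto simp: mult.commute)
    qed
    obtain q where q: "prime q" "q dvd a"
      using prime_divisor_exists[of a] ab(2) by auto
    have q0: "1 < q" using q(1) by (simp add: prime_gt_1_int)
    have "q \<le> a" using q(2) ab(2) by (intro zdvd_imp_le) auto
    then have "q * q \<le> a * b" using ab q0 by (intro mult_mono) auto
    then have qq: "q * q \<le> x" using ab(1) by simp
    have qx: "q dvd x" using q(2) ab(1) by simp
    have "q < 59"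
    proof (rule ccontr)
      assume "\<not> q < 59"
      then have "59 * 59 \<le> q * q" by (intro mult_mono) auto
      with qq x(2) show False by simp
    qed
    have "q \<noteq> 2" "q \<noteq> 3" "q \<noteq> 5" using qx x by auto
    moreover have "q \<in> set [2..58]" unfolding set_upto using q0 \<open>q < 59\<close> by simp
    ultimately have "q \<in> set trial_primes"
      using q(1) unfolding trial_primes_def
      by (simp add: upto_rec_numeral del: set_upto) (elim disjE; simp)
    then have "x < q * q"
      by (intro not_has_divisor[OF nd]) (use x qx in \<open>simp_all add: trial_primes_def\<close>)
    with qq show False by simp
  qed
qed

lemma set_sift: "set (sift xs) = {x \<in> set xs. \<not> has_divisor x trial_primes}"
  by (induction xs) (simp_all, blast+)

declare sift.simps [simp del]

lemma coprime_30_cases: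
  assumes "30 dvd n" "n + 7 \<le> x" "x < n + 37" "\<not> 2 dvd x" "\<not> 3 dvd x" "\<not> 5 dvd (x :: int)"
  shows "x \<in> {n + 7, n + 11, n + 13, n + 17, n + 19, n + 23, n + 29, n + 31}"
proof -
  obtain k where n: "n = 30 * k" using assms(1) by auto
  define r where "r = x - n"
  have "r \<in> set [7..36]" unfolding set_upto using assms(2,3) by (simp add: r_def)
  moreover have "x = 30 * k + r" by (simp add: r_def n)
  moreover have "\<not> 2 dvd r" "\<not> 3 dvd r" "\<not> 5 dvd r"
    using assms(4-6) unfolding \<open>x = 30 * k + r\<close> by presburger+
  ultimately have "r \<in> {7, 11, 13, 17, 19, 23, 29, 31}"
    by (simp add: upto_rec_numeral del: set_upto) (elim disjE; simp)
  then show ?thesis by (auto simp: r_def)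
qed

lemma prime_blocks_le: "prime_blocks n pss \<Longrightarrow> n \<le> 3000"
  by (induction n pss rule: prime_blocks.induct) auto

lemma prime_blocks_prime:
  assumes "prime_blocks n pss" "30 dvd n" "0 \<le> n" "x \<in> set (concat pss)"
  shows "prime x"
  using assms
proof (induction n pss rule: prime_blocks.induct)
  case (2 n ps pss)
  have blocks: "sift [n + 7, n + 11, n + 13, n + 17, n + 19, n + 23, n + 29, n + 31] = ps"
    "prime_blocks (n + 30) pss" using "2.prems"(1) by simp_all
  show ?case
  proof (cases "x \<in> set ps")
    case True
    then have x: "x \<in> {n + 7, n + 11, n + 13, n + 17, n + 19, n + 23, n + 29, n + 31}"
      "\<not> has_divisor x trial_primes"
      unfolding blocks(1)[symmetric] set_sift by auto
    obtain k where k: "n = 30 * k" using "2.prems"(2) by auto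
    have "\<not> 2 dvd x" "\<not> 3 dvd x" "\<not> 5 dvd x"
      using x(1) unfolding k by (elim insertE emptyE; presburger)+
    moreover have "1 < x" "x < 3481"
      using x(1) "2.prems"(3) prime_blocks_le[OF blocks(2)] by auto
    ultimately show ?thesis using has_divisor_iff x(2) by blast
  next
    case False
    then show ?thesis
      using "2.IH"[OF blocks(2)] "2.prems"(2-4) by (simp add: dvd_add)
  qed
qed simp

lemma in_prime_blocks:
  assumes "prime_blocks n pss" "30 dvd n" "0 \<le> n" "n + 7 \<le> x" "x < 3007" "prime x"
  shows "x \<in> set (concat pss)"
  using assms
proof (induction n pss rule: prime_blocks.induct)
  case (2 n ps pss)
  have blocks: "sift [n + 7, n + 11, n + 13, n + 17, n + 19, n + 23, n + 29, n + 31] = ps"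
    "prime_blocks (n + 30) pss" using "2.prems"(1) by simp_all
  show ?case
  proof (cases "x < n + 37")
    case True
    have nd: "\<not> 2 dvd x" "\<not> 3 dvd x" "\<not> 5 dvd x"
      using "2.prems"(3,4,6) primes_dvd_imp_eq[of 2 x] primes_dvd_imp_eq[of 3 x] primes_dvd_imp_eq[of 5 x]
      by auto
    have "x \<in> {n + 7, n + 11, n + 13, n + 17, n + 19, n + 23, n + 29, n + 31}"
      by (rule coprime_30_cases[OF "2.prems"(2,4) True nd])
    moreover have "1 < x" "x < 3481" using "2.prems"(3-5) by linarith+
    then have "\<not> has_divisor x trial_primes"
      using has_divisor_iff[OF _ _ nd] "2.prems"(6) by blast
    ultimately have "x \<in> set ps"
      unfolding blocks(1)[symmetric] set_sift by auto
    then show ?thesis by simp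
  next
    case False
    then show ?thesis
      using "2.IH"[OF blocks(2)] "2.prems"(2-6) by (simp add: dvd_add)
  qed
qed simp

lemma prime_list: "list_all prime (concat blocks_3000)"
  using prime_blocks_prime[OF prime_blocks_3000] by (auto simp: list_all_iff)

lemma ascending_gt: "ascending c l xs \<Longrightarrow> \<forall>x\<in>set xs. l < x"
  by (induction c l xs rule: ascending.induct) auto

lemma ascending_le: "ascending c l xs \<Longrightarrow> l \<le> 3001 \<and> (\<forall>x\<in>set xs. x \<le> 3001)"
  by (induction c l xs rule: ascending.induct) auto

lemma ascending_distinct: "ascending c l xs \<Longrightarrow> distinct xs \<and> c + int (length xs) = 428"
proof (induction c l xs rule: ascending.induct)
  case (2 c l x xs)
  then show ?case using ascending_gt[of "c + 1" x xs] by auto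
qed simp

lemma card_primes_upto_3000: "430 \<le> card (primes_upto 3000)"
proof -
  define L where "L = concat blocks_3000"
  have L: "distinct L" "length L = 428" "\<forall>x\<in>set L. 5 < x"
    using ascending_distinct[OF ascending_3000] ascending_gt[OF ascending_3000] by (auto simp: L_def)
  have pr: "prime x" if "x \<in> set L" for x
    using prime_list that unfolding L_def list_all_iff by blast
  have le: "x \<le> 3001" if "x \<in> set L" for x
    using ascending_le[OF ascending_3000] that unfolding L_def by blast
  have "card (set L \<union> {2, 3, 5}) = 431"
    using L by (subst card_Un_disjoint) (auto simp: distinct_card)
  then have "430 \<le> card (set L \<union> {2, 3, 5} - {3001})"
    by (simp add: card_Diff_singleton_if)
  also have "set L \<union> {2, 3, 5} - {3001} \<subseteq> int ` primes_upto 3000"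
  proof
    fix x assume x: "x \<in> set L \<union> {2, 3, 5} - {3001}"
    then have "prime x" "x \<le> 3000" using pr le[of x] by auto
    moreover obtain q where "x = int q"
      using prime_gt_0_int[OF \<open>prime x\<close>] by (metis less_le zero_le_imp_eq_int)
    ultimately show "x \<in> int ` primes_upto 3000" by (simp add: primes_upto_def)
  qed
  then have "card (set L \<union> {2, 3, 5} - {3001}) \<le> card (int ` primes_upto 3000)"
    by (intro card_mono) auto
  finally show ?thesis by (simp add: card_image)
qed

text \<open>\<open>power_table\<close> lists the residues of \<open>g ^ (2 ^ i)\<close>.  The exponents \<open>ms\<close> are
  sorted by absolute value modulo \<open>p - 1\<close>, and \<open>chain\<close> checks that their subset sums cover a
  growing interval of exponents.\<close>

fun power_table :: "int list \<Rightarrow> (int \<times> int) list \<Rightarrow> int \<Rightarrow> int \<Rightarrow> nat \<Rightarrow> (int \<times> int) list" where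
  "power_table R T e g 0 = T"
| "power_table R T e g (Suc n) = power_table R ((e, g) # T) (e + e) (reduce R (g * g)) n"

text \<open>The exponent is expanded in binary along the table, largest power of two first. The
  default 0 marks an exponent that the table cannot represent; it is neither prime nor
  \<open>nontrivial\<close>, so the check fails.\<close>

fun table_power :: "int list \<Rightarrow> (int \<times> int) list \<Rightarrow> int \<Rightarrow> int \<Rightarrow> int" where
  "table_power R [] m x = (if m = 0 then x else 0)"
| "table_power R (t # T) m x =
    (if fst t \<le> m then table_power R T (m - fst t) (reduce R (x * snd t)) else table_power R T m x)"

text \<open>The invariant is that \<open>s + 1\<close> consecutive exponents are covered. An
  \<open>m\<close> beyond \<open>p / 2\<close> acts as the negative shift
  \<open>m - (p - 1)\<close>. The increasing key \<open>l\<close> is twice the absolute value of the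
  shift, plus 1 for a negative one, so that opposite shifts may both occur but no exponent
  repeats.\<close>

fun chain :: "int list \<Rightarrow> (int \<times> int) list \<Rightarrow> int \<Rightarrow> int \<Rightarrow> int \<Rightarrow> int list \<Rightarrow> bool" where
  "chain R T p l s [] \<longleftrightarrow> p \<le> s + 2"
| "chain R T p l s (m # ms) \<longleftrightarrow> prime (table_power R T m 1) \<and> table_power R T m 1 < p \<and>
    (if m + m \<le> p then l < m + m \<and> m \<le> s + 1 \<and> chain R T p (m + m) (s + m) ms
     else l < (p - 1 - m) + (p - 1 - m) + 1 \<and> p - 1 - m \<le> s + 1 \<and>
       chain R T p ((p - 1 - m) + (p - 1 - m) + 1) (s + (p - 1 - m)) ms)"

fun int_product :: "int list \<Rightarrow> int" where
  "int_product [] = 1"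
| "int_product (x # xs) = x * int_product xs"

definition nontrivial :: "int \<Rightarrow> int \<Rightarrow> bool"
  where "nontrivial p y \<longleftrightarrow> 1 < y \<and> y < p"

text \<open>\<open>ls\<close> factors \<open>p - 1\<close> with multiplicity and \<open>c\<close> is
  the product of the primes already passed, so \<open>c * int_product ls\<close> is
  \<open>(p - 1) / l\<close>. This is the Lucas test without division.\<close>

fun primitive_root :: "int list \<Rightarrow> (int \<times> int) list \<Rightarrow> int \<Rightarrow> int \<Rightarrow> int list \<Rightarrow> bool" where
  "primitive_root R T p c [] \<longleftrightarrow> c + 1 = p"
| "primitive_root R T p c (l # ls) \<longleftrightarrow> prime l \<and>
    nontrivial p (table_power R T (c * int_product ls) 1) \<and> primitive_root R T p (c * l) ls"

definition certified_table :: "int \<Rightarrow> int list \<Rightarrow> (int \<times> int) list \<Rightarrow> int list \<Rightarrow> int list \<Rightarrow> bool"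
  where "certified_table p R T ls ms \<longleftrightarrow> primitive_root R T p 1 ls \<and> chain R T p 1 0 ms"

definition certified_shifts :: "int \<Rightarrow> int list \<Rightarrow> int \<Rightarrow> int list \<Rightarrow> int list \<Rightarrow> bool"
  where "certified_shifts p R g ls ms \<longleftrightarrow> certified_table p R (power_table R [] 1 g 12) ls ms"

definition certified :: "int \<Rightarrow> int \<Rightarrow> int list \<Rightarrow> int list \<Rightarrow> bool"
  where "certified p g ls ms \<longleftrightarrow> 0 < g \<and> g < p \<and> certified_shifts p (shifts p) g ls ms"

section \<open>Soundness of the certificates\<close>

lemma power_table_cong:
  assumes "\<forall>r\<in>set R. p dvd r" "\<forall>(e, v)\<in>set T. 0 \<le> e \<and> [v = g ^ nat e] (mod p)"
    and "0 \<le> e" "[v = g ^ nat e] (mod p)"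
  shows "\<forall>(e, v)\<in>set (power_table R T e v n). 0 \<le> e \<and> [v = g ^ nat e] (mod p)"
  using assms(2-)
proof (induction n arbitrary: T e v)
  case (Suc n)
  have "[reduce R (v * v) = v * v] (mod p)" using assms(1) by (rule reduce_cong)
  also have "[v * v = g ^ nat e * g ^ nat e] (mod p)" using Suc.prems(3) by (rule cong_mult) (rule Suc.prems(3))
  also have "g ^ nat e * g ^ nat e = g ^ nat (e + e)"
    using Suc.prems(2) by (simp only: nat_add_distrib power_add)
  finally show ?case
    using Suc.IH[of "(e, v) # T" "e + e" "reduce R (v * v)"] Suc.prems by simp
qed simp

lemma table_power_cong:
  assumes "\<forall>r\<in>set R. p dvd r" "\<forall>(e, v)\<in>set T. 0 \<le> e \<and> [v = g ^ nat e] (mod p)"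
    and "0 \<le> m" "table_power R T m x \<noteq> 0"
  shows "[table_power R T m x = x * g ^ nat m] (mod p)"
  using assms(2-)
proof (induction T arbitrary: m x)
  case Nil
  then show ?case by (auto split: if_splits)
next
  case (Cons t T)
  show ?case
  proof (cases "fst t \<le> m")
    case True
    have t: "0 \<le> fst t" "[snd t = g ^ nat (fst t)] (mod p)" using Cons.prems(1) by auto
    have "[table_power R T (m - fst t) (reduce R (x * snd t)) = reduce R (x * snd t) * g ^ nat (m - fst t)] (mod p)"
      using Cons True by auto
    also have "[reduce R (x * snd t) * g ^ nat (m - fst t) = x * snd t * g ^ nat (m - fst t)] (mod p)"
      by (rule cong_mult[OF reduce_cong[OF assms(1)] cong_refl])
    also have "[x * snd t * g ^ nat (m - fst t) = x * g ^ nat (fst t) * g ^ nat (m - fst t)] (mod p)"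
      by (rule cong_mult[OF cong_mult[OF cong_refl t(2)] cong_refl])
    also have "x * g ^ nat (fst t) * g ^ nat (m - fst t) = x * g ^ nat m"
      using t(1) True by (simp add: mult.assoc flip: power_add nat_add_distrib)
    finally show ?thesis using True by simp
  next
    case False
    then show ?thesis using Cons by auto
  qed
qed

text \<open>Distinctness and \<open>0 < m < p - 1\<close> both follow from the strictly increasing
  keys, all of which exceed 1.\<close>

lemma chain_facts:
  assumes "chain R T p l s ms" "1 \<le> l" "2 < p"
  shows "distinct ms \<and> (\<forall>m\<in>set ms. 0 < m \<and> m < p - 1 \<and> prime (table_power R T m 1)
    \<and> table_power R T m 1 < p \<and> l < (if m + m \<le> p then m + m else (p - 1 - m) + (p - 1 - m) + 1))"
  using assms
proof (induction R T p l s ms rule: chain.induct)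
  case (2 R T p l s m ms)
  show ?case
  proof (cases "m + m \<le> p")
    case True
    then show ?thesis using "2.IH"(1)[OF True] "2.prems" by (auto split: if_splits)
  next
    case False
    then show ?thesis using "2.IH"(2)[OF False] "2.prems" by (auto split: if_splits)
  qed
qed simp

text \<open>\<open>V\<close> collects the sums formed so far. A shift of absolute value at most
  \<open>s + 1\<close> joins an interval of \<open>s + 1\<close> exponents to its translate without
  a gap. At the end there are at least \<open>p - 1\<close> consecutive exponents, which meet every
  residue class.\<close>

lemma chain_cover:
  assumes "chain R T p l s ms" "distinct ms" "1 < p" "\<forall>x\<in>{i..i + s}. x \<in> V"
  shows "\<exists>x\<in>V. \<exists>S\<subseteq>set ms. [e = x + \<Sum>S] (mod (p - 1))"
  using assms
proof (induction R T p l s ms arbitrary: V i rule: chain.induct)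
  case (1 R T p l s)
  define x where "x = i + (e - i) mod (p - 1)"
  have "(e - i) mod (p - 1) < p - 1" "0 \<le> (e - i) mod (p - 1)" using 1 by simp_all
  then have "(e - i) mod (p - 1) \<le> s" using 1(1) by (simp only: chain.simps)
  with \<open>0 \<le> (e - i) mod (p - 1)\<close> have "x \<in> {i..i + s}" by (simp add: x_def)
  then have "x \<in> V" using 1 by blast
  moreover have "[e = x] (mod (p - 1))"
    by (simp add: x_def cong_def mod_simps)
  ultimately show ?case by (intro bexI[of _ x] exI[of _ "{}"]) auto
next
  case (2 R T p l s m ms)
  define d where "d = (if m + m \<le> p then m else m - (p - 1))"
  have dm: "[d = m] (mod (p - 1))" by (simp add: d_def cong_def minus_mod_self2)
  define V' where "V' = V \<union> (\<lambda>x. x + d) ` V"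
  have step: "\<exists>x\<in>V'. \<exists>S\<subseteq>set ms. [e = x + \<Sum>S] (mod (p - 1))"
  proof (cases "m + m \<le> p")
    case True
    have "\<forall>x\<in>{i..i + (s + m)}. x \<in> V'"
    proof
      fix x assume "x \<in> {i..i + (s + m)}"
      then have "x \<in> {i..i + s} \<or> x - d \<in> {i..i + s}"
        using True "2.prems"(1) by (auto simp: d_def)
      then have "x \<in> V \<or> x - d \<in> V" using "2.prems"(4) by blast
      then show "x \<in> V'" unfolding V'_def by force
    qed
    then show ?thesis using "2.IH"(1)[OF True] True "2.prems" by auto
  next
    case False
    have "\<forall>x\<in>{i + d..i + d + (s + (p - 1 - m))}. x \<in> V'"
    proof
      fix x assume "x \<in> {i + d..i + d + (s + (p - 1 - m))}"
      then have "x \<in> {i..i + s} \<or> x - d \<in> {i..i + s}"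
        using False "2.prems"(1) by (auto simp: d_def)
      then have "x \<in> V \<or> x - d \<in> V" using "2.prems"(4) by blast
      then show "x \<in> V'" unfolding V'_def by force
    qed
    then show ?thesis using "2.IH"(2)[OF False] False "2.prems" by auto
  qed
  then obtain x S where x: "x \<in> V'" "S \<subseteq> set ms" "[e = x + \<Sum>S] (mod (p - 1))" by blast
  show ?case
  proof (cases "x \<in> V")
    case True
    with x show ?thesis by (intro bexI[of _ x] exI[of _ S]) auto
  next
    case False
    with x(1) obtain y where y: "y \<in> V" "x = y + d" by (auto simp: V'_def)
    have "m \<notin> S" "finite S" using x(2) "2.prems"(2) finite_subset by auto
    then have "y + \<Sum>(insert m S) = y + m + \<Sum>S" by simp
    moreover have "[y + d + \<Sum>S = y + m + \<Sum>S] (mod (p - 1))"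
      using dm by (intro cong_add) auto
    ultimately have "[e = y + \<Sum>(insert m S)] (mod (p - 1))"
      using x(3) y(2) cong_trans by metis
    with x(2) y(1) show ?thesis by (intro bexI[of _ y] exI[of _ "insert m S"]) auto
  qed
qed


lemma primitive_root_facts:
  assumes "primitive_root R T p c ls" "0 < c"
  shows "c * int_product ls = p - 1 \<and> (\<forall>l\<in>set ls. nontrivial p (table_power R T ((p - 1) div l) 1))"
  using assms
proof (induction R T p c ls rule: primitive_root.induct)
  case (2 R T p c l ls)
  have "0 < l" using "2.prems"(1) by (simp add: prime_gt_0_int)
  then have IH: "c * l * int_product ls = p - 1"
    "\<forall>l\<in>set ls. nontrivial p (table_power R T ((p - 1) div l) 1)"
    using "2.IH" "2.prems" by simp_all
  have "(p - 1) div l = c * int_product ls"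
    unfolding IH(1)[symmetric] using \<open>0 < l\<close> by simp
  with IH "2.prems"(1) show ?case by (simp add: mult.assoc)
qed simp

lemma primitive_root_primes: "primitive_root R T p c ls \<Longrightarrow> \<forall>l\<in>set ls. prime l"
  by (induction R T p c ls rule: primitive_root.induct) auto

lemma prime_dvd_int_product:
  assumes "prime r" "r dvd int_product ls" "\<forall>l\<in>set ls. prime l"
  shows "r \<in> set ls"
  using assms
proof (induction ls)
  case (Cons l ls)
  then have "r dvd l \<or> r dvd int_product ls" by (simp add: prime_dvd_mult_iff)
  with Cons show ?case using primes_dvd_imp_eq[of r l] by auto
qed (use not_prime_unit in auto)

text \<open>If the order of \<open>g\<close> were a proper divisor of \<open>p - 1\<close>, a prime
  \<open>r\<close> dividing the quotient would make \<open>(p - 1) / r\<close> a multiple of the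
  order.\<close>

lemma residue_primroot_if_nontrivial:
  assumes p: "prime p" and g: "0 < g" "g < p"
    and nt: "\<And>r. prime r \<Longrightarrow> r dvd p - 1 \<Longrightarrow> \<not> [g ^ ((p - 1) div r) = 1] (mod p)"
  shows "residue_primroot p g"
proof -
  have cop: "coprime p g"
    using p g by (intro prime_imp_coprime) (auto dest: dvd_imp_le)
  have t: "totient p = p - 1" using p by (rule totient_prime)
  have p1: "p - 1 > 0" using prime_gt_1_nat[OF p] by simp
  obtain k where k: "p - 1 = ord p g * k"
    using order_divides_totient[OF cop] t by auto
  have "k = 1"
  proof (rule ccontr)
    assume "k \<noteq> 1"
    then obtain r where r: "prime r" "r dvd k" using prime_factor_nat by blast
    then obtain s where s: "k = r * s" by auto
    have "(p - 1) div r = ord p g * s"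
      using k s prime_gt_0_nat[OF r(1)] by simp
    then have "[g ^ ((p - 1) div r) = 1] (mod p)" unfolding ord_divides by simp
    moreover have "r dvd p - 1" using k s by simp
    ultimately show False using nt r(1) by blast
  qed
  then have "ord p g = p - 1" using k by simp
  then show ?thesis
    using cop t prime_gt_0_nat[OF p] by (simp add: residue_primroot_def)
qed

lemma certified_cover:
  assumes p: "prime p" "2 < p" and cert: "certified p g ls ms" and a: "0 < a" "a < p"
  shows "\<exists>S. finite S \<and> (\<forall>q\<in>S. prime q \<and> q < p) \<and> [\<Prod>S = a] (mod p)"
proof -
  define R where "R = shifts p"
  define T where "T = power_table R [] 1 g 12"
  have R: "\<forall>r\<in>set R. p dvd r" unfolding R_def by (rule doubles_dvd) auto
  have T: "\<forall>(e, v)\<in>set T. 0 \<le> e \<and> [v = g ^ nat e] (mod p)"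
    unfolding T_def by (rule power_table_cong[OF R]) auto
  have g: "0 < g" "g < p" and pr: "primitive_root R T p 1 ls" and ch: "chain R T p 1 0 ms"
    using cert unfolding certified_def certified_shifts_def certified_table_def R_def T_def by blast+
  define P where "P = nat p"
  define c where "c = nat g"
  have P: "p = int P" "prime P" "2 < P" and c: "g = int c" "0 < c" "c < P"
    using p g prime_int_nat_transfer[of p] unfolding P_def c_def by linarith+
  have root: "residue_primroot P c"
  proof (rule residue_primroot_if_nontrivial[OF P(2) c(2,3)])
    fix r assume r: "prime r" "r dvd P - 1"
    have "int_product ls = int (P - 1)"
      using primitive_root_facts[OF pr] P(1,3) by (simp add: of_nat_diff)
    then have "int r dvd int_product ls" using r(2) by (simp only: int_dvd_int_iff)
    then have "int r \<in> set ls"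
      using r(1) primitive_root_primes[OF pr] by (intro prime_dvd_int_product) auto
    then have nt: "nontrivial p (table_power R T ((p - 1) div int r) 1)"
      using primitive_root_facts[OF pr] by simp
    have e: "(p - 1) div int r = int ((P - 1) div r)"
      using P by (simp add: zdiv_int of_nat_diff)
    have "[table_power R T ((p - 1) div int r) 1 = 1 * g ^ nat ((p - 1) div int r)] (mod p)"
      by (rule table_power_cong[OF R T]) (use nt e in \<open>auto simp: nontrivial_def\<close>)
    then have y: "[table_power R T ((p - 1) div int r) 1 = int (c ^ ((P - 1) div r))] (mod int P)"
      unfolding e using P(1) c(1) by simp
    show "\<not> [c ^ ((P - 1) div r) = 1] (mod P)"
    proof
      assume "[c ^ ((P - 1) div r) = 1] (mod P)"
      then have "[int (c ^ ((P - 1) div r)) = int 1] (mod int P)" by (simp only: cong_int_iff)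
      with y have "[table_power R T ((p - 1) div int r) 1 = 1] (mod p)"
        unfolding P(1) using cong_trans by fastforce
      then show False using nt p by (simp add: nontrivial_def cong_def)
    qed
  qed
  then have cop: "coprime P c" and ord: "ord P c = P - 1"
    using P(2) by (simp_all add: residue_primroot_def totient_prime)
  have "nat a \<in> totatives P"
    using a P(1) totatives_prime[OF P(2)] by simp
  moreover have "1 < P" using P(3) by simp
  ultimately have "nat a \<in> (\<lambda>i. c ^ i mod P) ` {..<totient P}"
    using bij_betw_imp_surj_on[OF residue_primroot_is_generator[OF _ root]] by simp
  then obtain e where e: "nat a = c ^ e mod P" by (rule imageE)
  have "int (c ^ e) mod p = int (c ^ e mod P)" unfolding P(1) by (simp only: of_nat_mod)
  also have "\<dots> = a mod p" unfolding e[symmetric] using a by simp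
  finally have ea: "[int (c ^ e) = a] (mod p)" unfolding cong_def .
  have facts: "distinct ms" "\<And>m. m \<in> set ms \<Longrightarrow> 0 < m \<and> m < p - 1 \<and> prime (table_power R T m 1)
      \<and> table_power R T m 1 < p"
    using chain_facts[OF ch _ p(2)] by auto
  obtain S where S: "S \<subseteq> set ms" "[int e = \<Sum>S] (mod (p - 1))"
    using chain_cover[OF ch facts(1), of 0 "{0}" "int e"] p by auto
  have S0: "finite S" "\<forall>m\<in>S. 0 < m" using S(1) facts finite_subset by auto
  define w where "w m = table_power R T m 1" for m
  have w: "[w m = int (c ^ nat m)] (mod p)" if "m \<in> S" for m
  proof -
    have "prime (w m)" using facts(2)[of m] S(1) that by (auto simp: w_def)
    then have "w m \<noteq> 0" by auto
    then have "[w m = 1 * g ^ nat m] (mod p)"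
      unfolding w_def using S0 that by (intro table_power_cong[OF R T]) auto
    then show ?thesis using c(1) by simp
  qed
  \<comment> \<open>Distinct exponents between 0 and \<open>p - 1\<close> give distinct primes, so
    no factor is lost when passing to the set of primes.\<close>
  have "inj_on w S"
  proof (rule inj_onI)
    fix x y assume xy: "x \<in> S" "y \<in> S" "w x = w y"
    then have "[int (c ^ nat x) = int (c ^ nat y)] (mod int P)"
      unfolding P(1)[symmetric] using cong_trans[OF cong_sym[OF w[OF xy(1)]]] w[OF xy(2)] xy(3) by simp
    then have "[nat x = nat y] (mod (P - 1))"
      using order_divides_expdiff[OF cop] ord by (simp only: cong_int_iff)
    moreover have "0 < x" "x < p - 1" "0 < y" "y < p - 1"
      using facts(2)[of x] facts(2)[of y] S(1) xy by auto
    moreover from this have "nat x < P - 1" "nat y < P - 1" unfolding P(1) by linarith+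
    ultimately show "x = y" by (simp add: cong_def)
  qed
  then have "\<Prod>(w ` S) = (\<Prod>m\<in>S. w m)" by (simp add: prod.reindex)
  also have "[(\<Prod>m\<in>S. w m) = (\<Prod>m\<in>S. int (c ^ nat m))] (mod p)"
    using w by (rule cong_prod)
  also have "(\<Prod>m\<in>S. int (c ^ nat m)) = int (c ^ (\<Sum>m\<in>S. nat m))"
    by (simp add: power_sum)
  also have "[int (c ^ (\<Sum>m\<in>S. nat m)) = int (c ^ e)] (mod p)"
  proof -
    have "int (\<Sum>m\<in>S. nat m) = \<Sum>S" using S0 by (auto intro!: sum.cong)
    then have "[int e = int (\<Sum>m\<in>S. nat m)] (mod int (P - 1))"
      using S(2) P by (simp add: of_nat_diff)
    then have "[e = (\<Sum>m\<in>S. nat m)] (mod (P - 1))" by (simp only: cong_int_iff)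
    then have "[c ^ (\<Sum>m\<in>S. nat m) = c ^ e] (mod P)"
      using order_divides_expdiff[OF cop] ord cong_sym by simp
    then show ?thesis unfolding P(1) by (simp only: cong_int_iff)
  qed
  also note ea
  finally have "[\<Prod>(w ` S) = a] (mod p)" .
  moreover have "prime (w m) \<and> w m < p" if "m \<in> S" for m
    using facts(2)[of m] S(1) that by (auto simp: w_def)
  ultimately show ?thesis using S0 by (intro exI[of _ "w ` S"]) auto
qed

definition coverable :: "int \<Rightarrow> bool" where
  "coverable p \<longleftrightarrow> (prime p \<longrightarrow> 2 < p \<longrightarrow> (\<forall>a. 0 < a \<longrightarrow> a < p \<longrightarrow>
     (\<exists>S. finite S \<and> (\<forall>q\<in>S. prime q \<and> q < p) \<and> [\<Prod>S = a] (mod p))))"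

text \<open>A recursive function instead of \<open>list_all\<close>: rewriting below an abstraction would
  unfold the checks for symbolic arguments.\<close>

fun all_certified :: "(int \<times> int \<times> int list \<times> int list) list \<Rightarrow> bool" where
  "all_certified [] \<longleftrightarrow> True"
| "all_certified ((p, g, ls, ms) # cs) \<longleftrightarrow> certified p g ls ms \<and> all_certified cs"

lemma all_certified_coverable: "all_certified cs \<Longrightarrow> list_all coverable (map fst cs)"
proof (induction cs rule: all_certified.induct)
  case (2 p g ls ms cs)
  then have "certified p g ls ms" by (simp only: all_certified.simps)
  then have "coverable p"
    unfolding coverable_def by (intro impI allI) (rule certified_cover)
  moreover have "list_all coverable (map fst cs)"
    using "2.prems" by (intro "2.IH") (simp only: all_certified.simps)
  ultimately show ?case by (simp only: list.map fst_conv list.pred_inject simp_thms)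
qed simp

fun increasing_primes :: "int \<Rightarrow> int \<Rightarrow> int list \<Rightarrow> bool" where
  "increasing_primes p l [] \<longleftrightarrow> True"
| "increasing_primes p l (q # qs) \<longleftrightarrow> l < q \<and> q < p \<and> prime q \<and> increasing_primes p q qs"

text \<open>An exhaustive certificate, free of discrete logarithms: the lists of primes stand for
  the residues \<open>a\<close>, \<open>a + 1\<close>, ..., \<open>p - 1\<close> in this
  order.\<close>

fun represents_from :: "int \<Rightarrow> int list \<Rightarrow> int \<Rightarrow> int list list \<Rightarrow> bool" where
  "represents_from p R a [] \<longleftrightarrow> a = p"
| "represents_from p R a (S # Ss) \<longleftrightarrow> increasing_primes p 0 S \<and> reduce R (int_product S) = a
    \<and> represents_from p R (a + 1) Ss"

lemma increasing_primes_gt: "increasing_primes p l qs \<Longrightarrow> \<forall>q\<in>set qs. l < q"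
  by (induction p l qs rule: increasing_primes.induct) auto

lemma increasing_primes_facts:
  "increasing_primes p l qs \<Longrightarrow> int_product qs = \<Prod>(set qs) \<and> (\<forall>q\<in>set qs. prime q \<and> q < p)"
proof (induction p l qs rule: increasing_primes.induct)
  case (2 p l q qs)
  then have "q \<notin> set qs" using increasing_primes_gt[of p q qs] by auto
  with 2 show ?case by simp
qed simp

lemma represents_from_cover:
  assumes "represents_from p (shifts p) b Ss" "b \<le> a" "a < p"
  shows "\<exists>S. finite S \<and> (\<forall>q\<in>S. prime q \<and> q < p) \<and> [\<Prod>S = a] (mod p)"
  using assms
proof (induction Ss arbitrary: b)
  case (Cons qs Ss)
  show ?case
  proof (cases "a = b")
    case True
    have "[reduce (shifts p) (int_product qs) = int_product qs] (mod p)"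
      by (rule reduce_shifts_cong)
    then have "[\<Prod>(set qs) = a] (mod p)"
      using Cons.prems(1) True increasing_primes_facts[of p 0 qs] by (simp add: cong_sym_eq)
    with Cons.prems(1) increasing_primes_facts[of p 0 qs] show ?thesis
      by (intro exI[of _ "set qs"]) simp
  next
    case False
    then have "b + 1 \<le> a" using Cons.prems(2) by simp
    then show ?thesis using Cons.IH[of "b + 1"] Cons.prems by simp
  qed
qed simp

lemmas prime_evals = prime_list[unfolded blocks_3000_def concat.simps append.simps list.pred_inject simp_thms]

lemma prime_2_3_5: "prime (2 :: int)" "prime (3 :: int)" "prime (5 :: int)"
  by simp_all

section \<open>Evaluated certificates for the primes from 11 to 2999\<close>

lemmas certificate_eval = arith_eval fst_conv snd_conv mult_1_left mult_1_right
  power_table.simps table_power.simps chain.simps int_product.simps primitive_root.simps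
  all_certified.simps nontrivial_def certified_table_def certified_shifts_def certified_def prod.case
  increasing_primes.simps represents_from.simps prime_2_3_5 prime_evals

lemma power_table_12: "power_table R T e g 12 = power_table R T e g
    (Suc (Suc (Suc (Suc (Suc (Suc (Suc (Suc (Suc (Suc (Suc (Suc 0))))))))))))"
  by (simp add: eval_nat_numeral)

lemma represents_37: "represents_from 37 (shifts 37) 1
    [[], [2], [3], [2,3,13], [5], [2,3], [7], [7,17], [2,23], [2,5], [11], [3,5,23], [13], [2,7], [3,5],
    [2,7,17], [17], [5,11], [19], [3,19], [3,7], [2,11], [23], [11,19], [2,31], [2,13], [2,3,23], [5,13],
    [29], [2,3,5], [31], [3,23], [3,11], [2,17], [5,7], [2,5,11]]"
  by (simp only: certificate_eval power_table_12 cong: if_weak_cong)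

lemma represents_157: "represents_from 157 (shifts 157) 1
    [[], [2], [3], [7,23], [5], [2,3], [7], [3,5,11], [2,83], [2,5], [11], [3,7,23], [13], [2,7], [3,5],
    [2,3,5,11], [17], [2,17,19], [19], [3,59], [3,7], [2,11], [23], [2,3,7,23], [2,7,13], [2,13], [11,31],
    [5,37], [29], [2,3,5], [31], [19,43], [3,11], [2,17], [5,7], [2,11,73], [37], [2,19], [3,13], [2,3,59],
    [41], [2,3,7], [43], [3,67], [2,101], [2,23], [47], [5,41], [2,103], [2,3,113], [3,17], [11,19], [53],
    [2,11,31], [5,11], [3,71], [3,19], [2,29], [59], [7,31], [61], [2,31], [13,29], [13,17], [5,13], [2,3,11],
    [67], [2,5,101], [3,23], [2,5,7], [71], [5,13,47], [73], [2,37], [2,3,7,13], [2,3,5,13], [7,11], [2,3,13],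
    [79], [3,79], [2,7,17], [2,41], [83], [3,5,37], [5,17], [2,43], [3,29], [2,3,67], [89], [13,19], [7,13],
    [3,83], [3,31], [2,47], [5,19], [11,23], [97], [3,5,17], [7,59], [3,5,59], [101], [2,3,17], [103],
    [2,11,19], [3,5,7], [2,53], [107], [5,53], [109], [2,5,11], [3,37], [2,3,71], [113], [2,3,19], [5,23],
    [3,7,13], [2,137], [2,59], [7,17], [2,7,31], [2,139], [2,61], [3,41], [2,3,73], [2,3,47], [2,13,29],
    [127], [3,5,19], [3,43], [2,5,13], [131], [7,131], [7,19], [2,67], [2,3,101], [5,13,19], [137], [2,3,23],
    [139], [13,47], [3,47], [2,71], [11,13], [7,43], [5,29], [2,73], [2,3,103], [5,61], [149], [5,11,17],
    [151], [3,103], [2,5,31], [2,7,11], [5,31], [2,5,47]]"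
  by (simp only: certificate_eval power_table_12 cong: if_weak_cong)

lemma coverable_37_157: "coverable 37" "coverable 157"
proof -
  show "coverable 37" unfolding coverable_def
  proof (intro impI allI)
    fix a :: int assume "0 < a" "a < 37"
    then have "1 \<le> a" by linarith
    from represents_from_cover[OF represents_37 this \<open>a < 37\<close>]
    show "\<exists>S. finite S \<and> (\<forall>q\<in>S. prime q \<and> q < 37) \<and> [\<Prod>S = a] (mod 37)" .
  qed
  show "coverable 157" unfolding coverable_def
  proof (intro impI allI)
    fix a :: int assume "0 < a" "a < 157"
    then have "1 \<le> a" by linarith
    from represents_from_cover[OF represents_157 this \<open>a < 157\<close>]
    show "\<exists>S. finite S \<and> (\<forall>q\<in>S. prime q \<and> q < 157) \<and> [\<Prod>S = a] (mod 157)" .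
  qed
qed

text \<open>An entry consists of the prime, a primitive root, the prime factors of one less than the
  prime, and the discrete logarithms of the primes to be multiplied.\<close>

lemma certs_1: "all_certified
    [(11,2,[2,5],[1,8,7,4]), (13,2,[2,2,3],[1,11,9,4,7]), (17,3,[2,2,2,2],[1,14,4,11,7]),
    (19,13,[2,3,3],[17,2,14,12,11]), (23,5,[2,11],[1,2,19,15,9]), (29,3,[2,2,7],[1,26,4,8,13]),
    (31,3,[2,3,5],[1,28,4,23,20,11]), (41,29,[2,2,2,5],[39,38,4,33,25,17]),
    (43,26,[2,3,7],[41,2,38,34,30,22]), (47,11,[2,23],[1,44,42,7,15,22]), (53,22,[2,2,13],[51,2,48,46,38,27]),
    (59,40,[2,29],[57,56,54,8,16,30]), (61,2,[2,2,3,5],[1,59,57,54,49,22,31]),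
    (67,13,[2,3,11],[65,64,4,7,52,39,29]), (71,7,[2,5,7],[69,68,3,6,11,47,39]),
    (73,31,[2,2,2,3,3],[1,70,4,7,57,29,38]), (79,29,[2,3,13],[1,76,74,70,10,52,34]),
    (83,32,[2,41],[81,80,4,8,68,54,44]), (89,41,[2,2,2,11],[1,2,4,81,78,23,43]),
    (97,21,[2,2,2,2,2,3],[95,94,93,6,83,26,44]), (101,89,[2,2,5,5],[1,2,98,4,9,81,63,49]),
    (103,74,[2,3,17],[101,100,4,95,10,24,47,52]), (107,32,[2,53],[105,2,4,98,14,76,51]),
    (109,47,[2,2,3,3,3],[1,2,104,8,92,32,51]), (113,47,[2,2,2,2,7],[111,110,4,6,13,26,50,61]),
    (127,109,[2,3,3,7],[1,125,123,120,11,23,80,67]), (131,37,[2,5,13],[1,2,126,125,117,104,78,62]),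
    (137,106,[2,2,2,17],[135,2,132,5,13,26,85,69]), (139,61,[2,3,23],[1,136,135,5,11,115,97,68]),
    (149,106,[2,2,37],[147,2,144,141,137,25,97,75]), (151,133,[2,3,5,5],[149,148,4,142,16,31,87,81]),
    (163,67,[2,3,3,3,3],[161,160,4,8,146,135,105,87]), (167,131,[2,83],[1,2,162,160,152,138,117,81]),
    (173,111,[2,2,43],[171,170,169,166,13,24,50,89]), (179,127,[2,89],[1,2,4,7,167,24,131,88]),
    (181,47,[2,2,3,3,5],[1,2,178,174,12,156,135,93]), (191,71,[2,5,19],[189,188,187,184,13,24,141,98]),
    (193,167,[2,2,2,2,2,2,3],[1,190,189,185,181,168,49,94]), (197,13,[2,2,7,7],[1,194,4,188,16,168,58,101]),
    (199,176,[2,3,3,11],[197,196,4,5,13,174,50,100]), (211,167,[2,3,5,7],[1,2,4,8,196,181,56,108]),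
    (223,173,[2,3,37],[1,220,219,7,14,27,55,119,106]), (227,170,[2,113],[225,2,222,7,212,197,169,111])]"
  by (simp only: certificate_eval power_table_12 cong: if_weak_cong)

lemmas coverable_1 = all_certified_coverable[OF certs_1,
    unfolded list.map fst_conv list.pred_inject simp_thms]

lemma certs_2: "all_certified
    [(229,59,[2,2,3,19],[1,226,225,7,216,25,181,132,113]),
    (233,67,[2,2,2,29],[1,230,3,227,12,210,191,145,112]), (239,77,[2,7,17],[237,2,3,5,228,216,196,152,115]),
    (241,206,[2,2,2,2,3,5],[239,238,3,6,227,21,46,147,116]),
    (251,137,[2,5,5,5],[1,249,3,244,239,227,206,160,129]),
    (257,179,[2,2,2,2,2,2,2,2],[1,2,3,250,246,235,217,175,133]),
    (263,41,[2,131],[1,2,4,254,14,30,204,113,121]), (269,107,[2,2,67],[1,2,3,7,255,23,50,169,133]),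
    (271,43,[2,3,3,3,5],[1,2,266,264,13,244,219,104,138]),
    (277,78,[2,2,3,23],[275,274,272,270,264,255,44,91,139]),
    (281,27,[2,2,2,5,7],[279,2,276,273,13,25,51,177,144]), (283,277,[2,3,47],[1,281,3,276,10,261,43,81,131]),
    (293,101,[2,2,73],[1,2,289,285,14,26,238,185,145]), (307,157,[2,3,3,17],[1,2,303,299,12,281,261,211,156]),
    (311,202,[2,5,31],[309,308,307,6,297,26,259,207,156]),
    (313,67,[2,2,2,3,13],[1,2,4,304,299,284,261,204,152]), (317,32,[2,2,79],[315,2,4,308,16,284,253,193,155]),
    (331,137,[2,3,5,11],[329,328,4,322,315,300,277,110,159]),
    (337,314,[2,2,2,2,3,7],[335,334,4,8,16,309,58,113,169]),
    (347,337,[2,173],[1,344,342,7,332,317,291,239,160]),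
    (349,197,[2,2,3,29],[1,346,3,341,336,322,52,253,180]),
    (353,89,[2,2,2,2,2,11],[1,350,348,344,16,32,59,229,169]),
    (359,263,[2,179],[1,2,3,351,344,331,307,252,174]), (367,307,[2,3,61],[365,364,3,359,355,25,316,99,178]),
    (373,359,[2,2,3,31],[1,371,370,367,364,13,27,319,261,190]),
    (379,43,[2,3,3,3,7],[1,376,374,6,14,352,53,104,192]),
    (383,359,[2,191],[381,2,378,374,368,29,325,111,189]),
    (389,27,[2,2,97],[387,386,4,380,373,31,335,273,191]),
    (397,313,[2,2,3,3,11],[1,2,392,391,383,26,344,294,205]),
    (401,327,[2,2,2,2,5,5],[399,2,4,392,385,369,62,281,195]),
    (409,97,[2,2,2,3,17],[1,2,404,400,392,31,62,286,210]),
    (419,74,[2,11,19],[417,2,4,411,405,390,362,109,214]),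
    (421,331,[2,2,3,5,7],[1,2,4,413,15,391,361,117,207]), (431,280,[2,5,43],[429,2,426,8,414,402,59,312,216]),
    (433,107,[2,2,2,2,3,3,3],[1,2,4,7,15,404,374,316,219]),
    (439,335,[2,3,73],[437,436,435,431,12,26,51,342,243,223]),
    (443,283,[2,13,17],[1,2,4,436,14,28,389,334,213,214]),
    (449,419,[2,2,2,2,2,2,7],[1,2,444,440,433,420,390,116,232]),
    (457,99,[2,2,2,3,19],[455,454,4,448,444,429,55,346,236,221]),
    (461,362,[2,2,5,23],[459,458,4,455,7,20,35,70,144,224]),
    (463,108,[2,3,7,11],[461,2,459,6,449,26,413,365,191,238]),
    (467,419,[2,233],[465,464,462,458,451,435,62,122,235]),
    (479,439,[2,239],[1,477,2,474,469,18,36,409,140,242])]"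
  by (simp only: certificate_eval power_table_12 cong: if_weak_cong)

lemmas coverable_2 = all_certified_coverable[OF certs_2,
    unfolded list.map fst_conv list.pred_inject simp_thms]

lemma certs_3: "all_certified
    [(487,306,[2,3,3,3,3,3],[485,484,4,8,470,455,426,364,244]),
    (491,359,[2,5,7,7],[1,2,3,485,12,22,451,407,325,239]),
    (499,284,[2,3,83],[497,2,494,491,486,480,43,88,323,246]),
    (503,239,[2,251],[1,501,3,496,491,22,461,417,167,257]),
    (509,233,[2,2,127],[1,506,504,502,12,488,46,91,182,253]),
    (521,79,[2,2,2,5,13],[1,519,3,5,9,20,482,442,154,262]),
    (523,413,[2,3,3,29],[521,2,519,6,8,20,482,80,161,256]),
    (541,331,[2,2,3,3,3,5],[1,539,3,535,529,21,499,80,161,277]),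
    (547,389,[2,3,7,13],[1,2,542,8,530,32,64,420,246,271]),
    (557,347,[2,2,139],[555,554,3,6,546,538,41,477,395,283]),
    (563,359,[2,281],[1,560,559,7,14,534,508,452,345,289]),
    (569,434,[2,2,2,71],[567,2,566,562,556,544,34,81,161,287]),
    (571,338,[2,3,5,19],[569,568,4,5,562,21,41,77,410,286]),
    (577,257,[2,2,2,2,2,2,3,3],[1,2,572,569,561,549,52,108,214,287]),
    (587,443,[2,293],[1,2,584,6,575,17,36,74,144,292]),
    (593,433,[2,2,2,2,37],[1,2,588,7,11,566,542,490,201,299]),
    (599,343,[2,13,23],[597,596,595,591,590,577,40,516,435,305]),
    (601,41,[2,2,2,3,5,5],[1,2,597,593,14,573,50,495,398,299]),
    (607,433,[2,3,101],[1,604,602,7,593,28,56,497,385,302]),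
    (613,518,[2,2,3,3,17],[611,2,4,607,12,592,38,75,455,309]),
    (617,503,[2,2,2,7,11],[1,614,612,7,15,586,561,507,220,311]),
    (619,322,[2,3,103],[617,2,4,7,603,589,563,505,226,300]),
    (631,65,[2,3,3,5,7],[629,628,627,7,621,607,594,549,467,318]),
    (641,337,[2,2,2,2,2,2,2,5],[1,638,636,633,14,28,583,527,415,317]),
    (643,311,[2,3,107],[1,2,4,634,627,613,584,528,411,317]),
    (647,461,[2,17,19],[1,644,643,640,633,624,604,88,471,316]),
    (653,263,[2,2,163],[1,650,3,646,12,627,602,85,478,330]),
    (659,197,[2,7,47],[657,2,4,651,643,30,58,118,423,325]),
    (661,317,[2,2,3,5,11],[659,2,3,653,646,25,53,559,207,328]),
    (673,173,[2,2,2,2,2,3,7],[1,2,669,666,13,24,48,575,478,340]),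
    (677,586,[2,2,13,13],[675,2,4,671,666,653,45,590,500,346]),
    (683,499,[2,11,31],[1,680,3,675,10,658,637,589,503,337]),
    (691,122,[2,3,5,23],[689,2,686,682,674,658,627,567,443,346]),
    (701,291,[2,2,5,5,7],[699,698,4,8,13,28,46,99,500,341]),
    (709,369,[2,2,3,59],[707,706,704,700,10,683,658,607,508,349]),
    (719,449,[2,359],[1,2,714,711,15,689,665,606,495,364]),
    (727,312,[2,3,11,11],[725,724,722,8,15,31,60,122,242,375]),
    (733,43,[2,2,3,61],[1,2,728,727,719,707,47,640,544,371]),
    (739,619,[2,3,3,41],[1,2,734,730,723,707,677,615,500,376]),
    (743,470,[2,7,53],[741,2,4,8,15,711,681,619,243,376]),
    (751,349,[2,3,5,5,5],[1,2,747,6,12,727,48,654,558,373]),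
    (757,359,[2,2,3,3,3,7],[755,2,3,749,11,731,709,659,193,375]),
    (761,211,[2,2,2,5,19],[759,758,4,753,746,29,702,115,529,385])]"
  by (simp only: certificate_eval power_table_12 cong: if_weak_cong)

lemmas coverable_3 = all_certified_coverable[OF certs_3,
    unfolded list.map fst_conv list.pred_inject simp_thms]

lemma certs_4: "all_certified
    [(769,59,[2,2,2,2,2,2,2,2,3],[1,766,764,8,16,31,707,646,243,381]),
    (773,593,[2,2,193],[771,770,4,764,15,741,61,122,527,382]),
    (787,761,[2,3,131],[1,784,783,779,12,26,736,686,589,397]),
    (797,97,[2,2,199],[1,794,792,788,16,32,58,676,241,403]),
    (809,181,[2,2,2,101],[1,2,804,803,795,22,762,714,624,436,402]),
    (811,395,[2,3,3,3,3,5],[809,2,806,7,795,781,57,115,231,396]),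
    (821,521,[2,2,5,41],[819,818,4,812,16,32,758,694,570,394]),
    (823,43,[2,3,137],[1,820,4,814,806,795,57,110,225,420]),
    (827,89,[2,7,59],[1,824,823,819,812,799,776,722,209,412]),
    (829,641,[2,2,3,3,23],[827,826,4,8,16,32,764,702,574,411]),
    (839,163,[2,419],[1,836,4,8,823,31,60,122,244,413]),
    (853,269,[2,2,3,71],[851,2,848,7,14,824,55,742,221,421]),
    (857,732,[2,2,2,107],[855,2,4,7,841,28,798,116,625,434]),
    (859,213,[2,3,11,13],[857,2,854,850,843,30,797,120,240,435]),
    (863,358,[2,431],[861,860,858,7,848,834,806,753,222,434]),
    (877,654,[2,2,3,73],[875,2,4,871,864,23,48,788,692,509,439]),
    (881,227,[2,2,2,2,5,11],[1,878,4,872,866,30,820,117,232,439]),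
    (883,575,[2,3,3,7,7],[881,880,879,7,872,858,48,786,192,382,436]),
    (887,660,[2,443],[885,2,882,878,15,856,826,119,240,444]),
    (907,382,[2,3,151],[905,904,902,7,15,877,851,792,228,455]),
    (911,727,[2,5,7,13],[1,2,4,905,897,892,866,822,176,568,447]),
    (919,265,[2,3,3,3,17],[917,916,915,5,6,15,889,55,117,233,463]),
    (929,159,[2,2,2,2,2,29],[927,926,924,8,914,900,870,812,697,453,468]),
    (937,421,[2,2,2,3,3,13],[935,934,4,929,15,906,877,819,703,477,460]),
    (941,82,[2,2,5,47],[939,2,3,6,929,21,897,82,162,332,471]),
    (947,570,[2,11,43],[945,2,3,939,933,24,47,849,771,361,478]),
    (953,433,[2,2,2,7,17],[1,2,948,944,16,31,63,826,252,480]),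
    (967,372,[2,3,7,23],[965,2,963,6,10,949,926,75,811,658,479]),
    (971,883,[2,5,97],[1,2,967,965,10,18,40,890,810,650,481]),
    (977,414,[2,2,2,2,61],[975,2,972,971,12,953,928,883,187,376,489]),
    (983,887,[2,491],[1,981,3,6,975,19,946,74,145,293,486]),
    (991,708,[2,3,3,5,11],[989,2,4,986,10,968,947,81,822,334,496]),
    (997,354,[2,2,3,83],[995,994,3,6,9,19,37,76,845,692,499]),
    (1009,701,[2,2,2,2,3,3,7],[1,1006,1004,7,994,980,952,111,788,567,506]),
    (1013,137,[2,2,11,23],[1,1011,3,1007,1001,991,41,80,158,690,517]),
    (1019,690,[2,509],[1017,2,1015,7,1005,992,53,106,806,594,520]),
    (1021,751,[2,2,3,5,17],[1019,2,1017,7,13,1001,976,933,844,352,514]),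
    (1031,356,[2,5,103],[1029,1028,1027,7,13,1003,53,107,817,603,519]),
    (1033,827,[2,2,2,3,43],[1,2,4,1024,15,1001,970,909,789,489,507]),
    (1039,593,[2,3,173],[1,2,1035,1033,1029,1017,998,956,164,710,523]),
    (1049,243,[2,2,2,131],[1047,1046,1045,1042,11,1026,44,86,875,701,519]),
    (1051,457,[2,3,5,5,7],[1,1049,2,1045,1041,1033,1015,979,914,773,517]),
    (1061,302,[2,2,5,53],[1059,2,1056,7,1045,28,58,944,226,457,533])]"
  by (simp only: certificate_eval power_table_12 cong: if_weak_cong)

lemmas coverable_4 = all_certified_coverable[OF certs_4,
    unfolded list.map fst_conv list.pred_inject simp_thms]

lemma certs_5: "all_certified
    [(1063,804,[2,3,3,59],[1061,1060,1059,7,1053,1044,1023,79,906,749,534]),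
    (1069,461,[2,2,3,89],[1,1066,4,1062,1055,1041,1016,104,202,412,531]),
    (1087,1069,[2,3,181],[1,1084,1082,1080,1072,1058,1033,109,873,659,546]),
    (1091,149,[2,5,109],[1,1089,3,1087,1081,17,35,1020,952,277,549]),
    (1093,439,[2,2,3,7,13],[1,2,1088,5,1082,22,1047,89,179,735,545]),
    (1097,887,[2,2,2,137],[1,1094,3,1090,1084,1072,1048,97,904,386,550]),
    (1103,5,[2,19,29],[1,1100,1099,1097,11,22,45,1012,922,742,561]),
    (1109,33,[2,2,277],[1107,1106,3,7,14,1082,50,1005,204,699,558]),
    (1117,1039,[2,2,3,3,31],[1,2,3,6,12,1093,47,1022,189,377,554]),
    (1123,1069,[2,3,11,17],[1121,1120,4,6,1113,22,43,82,170,784,554]),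
    (1129,631,[2,2,2,3,47],[1,1126,4,7,15,28,1072,1017,224,449,557]),
    (1151,463,[2,5,5,23],[1,2,1146,1145,1137,22,1103,95,964,373,569]),
    (1153,671,[2,2,2,2,2,2,2,3,3],[1151,2,1149,1145,9,1131,1112,1071,165,328,582]),
    (1163,880,[2,7,83],[1161,1160,4,1156,14,28,1106,109,221,720,582]),
    (1171,241,[2,3,3,5,13],[1,1169,1167,1164,1160,1148,1128,85,169,832,588]),
    (1181,1087,[2,2,5,59],[1179,2,4,1172,1165,1154,55,1072,217,745,602]),
    (1187,974,[2,593],[1185,2,1184,5,1175,22,41,1101,1027,859,590]),
    (1193,929,[2,2,2,149],[1,1190,4,1184,10,1169,1152,1105,1016,841,598]),
    (1201,227,[2,2,2,2,3,5,5],[1,2,1196,8,11,1179,1153,1108,183,833,607]),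
    (1213,691,[2,2,3,101],[1,1210,4,6,12,1188,49,96,195,390,619]),
    (1217,125,[2,2,2,2,2,2,19],[1215,2,1213,6,1205,22,44,90,179,359,602]),
    (1223,1073,[2,13,47],[1221,1220,4,1215,1211,1206,1181,1141,1061,321,614]),
    (1229,898,[2,2,307],[1227,1226,1225,1222,12,23,48,96,186,852,615]),
    (1231,53,[2,3,5,41],[1,1228,1226,8,15,27,1173,114,1002,455,619]),
    (1237,811,[2,2,3,103],[1,1234,4,8,1220,1206,1176,1118,996,479,627]),
    (1249,1086,[2,2,2,2,2,3,13],[1247,1246,1245,5,1236,1225,1201,1154,184,882,625]),
    (1259,202,[2,17,37],[1257,1256,4,8,14,30,60,1140,238,782,631]),
    (1277,789,[2,2,11,29],[1275,1274,1272,6,1265,1252,49,1179,194,891,641]),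
    (1279,497,[2,3,3,71],[1277,1276,1274,1271,12,1253,51,100,190,889,641]),
    (1283,845,[2,641],[1281,2,1278,8,14,25,1229,1175,209,862,638]),
    (1289,601,[2,2,2,7,23],[1,2,1284,8,12,23,50,100,1091,893,643]),
    (1291,937,[2,3,5,43],[1289,2,3,7,14,1275,1249,80,164,964,643]),
    (1297,89,[2,2,2,2,3,3,3,3],[1,2,4,6,13,1272,49,1203,1104,914,651]),
    (1301,747,[2,2,5,5,13],[1299,2,4,1293,1287,1275,1250,102,1095,890,644]),
    (1303,1261,[2,3,7,31],[1301,2,1298,1294,12,1282,1256,94,1116,374,655]),
    (1307,1217,[2,653],[1,1304,1302,6,14,24,1259,99,198,393,655]),
    (1319,967,[2,659],[1,2,1314,1310,15,31,1256,124,248,496,657]),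
    (1321,1182,[2,2,2,3,5,11],[1319,2,1316,8,1305,31,60,1198,1078,836,661]),
    (1327,1039,[2,3,13,17],[1,1324,1322,8,13,29,1268,114,228,453,667]),
    (1361,131,[2,2,2,2,5,17],[1,2,4,8,15,1330,1308,1249,217,440,683]),
    (1367,691,[2,683],[1,1364,1362,1360,12,1341,1316,99,1167,387,675]),
    (1373,1327,[2,2,7,7,7],[1,1370,4,1364,15,1341,1310,1248,1127,881,683]),
    (1381,499,[2,2,3,5,23],[1379,1378,3,6,1369,23,1333,1287,187,370,677])]"
  by (simp only: certificate_eval power_table_12 cong: if_weak_cong)

lemmas coverable_5 = all_certified_coverable[OF certs_5,
    unfolded list.map fst_conv list.pred_inject simp_thms]

lemma certs_6: "all_certified
    [(1399,661,[2,3,233],[1,2,4,1391,1383,27,1343,1294,216,431,698]),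
    (1409,471,[2,2,2,2,2,2,2,11],[1407,1406,3,6,1395,24,1363,94,189,377,698]),
    (1423,563,[2,3,3,79],[1,2,4,1414,1406,24,1368,1320,212,1008,724]),
    (1427,487,[2,23,31],[1,1424,1422,5,13,26,1378,98,196,394,712]),
    (1429,1123,[2,2,3,7,17],[1,2,3,6,13,1405,1379,98,1235,389,712]),
    (1433,827,[2,2,2,179],[1,1430,4,8,14,1403,59,1314,236,965,713]),
    (1439,138,[2,719],[1437,2,4,6,1425,27,53,1332,211,418,720]),
    (1447,260,[2,3,241],[1445,1444,1442,1438,1430,1416,61,1323,1205,485,724]),
    (1451,228,[2,5,5,29],[1449,1448,1447,7,1436,22,1400,1352,198,1055,726]),
    (1453,1252,[2,2,3,11,11],[1451,1450,1448,1444,1438,1429,50,1351,1255,398,728]),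
    (1459,90,[2,3,3,3,3,3,3],[1457,1456,4,7,1443,1429,1408,1349,1240,425,737]),
    (1471,1148,[2,3,5,7,7],[1469,1468,1466,1463,1458,27,53,103,204,406,738]),
    (1481,137,[2,2,2,5,37],[1,2,1476,1474,14,28,53,105,213,1055,744]),
    (1483,907,[2,3,13,19],[1,1480,1479,7,1468,25,1432,100,1281,401,740]),
    (1487,943,[2,743],[1485,2,1482,1478,10,1462,50,98,1288,1105,750]),
    (1489,514,[2,2,2,2,3,31],[1487,2,3,1482,1475,25,1440,97,196,1096,751]),
    (1493,433,[2,2,373],[1,1490,1488,1485,1477,1466,1440,1384,216,426,749]),
    (1499,1289,[2,7,107],[1,1496,3,7,14,1470,1442,105,1292,1077,759]),
    (1511,967,[2,5,151],[1,2,1506,6,13,1483,1457,1403,213,425,764]),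
    (1523,199,[2,761],[1,2,1518,1514,1508,1500,1475,99,197,391,768]),
    (1531,800,[2,3,3,5,17],[1529,1528,4,7,1518,1504,1477,1424,209,1111,767]),
    (1543,431,[2,3,257],[1,1540,4,7,1528,1515,1491,102,1333,1129,770]),
    (1549,1453,[2,2,3,3,43],[1,1546,1544,6,14,1520,56,109,219,1108,777]),
    (1553,591,[2,2,2,2,97],[1551,1550,1548,1544,1539,29,54,1440,222,444,771]),
    (1559,1067,[2,19,41],[1557,2,4,7,1544,1529,1501,1443,225,1103,773]),
    (1567,271,[2,3,3,3,29],[1,1564,1562,8,15,1535,1504,123,1323,1081,786]),
    (1571,1559,[2,5,157],[1,1568,4,1563,14,1542,55,111,1348,1128,784]),
    (1579,239,[2,3,263],[1,2,4,1572,13,1552,1525,1473,210,1157,788]),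
    (1583,379,[2,7,113],[1,1580,3,7,14,25,1530,103,207,1173,790]),
    (1597,151,[2,2,3,7,19],[1,2,1593,1589,1582,28,56,109,1375,441,801]),
    (1601,544,[2,2,2,2,2,2,5,5],[1599,1598,4,1592,16,31,1537,1475,1350,1099,795]),
    (1607,881,[2,11,73],[1605,1604,1602,8,1593,26,53,1500,1393,1183,800]),
    (1609,223,[2,2,2,3,67],[1607,2,4,1600,1594,1583,1557,1504,1402,414,800]),
    (1613,183,[2,2,13,31],[1611,2,4,8,16,1580,64,1493,1377,1132,792]),
    (1619,491,[2,809],[1,1616,1614,1611,1603,1590,56,112,1393,448,799]),
    (1621,1340,[2,2,3,3,3,3,5],[1619,2,1616,8,16,1592,58,114,226,458,811]),
    (1627,173,[2,3,271],[1,2,4,7,1613,1600,1572,1520,1412,1200,811]),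
    (1637,1579,[2,2,409],[1,1634,1632,8,15,31,1583,108,1416,1200,812]),
    (1657,925,[2,2,2,3,3,23],[1655,1654,1652,1649,15,1627,57,1541,1426,1197,836]),
    (1663,1409,[2,3,277],[1661,1660,1658,8,14,1636,56,1556,1446,1237,825]),
    (1667,620,[2,7,7,17],[1665,1664,1662,8,1651,1635,54,1554,1438,1211,835]),
    (1669,617,[2,2,3,139],[1,2,4,1660,11,1641,1614,1564,1456,1245,828]),
    (1693,1597,[2,2,3,3,47],[1691,2,1688,1684,1676,32,1630,1569,247,486,844])]"
  by (simp only: certificate_eval power_table_12 cong: if_weak_cong)

lemmas coverable_6 = all_certified_coverable[OF certs_6,
    unfolded list.map fst_conv list.pred_inject simp_thms]

lemma certs_7: "all_certified
    [(1697,563,[2,2,2,2,2,53],[1,2,1692,1689,1681,1671,53,105,1484,425,847]),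
    (1699,11,[2,3,283],[1,1696,4,1690,1685,29,54,111,220,438,856]),
    (1709,118,[2,2,7,61],[1707,1706,4,8,15,1678,1647,122,244,485,850]),
    (1721,1327,[2,2,2,5,43],[1,1718,4,7,1705,29,59,1602,235,1251,866]),
    (1723,1565,[2,3,7,41],[1721,1720,4,1715,1708,1693,56,1609,1495,1268,863]),
    (1733,842,[2,2,433],[1731,2,3,1725,14,1704,1677,1621,1510,442,876]),
    (1741,683,[2,2,3,5,29],[1,1738,1736,8,1726,1713,56,1627,223,1298,873]),
    (1747,659,[2,3,3,97],[1,1744,1742,8,1732,1716,58,117,232,466,877]),
    (1753,1634,[2,2,2,3,73],[1751,2,1748,1744,1736,1723,59,1635,1515,1279,874]),
    (1759,919,[2,3,293],[1,2,1754,7,1744,29,1702,114,225,453,878]),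
    (1777,83,[2,2,2,2,3,37],[1,1774,1772,1769,1761,1746,59,1664,1545,1314,895]),
    (1783,166,[2,3,3,3,3,11],[1781,2,1778,8,1767,1751,62,1664,234,1308,883]),
    (1787,1321,[2,19,47],[1,2,1782,8,16,28,1726,1668,234,469,887]),
    (1789,379,[2,2,3,149],[1,1787,2,5,1778,19,1749,68,144,290,1208,898]),
    (1801,13,[2,2,2,3,3,5,5],[1,1798,1796,1795,1791,22,1758,86,167,1461,678,899]),
    (1811,907,[2,5,181],[1,1808,4,8,1794,29,54,1697,1582,454,908]),
    (1823,1607,[2,911],[1,1820,1818,1815,1807,1794,1764,1706,1594,457,910]),
    (1831,593,[2,3,5,61],[1,2,1826,8,1814,29,1771,1710,1594,468,913]),
    (1847,1022,[2,13,71],[1845,2,1842,8,16,1814,1783,1719,1592,507,921]),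
    (1861,709,[2,2,3,5,31],[1,2,1856,7,1845,1842,45,1774,1683,355,711,936]),
    (1867,126,[2,3,311],[1865,1864,4,1861,1854,25,1817,97,1673,386,774,934]),
    (1871,107,[2,5,11,17],[1869,2,3,1866,1859,1852,1835,1796,145,288,581,941]),
    (1873,1725,[2,2,2,2,3,3,13],[1871,2,1868,7,14,1855,44,1786,169,1527,1182,934]),
    (1877,109,[2,2,7,67],[1,2,1874,1873,1867,18,1843,1809,1741,1605,1338,941]),
    (1879,601,[2,3,313],[1,1877,2,1873,10,1858,40,1802,150,302,1283,935]),
    (1889,1323,[2,2,2,2,2,59],[1887,1886,4,5,1878,1869,1848,1807,156,1571,1255,941]),
    (1901,128,[2,2,5,5,19],[1899,1898,3,5,6,18,35,1829,1758,284,565,947]),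
    (1907,467,[2,953],[1,2,1902,1898,16,30,59,1786,240,480,956]),
    (1913,181,[2,2,2,239],[1,1910,1909,5,12,1900,35,71,140,280,1350,955]),
    (1931,1851,[2,5,193],[1929,2,4,8,16,1898,63,1803,1678,506,948]),
    (1933,1192,[2,2,3,7,23],[1931,1930,4,1924,1922,1906,1883,101,200,401,1133,974]),
    (1949,1456,[2,2,487],[1947,1946,1944,1940,16,1916,1885,1823,1697,1446,982]),
    (1951,365,[2,3,5,5,13],[1949,2,1946,1942,1934,19,1902,1867,180,362,1226,973]),
    (1973,617,[2,2,17,29],[1,2,1969,1965,13,27,1923,1869,1771,1565,1159,982]),
    (1979,43,[2,23,43],[1977,1976,3,1971,1965,27,1925,1876,1769,1565,1147,993]),
    (1987,193,[2,3,331],[1,2,4,8,14,1956,1926,120,1746,1508,954,991]),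
    (1993,1733,[2,2,2,3,83],[1,2,1988,8,1978,30,1935,1875,1760,1529,928,995]),
    (1997,1237,[2,2,499],[1,2,1992,6,1985,1971,49,98,1801,385,1221,996]),
    (1999,1889,[2,3,3,3,37],[1,1996,1995,7,12,1977,47,1904,1812,374,747,1013]),
    (2003,923,[2,7,11,13],[2001,2000,3,1995,1993,1980,1958,89,1824,1650,1296,998]),
    (2011,1875,[2,3,5,67],[2009,2,2006,2004,13,27,49,102,1809,400,803,1012]),
    (2017,640,[2,2,2,2,2,3,3,7],[2015,2,2012,2010,2002,1988,1964,1911,1817,1608,820,1012]),
    (2027,1723,[2,1013],[1,2,3,7,2013,2003,47,97,176,1658,1288,1011])]"
  by (simp only: certificate_eval power_table_12 cong: if_weak_cong)

lemmas coverable_7 = all_certified_coverable[OF certs_7,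
    unfolded list.map fst_conv list.pred_inject simp_thms]

lemma certs_8: "all_certified
    [(2029,193,[2,2,3,13,13],[1,2027,2,5,2020,2010,36,70,1886,1745,565,1012]),
    (2039,1499,[2,1019],[1,2037,2,2033,2028,2020,2000,73,1893,291,585,1025]),
    (2053,257,[2,2,3,3,3,19],[1,2,4,2044,2038,2023,1993,117,1822,465,1125,1022]),
    (2063,1249,[2,1031],[2061,2,2058,8,13,28,53,107,211,426,852,1026]),
    (2069,1069,[2,2,11,47],[1,2,2066,2063,2059,2054,2034,2001,133,263,531,1024]),
    (2081,954,[2,2,2,2,2,5,13],[2079,2,3,2075,12,2056,2036,1988,184,1713,730,1031]),
    (2083,1474,[2,3,347],[2081,2,3,6,2070,25,2042,1995,166,336,679,1045]),
    (2087,443,[2,7,149],[1,2,2084,2081,7,2068,33,69,138,272,546,1039]),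
    (2089,1039,[2,2,2,3,3,29],[2087,2,2084,7,2075,2062,2035,106,211,418,1248,1049]),
    (2099,1179,[2,1049],[2097,2,4,2092,9,21,2055,87,1927,1753,1410,1047]),
    (2111,683,[2,5,211],[1,2,2106,7,2097,2082,2054,1998,224,447,1216,1059]),
    (2113,857,[2,2,2,2,2,2,3,11],[1,2111,2109,2106,2101,21,2074,81,158,320,636,1059]),
    (2129,1957,[2,2,2,2,7,19],[2127,2,4,2120,2113,2099,2072,2013,1898,1669,1208,1051]),
    (2131,1223,[2,3,5,71],[1,2128,2127,7,2118,15,38,2051,1972,1819,1504,1067]),
    (2137,759,[2,2,2,3,89],[2135,2134,4,5,2125,23,2092,2046,1955,1774,1418,1079]),
    (2141,1497,[2,2,5,107],[2139,2,3,6,2132,21,2101,2063,1986,309,620,1065]),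
    (2143,1627,[2,3,3,7,17],[1,2140,3,2135,2133,22,38,82,158,322,644,1073]),
    (2153,1071,[2,2,2,269],[2151,2150,2149,6,10,23,2106,91,1972,363,726,1072]),
    (2161,1069,[2,2,2,2,3,3,3,5],[2159,2,4,8,2146,2130,2100,120,1921,479,1202,1072]),
    (2179,2023,[2,3,3,11,11],[2177,2,2175,5,2168,22,44,2091,2005,346,694,1093]),
    (2203,1693,[2,3,367],[1,2201,2199,4,10,2182,2163,2126,2048,306,613,1110]),
    (2207,1811,[2,1103],[1,2204,4,8,2195,26,52,104,1997,416,830,1099]),
    (2213,499,[2,2,7,79],[1,2211,3,2206,2202,22,44,70,158,314,1582,1104]),
    (2221,1064,[2,2,3,5,37],[2219,2,2216,2214,2210,21,2175,2131,2042,356,1511,1108]),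
    (2237,1171,[2,2,13,43],[1,2234,3,2230,2223,2210,52,2134,2031,398,1427,1110]),
    (2239,337,[2,3,373],[2237,2,4,2231,2227,23,2195,2147,2059,362,721,1117]),
    (2243,2048,[2,19,59],[2241,2,2238,7,15,2222,39,84,173,343,1554,1118]),
    (2251,328,[2,3,3,5,5,5],[2249,2,4,2244,2238,26,2202,100,2052,396,792,1132]),
    (2267,2076,[2,11,103],[2265,2264,3,7,14,25,50,94,2069,387,1488,1134]),
    (2269,311,[2,2,3,3,3,3,7],[1,2,2264,2260,2258,2243,2219,2169,2070,397,1474,1140]),
    (2273,691,[2,2,2,2,2,71],[1,2,2270,4,2262,2252,39,2196,149,300,603,1130]),
    (2281,1237,[2,2,2,3,5,19],[1,2278,4,8,2266,2259,45,2195,2102,356,1567,1143]),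
    (2287,66,[2,3,3,127],[2285,2,3,2281,2276,22,2245,2201,2120,334,1616,1144]),
    (2293,1423,[2,2,3,191],[1,2290,2289,2285,13,27,42,93,2105,376,1540,1148]),
    (2297,449,[2,2,2,7,41],[1,2295,2293,6,12,2274,2251,2207,173,350,703,1151]),
    (2309,11,[2,2,577],[1,2306,4,8,13,2283,2258,2207,204,408,817,1153]),
    (2311,195,[2,3,5,7,11],[2309,2308,3,2304,11,2287,46,91,183,364,729,1162]),
    (2333,947,[2,2,11,53],[1,2,2328,7,13,27,54,106,212,422,1487,1178]),
    (2339,1354,[2,7,167],[2337,2,2335,2331,11,25,2290,89,187,1964,748,1167]),
    (2341,1093,[2,2,3,3,5,13],[1,2,2336,2333,12,19,2297,2257,2168,343,687,1165]),
    (2347,187,[2,3,17,23],[2345,2,3,6,2333,23,49,2256,2158,375,1595,1181]),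
    (2351,2063,[2,5,5,47],[2349,2,4,2346,10,2330,42,77,2199,309,1732,1187]),
    (2357,180,[2,2,19,31],[2355,2,4,2350,2349,2335,2318,2278,158,2040,1726,1176])]"
  by (simp only: certificate_eval power_table_12 cong: if_weak_cong)

lemmas coverable_8 = all_certified_coverable[OF certs_8,
    unfolded list.map fst_conv list.pred_inject simp_thms]

lemma certs_9: "all_certified
    [(2371,390,[2,3,5,79],[2369,2368,2367,6,11,23,42,2285,166,2030,1698,1188]),
    (2377,503,[2,2,2,3,3,3,11],[1,2374,2373,2371,2364,24,46,94,186,2010,1641,1201]),
    (2381,953,[2,2,5,7,17],[1,2378,2376,2372,2371,23,2333,2289,2197,365,1647,1197]),
    (2383,823,[2,3,397],[1,2,2378,2374,2369,28,2325,111,2157,1933,895,1181]),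
    (2389,1869,[2,2,3,199],[2387,2386,3,5,2380,2368,39,78,2232,2077,1771,1188]),
    (2393,702,[2,2,2,13,23],[2391,2,4,6,2382,2372,2348,2304,2218,2048,1701,1205]),
    (2399,1499,[2,11,109],[2397,2396,4,7,2385,20,48,2304,188,2021,755,1193]),
    (2411,587,[2,5,241],[1,2,2406,2405,2399,22,41,2323,2242,342,1728,1203]),
    (2417,1832,[2,2,2,2,151],[2415,2414,2412,2410,13,2391,2364,2312,2209,2002,828,1205]),
    (2423,1531,[2,7,173],[1,2420,4,8,13,29,57,2309,217,1978,885,1220]),
    (2437,271,[2,2,3,7,29],[2435,2,4,6,2428,20,38,2357,159,313,630,1208]),
    (2441,1248,[2,2,2,5,61],[2439,2438,2436,2432,14,30,56,116,228,1982,1522,1221]),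
    (2447,23,[2,1223],[1,2444,4,8,2435,2419,2393,2346,203,406,1631,1218]),
    (2459,1437,[2,1229],[2457,2456,2454,8,13,2430,2401,2353,213,2026,863,1226]),
    (2467,601,[2,3,3,137],[2465,2,4,2460,12,2440,51,2371,197,393,1688,1238]),
    (2473,83,[2,2,2,3,103],[1,2470,4,2464,15,27,2414,111,2246,2020,902,1239]),
    (2477,419,[2,2,619],[1,2474,4,7,2461,2452,53,2375,206,405,1657,1254]),
    (2503,572,[2,3,3,139],[2501,2500,3,4,2492,2482,41,2422,158,2192,629,1252]),
    (2521,23,[2,2,2,3,3,5,7],[1,2519,3,2514,2511,2499,42,2437,2359,2193,655,1266]),
    (2531,384,[2,5,11,23],[2529,2528,4,8,13,2512,2484,93,2344,372,1786,1267]),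
    (2539,431,[2,3,3,3,47],[1,2536,4,2534,12,2515,47,94,183,370,741,1258]),
    (2543,5,[2,31,41],[1,2540,2538,2536,14,2517,53,2438,2333,2125,830,1279]),
    (2549,1075,[2,2,7,7,13],[2547,2546,3,2541,2534,27,2494,2440,215,2122,857,1276]),
    (2551,787,[2,3,5,5,17],[1,2,4,2542,15,30,61,2428,2307,2069,1584,1284]),
    (2557,379,[2,2,3,3,71],[1,2,2553,6,2543,2532,2506,98,2363,2169,1781,1276]),
    (2579,1928,[2,1289],[2577,2576,4,2570,15,30,2523,2463,2352,457,1664,1286]),
    (2591,389,[2,5,7,37],[1,2589,3,6,11,2568,2547,2502,2414,352,704,1291]),
    (2593,974,[2,2,2,2,2,3,3,3,3],[2591,2590,2588,2586,2581,24,49,2503,187,370,1849,1297]),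
    (2609,911,[2,2,2,2,163],[1,2607,2605,2602,2596,2585,2561,2514,2420,2235,1860,1302]),
    (2617,307,[2,2,2,3,109],[1,2,2612,2608,2602,2586,58,2498,2387,463,1689,1303]),
    (2621,661,[2,2,5,131],[1,2618,4,2612,2604,2602,46,94,2431,2246,1868,1305]),
    (2633,2029,[2,2,2,7,47],[1,2630,4,2625,2622,2609,2589,2542,2452,357,1914,1318]),
    (2647,7,[2,3,3,3,7,7],[2645,2644,2642,6,11,2621,39,89,2471,2293,706,1317]),
    (2657,650,[2,2,2,2,2,83],[2655,2,2653,2649,10,22,2611,91,2475,2296,722,1319]),
    (2659,837,[2,3,443],[2657,2656,2654,2650,15,24,2604,106,214,2232,846,1332]),
    (2663,2381,[2,11,11,11],[2661,2660,2658,2654,15,31,60,122,2426,2183,1704,1336]),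
    (2671,2399,[2,3,5,89],[1,2,2667,7,2657,2644,53,2568,207,2255,830,1328]),
    (2677,914,[2,2,3,223],[2675,2674,4,7,15,28,52,110,2457,2239,1807,1334]),
    (2683,2113,[2,3,3,149],[2681,2,4,2675,2670,22,48,2586,192,2298,767,1352]),
    (2687,340,[2,17,79],[2685,2,2682,2680,2673,27,2638,2588,198,2293,791,1344]),
    (2689,71,[2,2,2,2,2,2,2,3,7],[1,2686,2684,6,13,26,49,2588,195,396,793,1346]),
    (2693,1817,[2,2,673],[2691,2690,3,2685,2679,2665,2639,104,206,413,1863,1351]),
    (2699,1451,[2,19,71],[1,2,4,2690,16,2666,2652,2596,2487,422,1855,1352])]"
  by (simp only: certificate_eval power_table_12 cong: if_weak_cong)

lemmas coverable_9 = all_certified_coverable[OF certs_9,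
    unfolded list.map fst_conv list.pred_inject simp_thms]

lemma certs_10: "all_certified
    [(2707,2556,[2,3,11,41],[2705,2704,3,2700,2693,2682,43,2618,174,2351,701,1354]),
    (2711,1524,[2,5,271],[2709,2708,4,6,2696,27,55,107,2494,2290,853,1356]),
    (2713,934,[2,2,2,3,113],[2711,2,4,2705,2700,2687,47,95,2528,378,753,1353]),
    (2719,2339,[2,3,3,151],[2717,2,3,7,13,2699,45,2631,178,2362,2007,1373]),
    (2729,92,[2,2,2,11,31],[2727,2,2724,2721,13,2702,48,2627,2528,391,792,1371]),
    (2731,7,[2,3,5,7,13],[1,2729,2727,2724,12,22,46,91,2547,363,722,1382]),
    (2741,2378,[2,2,5,137],[2739,2738,4,8,2727,28,2683,108,220,442,1859,1373]),
    (2749,863,[2,2,3,229],[1,2,2744,2742,12,2725,46,2661,2566,359,2025,1378]),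
    (2753,2272,[2,2,2,2,2,2,43],[2751,2,2748,8,2736,2721,63,126,2506,2255,1765,1370]),
    (2767,194,[2,3,461],[2765,2764,2762,2758,2756,25,2716,2665,198,2366,800,1376]),
    (2777,109,[2,2,2,347],[1,2,3,2769,2762,2757,2734,89,2598,348,2075,1393]),
    (2789,1481,[2,2,17,41],[1,2786,4,8,2772,2758,58,2674,2566,2334,909,1412]),
    (2791,2467,[2,3,3,5,31],[1,2,3,2784,2777,26,48,2693,2595,2398,783,1394]),
    (2797,139,[2,2,3,233],[1,2794,3,7,14,2770,2753,94,2606,380,2045,1397]),
    (2801,1953,[2,2,2,2,5,5,7],[2799,2798,2797,2793,13,2775,2753,99,196,393,782,1405]),
    (2803,1637,[2,3,467],[1,2,2798,2796,2789,27,2752,104,2595,413,1975,1398]),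
    (2819,474,[2,1409],[2817,2816,2814,2811,2806,26,53,103,208,414,829,1406]),
    (2833,1543,[2,2,2,2,3,59],[1,2,2828,2824,2817,29,2777,2720,225,2382,1936,1415]),
    (2837,1885,[2,2,709],[2835,2,3,5,2824,22,2792,2746,180,360,2118,1415]),
    (2843,2721,[2,7,7,29],[2841,2840,3,2835,2828,27,54,2736,2628,2417,850,1415]),
    (2851,2777,[2,3,5,5,19],[1,2848,2846,2843,2838,26,2803,95,2657,2462,774,1433]),
    (2857,360,[2,2,2,3,7,17],[2855,2854,4,5,11,2832,2809,2763,2674,368,733,1431]),
    (2861,1031,[2,2,5,11,13],[1,2858,2856,2853,2845,23,2815,2765,192,385,769,1421]),
    (2879,975,[2,1439],[2877,2876,4,7,2864,2849,58,2768,2652,451,1975,1442]),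
    (2887,2498,[2,3,13,37],[2885,2884,4,8,2871,31,2825,2763,239,479,964,1444]),
    (2897,1277,[2,2,2,2,181],[1,2894,2892,2890,2882,2869,2841,2786,217,437,2024,1439]),
    (2903,452,[2,1451],[2901,2900,2898,7,13,2874,54,2809,2700,2499,807,1442]),
    (2909,2467,[2,2,727],[2907,2,3,6,13,2883,51,2810,198,2510,2112,1451]),
    (2917,2819,[2,2,3,3,3,3,3,3],[1,2,2912,5,2903,2891,2865,2814,2714,2512,808,1457]),
    (2927,424,[2,7,11,19],[2925,2,4,8,16,2896,2864,124,2678,2432,1939,1464]),
    (2939,2039,[2,13,113],[1,2936,4,2930,16,2907,63,121,2692,493,985,1468]),
    (2953,2723,[2,2,2,3,3,41],[2951,2950,4,7,15,26,55,2846,2738,2523,2095,1466]),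
    (2957,2879,[2,2,739],[1,2954,2952,8,16,30,62,124,248,2463,1971,1491]),
    (2963,397,[2,1481],[2961,2960,2958,2956,2948,2939,2915,2864,196,2585,2197,1483]),
    (2969,1799,[2,2,2,7,53],[2967,2,4,5,2955,2943,2920,97,196,387,2197,1482]),
    (2971,2039,[2,3,3,3,5,11],[1,2968,4,2962,2957,2945,2917,2867,2760,419,2136,1487]),
    (2999,442,[2,1499],[2997,2996,2995,2991,2984,28,2944,108,214,430,861,1500])]"
  by (simp only: certificate_eval power_table_12 cong: if_weak_cong)

lemmas coverable_10 = all_certified_coverable[OF certs_10,
    unfolded list.map fst_conv list.pred_inject simp_thms]


text \<open>Two listed primes carry no certificate: 7 is a genuine exception, and 3001 falls under
  the argument for large primes.\<close>

lemma coverable_list: "list_all (\<lambda>p. p = 7 \<or> p = 3001 \<or> coverable p) (concat blocks_3000)"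
  by (simp only: blocks_3000_def concat.simps append.simps list.pred_inject arith_eval
      coverable_37_157 coverable_1 coverable_2 coverable_3 coverable_4 coverable_5 coverable_6 coverable_7 coverable_8 coverable_9 coverable_10)

lemma cover_below_3000:
  assumes "prime p" "11 \<le> p" "p < 3001" "0 < a" "a < (p :: int)"
  shows "\<exists>S. finite S \<and> (\<forall>q\<in>S. prime q \<and> q < p) \<and> [\<Prod>S = a] (mod p)"
proof -
  have "p \<in> set (concat blocks_3000)"
    using assms by (intro in_prime_blocks[OF prime_blocks_3000]) auto
  then have "p = 7 \<or> p = 3001 \<or> coverable p"
    using coverable_list unfolding list_all_iff by blast
  moreover have "p \<noteq> 7" "p \<noteq> 3001" using assms by simp_all
  ultimately have "coverable p" by blast
  moreover have "2 < p" using assms by simp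
  ultimately show ?thesis using assms(1,4,5) unfolding coverable_def by blast
qed

section \<open>Squarefree smooth representatives\<close>

lemma squarefree_smooth_if_cover:
  assumes S: "finite S" "\<forall>q\<in>S. prime q \<and> q < p" "[\<Prod>S = a] (mod p)"
  shows "\<exists>n::int. n > 0 \<and> squarefree n \<and> smooth (of_int p) n \<and> [n = a] (mod p)"
proof (intro exI conjI)
  show "\<Prod>S > 0" using S by (intro prod_pos) (auto simp: prime_gt_0_int)
  show "squarefree (\<Prod>S)"
    using S by (intro squarefree_prod_coprime) (auto intro: primes_coprime squarefree_prime)
  show "smooth (of_int p) (\<Prod>S)"
    unfolding smooth_def
  proof (intro allI impI)
    fix q :: int assume "prime q" "q dvd \<Prod>S"
    then obtain r where "r \<in> S" "q dvd r"
      using S(1) prime_dvd_prod_iff[of S q "\<lambda>x. x"] by auto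
    then have "q = r" using S(2) \<open>prime q\<close> primes_dvd_imp_eq by blast
    then show "real_of_int q \<le> real_of_int p" using S(2) \<open>r \<in> S\<close> by auto
  qed
qed (rule S)

theorem theorem1:
  fixes p a :: int
  assumes "prime p" and "p \<noteq> 5" and "p \<noteq> 7"
  shows "\<exists>n::int. n > 0 \<and> squarefree n \<and> smooth (of_int p) n \<and> [n = a] (mod p)"
proof (cases "p dvd a")
  case True
  have "smooth (of_int p) p"
    using assms(1) by (auto simp: smooth_def dest: primes_dvd_imp_eq)
  moreover have "[p = a] (mod p)" using True by (simp add: cong_def mod_eq_0_iff_dvd)
  ultimately show ?thesis
    using assms(1) by (intro exI[of _ p]) (auto simp: prime_gt_0_int squarefree_prime)
next
  case False
  define b where "b = a mod p"
  have p: "p > 1" using assms(1) by (rule prime_gt_1_int)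
  have b: "0 < b" "b < p"
  proof -
    have "b \<noteq> 0" using False by (simp add: b_def dvd_eq_mod_eq_0)
    moreover have "0 \<le> b" unfolding b_def using p by simp
    ultimately show "0 < b" by simp
    show "b < p" unfolding b_def using p by simp
  qed
  have "\<exists>S. finite S \<and> (\<forall>q\<in>S. prime q \<and> q < p) \<and> [\<Prod>S = b] (mod p)"
  proof -
    consider "p < 11" | "11 \<le> p" "p < 3001" | "3001 \<le> p" by linarith
    then show ?thesis
    proof cases
      case 1
      then have "p \<in> set [2..10]" unfolding set_upto using p by simp
      then have "p = 2 \<or> p = 3"
        using assms by (simp add: upto_rec_numeral del: set_upto) (elim disjE; simp)
      then consider "b = 1" | "p = 3" "b = 2" using b by linarith
      then show ?thesis
      proof cases
        case 1
        then show ?thesis by (intro exI[of _ "{}"]) simp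
      next
        case 2
        then show ?thesis by (intro exI[of _ "{2}"]) simp
      qed
    next
      case 2
      show ?thesis by (rule cover_below_3000[OF assms(1) 2 b])
    next
      case 3
      define P where "P = nat p"
      have P: "p = int P" "prime P"
        using assms(1) p prime_int_nat_transfer[of p] unfolding P_def by linarith+
      interpret prime_units P "units_of (residue_ring (int P))"
        by unfold_locales (rule P(2))
      have "3000 \<le> P - 1" "b < int P" using 3 b(2) P(1) by linarith+
      from cover_from_3000[OF this(1) b(1) this(2) card_primes_upto_3000]
      show ?thesis unfolding P(1) .
    qed
  qed
  then obtain S where S: "finite S" "\<forall>q\<in>S. prime q \<and> q < p" "[\<Prod>S = b] (mod p)" by blast
  have "[b = a] (mod p)" by (simp add: b_def)
  with S(3) have "[\<Prod>S = a] (mod p)" by (rule cong_trans)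
  with S(1,2) show ?thesis by (rule squarefree_smooth_if_cover)
qed

end
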